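(* Let $N\ge1$, $1\le m\le N$, $A\in\mathbb R^{N\times N}$ diagonalizable over $\mathbb R$, $B\in\mathbb R^{N\times m}$, $T>0$, and let $\mathcal O$ be either $\mathbb R$ or a set satisfying the bounded-gap condition (BG). (1) Failure of observability without the Kalman condition. Assume that $\operatorname{rank}(B,AB,\dots,A^{N-1}B)=r<N$. Then there exists a nontrivial subspace $\mathcal U\subset\mathbb R^N$ such that, for every $v\in\mathcal U$, $$B^\top e^{i\xi(T-t)A^\top}v=0\quad\text{for all }t\in[0,T]\text{ and all }\xi\in\mathbb R .$$ This subspace coincides with the orthogonal complement of the Kalman space $\mathcal K_{N-1}=\operatorname{Ran}(B,AB,\dots,A^{N-1}B)$. Consequently, no observability inequality $\|q_T\|_X^2\le C\int_0^T\int_{\mathcal O}|B^\top q|^2\,dx\,dt$ can hold in any norm $\|\cdot\|_X$ that is nondegenerate on $\mathcal U$ (i.e. for which there is a terminal datum $q_T$ with values in $\mathcal U$ and $\|q_T\|_X\ne0$). In particular, exact controllability of $y_t+Ay_x=B\chi_{\mathcal O}u$ on the whole state space $L^2(\mathbb R;\mathbb R^N)$ with controls $u\in L^2((0,T)\times\mathcal O;\mathbb R^m)$ fails. (2) Optimality of the weights. Assume that $(A,B)$ satisfies the Kalman rank condition with Kalman index $K$. Fix $k\in\{0,\dots,K\}$ such that $\mathcal V_k\ne\{0\}$ and let $w:\mathbb R\to[0,\infty)$ be a measurable weight satisfying $w(\xi)/|\xi|^{2k}\to+\infty$ as $\xi\to0$. Then there is no constant $C>0$ such that, for every terminal datum $q_T\in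 L^2(\mathbb R;\mathbb R^N)$ and corresponding adjoint solution $q$, $$\int_{\mathbb R}w(\xi)\,|\Pi_k\widehat q_T(\xi)|^2\,d\xi\le C\int_0^T\int_{\mathcal O}|B^\top q|^2\,dx\,dt .$$ Consequently, among Hilbert spaces whose norms are defined by block-diagonal Fourier multipliers adapted to the Kalman decomposition, i.e. $\|q\|^2=\sum_{k=0}^K\int_{\mathbb R}w_k(\xi)|\Pi_k\widehat q(\xi)|^2\,d\xi$, the space $\mathcal Y_K^-$ (for which $w_k=\rho_k$) is sharp: on each nontrivial Kalman layer, its low-frequency weight cannot be replaced by a uniformly stronger one (one with $w_k(\xi)/|\xi|^{2k}\to+\infty$ as $\xi\to0$) while preserving observability.
   Context: Fourier convention: $\widehat f(\xi)=\int_{\mathbb R}f(x)e^{-ix\xi}\,dx$. Kalman rank condition with Kalman index $K$: $K\ge0$ is the smallest integer such that $\operatorname{rank}(B,AB,\dots,A^KB)=N$. Kalman layers: $\mathcal K_k=\operatorname{Ran}(B,AB,\dots,A^kB)\subset\mathbb R^N$, $\mathcal K_{-1}=\{0\}$, $\mathcal V_k=\mathcal K_k\cap\mathcal K_{k-1}^\perp$ for $k=0,\dots,K$ (orthogonality for the Euclidean inner product), so $\mathbb R^N=\bigoplus_{k=0}^K\mathcal V_k$; $\Pi_k$ is the orthogonal projector onto $\mathcal V_k$, extended complex-linearly to $\mathbb C^N$. Weights: $\rho_k(\xi)=\min\{|\xi|^{2k},1\}$. The space $\mathcal Y_K^-$ is the Hilbert completion of the Schwartz space $\mathcal S(\mathbb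 R;\mathbb C^N)$ for the norm $\|q\|_{\mathcal Y_K^-}^2=\sum_{k=0}^K\int_{\mathbb R}\rho_k(\xi)|\Pi_k\widehat q(\xi)|^2\,d\xi$. Adjoint system: $q_t+A^\top q_x=0$ in $(0,T)\times\mathbb R$, $q(T,\cdot)=q_T$; its solution satisfies $\widehat q(t,\xi)=e^{i\xi(T-t)A^\top}\widehat q_T(\xi)$. Bounded-gap condition (BG): $\mathcal O=\bigcup_{n\in\mathbb Z}(a_n,b_n)$ with $a_n<b_n<a_{n+1}$ for all $n\in\mathbb Z$, $\inf_n(b_n-a_n)>0$ and $\sup_n(a_{n+1}-b_n)<\infty$. *)

theory Defs
  imports "HOL-Analysis.Analysis"
begin

section \<open>Matrices\<close>

text \<open>The type class multiplication on \<open>'a^'n^'n\<close> is componentwise, so the type class power and \<open>exp\<close>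
  are not the matrix ones; both are defined here from the matrix product \<open>**\<close>.\<close>

definition matpow :: "'a::semiring_1^'n^'n \<Rightarrow> nat \<Rightarrow> 'a^'n^'n" where
  "matpow M k = (((**) M) ^^ k) (mat 1)"

definition matexp :: "complex^'n^'n \<Rightarrow> complex^'n^'n" where
  "matexp M = (\<Sum>k. (1 / fact k) *\<^sub>R matpow M k)"

definition diagonalizable_over_reals :: "real^'n^'n \<Rightarrow> bool" where
  "diagonalizable_over_reals A \<longleftrightarrow>
     (\<exists>P D :: real^'n^'n. invertible P \<and> (\<forall>i j. i \<noteq> j \<longrightarrow> D $ i $ j = 0) \<and> A = P ** D ** matrix_inv P)"

definition cvec :: "real^'n \<Rightarrow> complex^'n" where
  "cvec v = (\<chi> i. complex_of_real (v $ i))"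

definition cmat :: "real^'n^'m \<Rightarrow> complex^'n^'m" where
  "cmat M = map_matrix complex_of_real M"


section \<open>Kalman spaces and layers\<close>

text \<open>The range of the block matrix \<open>(B, AB, \<dots>, A\<^sup>kB)\<close>; the block vector it is applied to is the
  family \<open>u 0, \<dots>, u k\<close>. The rank of the block matrix is the dimension of this space.\<close>

definition kalman_space :: "real^'n^'n \<Rightarrow> real^'m^'n \<Rightarrow> nat \<Rightarrow> (real^'n) set" where
  "kalman_space A B k = range (\<lambda>u :: nat \<Rightarrow> real^'m. \<Sum>j\<le>k. (matpow A j ** B) *v u j)"

definition kalman_rank :: "real^'n^'n \<Rightarrow> real^'m^'n \<Rightarrow> nat \<Rightarrow> nat" where
  "kalman_rank A B k = dim (kalman_space A B k)"

definition kalman_index :: "real^'n^'n \<Rightarrow> real^'m^'n \<Rightarrow> nat \<Rightarrow> bool" where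
  "kalman_index A B K \<longleftrightarrow>
     kalman_rank A B K = CARD('n) \<and> (\<forall>j<K. kalman_rank A B j \<noteq> CARD('n))"

text \<open>The case \<open>k = 0\<close> encodes the convention that the Kalman space of index \<open>-1\<close> is zero.\<close>

definition kalman_layer :: "real^'n^'n \<Rightarrow> real^'m^'n \<Rightarrow> nat \<Rightarrow> (real^'n) set" where
  "kalman_layer A B k =
     kalman_space A B k \<inter> (case k of 0 \<Rightarrow> {0} | Suc j \<Rightarrow> kalman_space A B j)\<^sup>\<bottom>"

definition orth_proj :: "(real^'n) set \<Rightarrow> real^'n \<Rightarrow> real^'n" where
  "orth_proj S x = (THE p. p \<in> S \<and> x - p \<in> S\<^sup>\<bottom>)"

definition kalman_proj :: "real^'n^'n \<Rightarrow> real^'m^'n \<Rightarrow> nat \<Rightarrow> complex^'n \<Rightarrow> complex^'n" where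
  "kalman_proj A B k z =
     cvec (orth_proj (kalman_layer A B k) (\<chi> i. Re (z $ i))) +
     \<i> *s cvec (orth_proj (kalman_layer A B k) (\<chi> i. Im (z $ i)))"


section \<open>Function spaces and the Fourier transform\<close>

text \<open>Elements of \<open>L\<^sup>2\<close> are given by Borel representatives; equality in \<open>L\<^sup>2\<close> is equality almost
  everywhere.\<close>

definition L2_on :: "'a::euclidean_space set \<Rightarrow> ('a \<Rightarrow> 'b::euclidean_space) set" where
  "L2_on S = {f. set_borel_measurable lborel S f \<and>
                 set_integrable lborel S (\<lambda>x. (norm (f x))\<^sup>2)}"

definition L2_dist_sq :: "(real \<Rightarrow> 'b::euclidean_space) \<Rightarrow> (real \<Rightarrow> 'b) \<Rightarrow> ennreal" where
  "L2_dist_sq f g = (\<integral>\<^sup>+x. ennreal ((norm (f x - g x))\<^sup>2) \<partial>lborel)"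

definition schwartz :: "(real \<Rightarrow> 'b::euclidean_space) set" where
  "schwartz = {f. \<exists>D :: nat \<Rightarrow> real \<Rightarrow> 'b. D 0 = f \<and>
     (\<forall>j x. (D j has_vector_derivative D (Suc j) x) (at x)) \<and>
     (\<forall>j l. bounded (range (\<lambda>x. x ^ l *\<^sub>R D j x)))}"

definition truncated_fourier :: "real \<Rightarrow> (real \<Rightarrow> complex^'n) \<Rightarrow> real \<Rightarrow> complex^'n" where
  "truncated_fourier R f \<xi> = (LINT x:{-R..R}|lborel. exp (- \<i> * of_real (x * \<xi>)) *s f x)"

text \<open>The Fourier(--Plancherel) transform on \<open>L\<^sup>2\<close>, normalised by the kernel \<open>exp (-i x \<xi>)\<close> without
  prefactor: the limit in \<open>L\<^sup>2\<close> of the transforms of the truncations. It is determined up to null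
  sets only, hence the choice of a representative.\<close>

definition fourier :: "(real \<Rightarrow> complex^'n) \<Rightarrow> real \<Rightarrow> complex^'n" where
  "fourier f = (SOME g. g \<in> L2_on UNIV \<and>
     ((\<lambda>R. L2_dist_sq (truncated_fourier R f) g) \<longlongrightarrow> 0) at_top)"

definition fourier_real :: "(real \<Rightarrow> real^'n) \<Rightarrow> real \<Rightarrow> complex^'n" where
  "fourier_real f = fourier (\<lambda>x. cvec (f x))"


section \<open>First-order systems\<close>

text \<open>\<open>test_fun T \<phi> \<phi>t \<phi>x\<close>: \<open>\<phi>\<close> is a continuously differentiable function of \<open>(t, x)\<close> with partial
  derivatives \<open>\<phi>t\<close> and \<open>\<phi>x\<close>, and it is compactly supported in \<open>x\<close>, uniformly for \<open>t\<close> in \<open>[0, T]\<close>.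
  It need not vanish at \<open>t = 0\<close> or \<open>t = T\<close>.\<close>

definition test_fun ::
  "real \<Rightarrow> (real \<times> real \<Rightarrow> real^'n) \<Rightarrow> (real \<times> real \<Rightarrow> real^'n) \<Rightarrow> (real \<times> real \<Rightarrow> real^'n) \<Rightarrow> bool" where
  "test_fun T \<phi> \<phi>t \<phi>x \<longleftrightarrow>
     (\<forall>t x. ((\<lambda>s. \<phi> (s, x)) has_vector_derivative \<phi>t (t, x)) (at t)) \<and>
     (\<forall>t x. ((\<lambda>z. \<phi> (t, z)) has_vector_derivative \<phi>x (t, x)) (at x)) \<and>
     continuous_on UNIV \<phi>t \<and> continuous_on UNIV \<phi>x \<and>
     (\<exists>R. \<forall>t\<in>{0..T}. \<forall>x. R < \<bar>x\<bar> \<longrightarrow> \<phi> (t, x) = 0)"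

text \<open>\<open>y\<close> is a (weak) solution in \<open>C([0,T]; L\<^sup>2)\<close> of \<open>y\<^sub>t + M y\<^sub>x = F\<close> on \<open>(0,T) \<times> \<real>\<close>: the equation is
  multiplied by a test function and integrated by parts over \<open>(0,\<tau>) \<times> \<real>\<close>, for every \<open>\<tau>\<close>.\<close>

definition transport_solution ::
  "real \<Rightarrow> real^'n^'n \<Rightarrow> (real \<times> real \<Rightarrow> real^'n) \<Rightarrow> (real \<Rightarrow> real \<Rightarrow> real^'n) \<Rightarrow> bool" where
  "transport_solution T M F y \<longleftrightarrow>
     (\<forall>t\<in>{0..T}. y t \<in> L2_on UNIV) \<and>
     (\<forall>t\<in>{0..T}. ((\<lambda>s. L2_dist_sq (y s) (y t)) \<longlongrightarrow> 0) (at t within {0..T})) \<and>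
     (\<forall>\<phi> \<phi>t \<phi>x. test_fun T \<phi> \<phi>t \<phi>x \<longrightarrow> (\<forall>\<tau>\<in>{0..T}.
        (LINT x|lborel. y \<tau> x \<bullet> \<phi> (\<tau>, x)) - (LINT x|lborel. y 0 x \<bullet> \<phi> (0, x)) =
        (LINT t:{0..\<tau>}|lborel. LINT x|lborel. y t x \<bullet> (\<phi>t (t, x) + transpose M *v \<phi>x (t, x))) +
        (LINT p:{0<..<\<tau>} \<times> UNIV|lborel. F p \<bullet> \<phi> p)))"

definition adjoint_solution ::
  "real \<Rightarrow> real^'n^'n \<Rightarrow> (real \<Rightarrow> real^'n) \<Rightarrow> (real \<Rightarrow> real \<Rightarrow> real^'n) \<Rightarrow> bool" where
  "adjoint_solution T A qT q \<longleftrightarrow>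
     transport_solution T (transpose A) (\<lambda>_. 0) q \<and> (AE x in lborel. q T x = qT x)"

definition exactly_controllable ::
  "real \<Rightarrow> real set \<Rightarrow> real^'n^'n \<Rightarrow> real^'m^'n \<Rightarrow> bool" where
  "exactly_controllable T \<O> A B \<longleftrightarrow>
     (\<forall>y0 \<in> L2_on UNIV. \<forall>y1 \<in> L2_on UNIV. \<exists>u \<in> L2_on ({0<..<T} \<times> \<O>). \<exists>y.
        transport_solution T A (\<lambda>(t, x). indicator \<O> x *\<^sub>R (B *v u (t, x))) y \<and>
        (AE x in lborel. y 0 x = y0 x) \<and> (AE x in lborel. y T x = y1 x))"

definition bounded_gap :: "real set \<Rightarrow> bool" where
  "bounded_gap \<O> \<longleftrightarrow> (\<exists>a b :: int \<Rightarrow> real.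
     \<O> = (\<Union>n. {a n<..<b n}) \<and> (\<forall>n. a n < b n \<and> b n < a (n + 1)) \<and>
     0 < (INF n. b n - a n) \<and> bdd_above (range (\<lambda>n. a (n + 1) - b n)))"


section \<open>Observability\<close>

definition observation ::
  "real \<Rightarrow> real set \<Rightarrow> real^'m^'n \<Rightarrow> (real \<Rightarrow> real \<Rightarrow> real^'n) \<Rightarrow> ennreal" where
  "observation T \<O> B q =
     (\<integral>\<^sup>+t\<in>{0<..<T}. (\<integral>\<^sup>+x\<in>\<O>. ennreal ((norm (transpose B *v q t x))\<^sup>2) \<partial>lborel) \<partial>lborel)"

text \<open>\<open>N2 qT\<close> is the square of a norm of the datum \<open>qT\<close>; it is allowed to be infinite.\<close>

definition observable_on ::
  "(real \<Rightarrow> real^'n) set \<Rightarrow> ((real \<Rightarrow> real^'n) \<Rightarrow> ennreal) \<Rightarrow>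
   real \<Rightarrow> real set \<Rightarrow> real^'n^'n \<Rightarrow> real^'m^'n \<Rightarrow> bool" where
  "observable_on X N2 T \<O> A B \<longleftrightarrow>
     (\<exists>C::real. 0 < C \<and> (\<forall>qT\<in>X. \<forall>q. adjoint_solution T A qT q \<longrightarrow>
        N2 qT \<le> ennreal C * observation T \<O> B q))"

text \<open>Function types carry no vector space structure here, so the seminorm axioms are spelled out.
  A norm on a space of almost-everywhere classes induces such a seminorm on representatives.\<close>

definition seminorm_on :: "('a \<Rightarrow> 'b::real_vector) set \<Rightarrow> (('a \<Rightarrow> 'b) \<Rightarrow> real) \<Rightarrow> bool" where
  "seminorm_on X p \<longleftrightarrow>
     (\<lambda>_. 0) \<in> X \<and>
     (\<forall>f\<in>X. \<forall>g\<in>X. (\<lambda>x. f x + g x) \<in> X \<and> p (\<lambda>x. f x + g x) \<le> p f + p g) \<and>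
     (\<forall>c. \<forall>f\<in>X. (\<lambda>x. c *\<^sub>R f x) \<in> X \<and> p (\<lambda>x. c *\<^sub>R f x) = \<bar>c\<bar> * p f)"

definition weight :: "(real \<Rightarrow> real) \<Rightarrow> bool" where
  "weight w \<longleftrightarrow> w \<in> borel_measurable lebesgue \<and> (\<forall>\<xi>. 0 \<le> w \<xi>)"

text \<open>Weights are only Lebesgue measurable, so the integral is taken over \<open>lebesgue\<close>.\<close>

definition layer_norm_sq ::
  "real^'n^'n \<Rightarrow> real^'m^'n \<Rightarrow> nat \<Rightarrow> (real \<Rightarrow> real) \<Rightarrow> (real \<Rightarrow> real^'n) \<Rightarrow> ennreal" where
  "layer_norm_sq A B k w q =
     (\<integral>\<^sup>+\<xi>. ennreal (w \<xi> * (norm (kalman_proj A B k (fourier_real q \<xi>)))\<^sup>2) \<partial>lebesgue)"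

definition block_norm_sq ::
  "real^'n^'n \<Rightarrow> real^'m^'n \<Rightarrow> nat \<Rightarrow> (nat \<Rightarrow> real \<Rightarrow> real) \<Rightarrow> (real \<Rightarrow> real^'n) \<Rightarrow> ennreal" where
  "block_norm_sq A B K w q = (\<Sum>k\<le>K. layer_norm_sq A B k (w k) q)"

text \<open>\<open>block_norm_sq A B K rho\<close> is the squared norm whose completion of the Schwartz space is
  \<open>\<Y>\<^sub>K\<^sup>-\<close>. A completion of the Schwartz space for a block norm is observable iff the inequality
  holds on the dense subspace of Schwartz data, and it is enough to test real-valued data, since
  the adjoint system and \<open>B\<close> are real.\<close>

definition rho :: "nat \<Rightarrow> real \<Rightarrow> real" where
  "rho k \<xi> = min (\<bar>\<xi>\<bar> ^ (2 * k)) 1"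

definition stronger_at_zero :: "nat \<Rightarrow> (real \<Rightarrow> real) \<Rightarrow> bool" where
  "stronger_at_zero k w \<longleftrightarrow> filterlim (\<lambda>\<xi>. w \<xi> / \<bar>\<xi>\<bar> ^ (2 * k)) at_top (at 0)"

end

theory Submission
  imports Defs "HOL-Probability.Sinc_Integral" "HOL-Probability.Characteristic_Functions" "HOL-Real_Asymp.Real_Asymp"
begin

text \<open>
  Because \<open>A\<close> is diagonalizable over the reals, the adjoint system splits into scalar transport
  equations. With eigenvectors \<open>e\<^sub>i\<close> of the transpose of \<open>A\<close>, eigenvalues \<open>\<lambda>\<^sub>i\<close> and dual functionals
  \<open>l\<^sub>i\<close>, the datum \<open>f\<close> at time \<open>T\<close> gives the solution
  \<open>q(t, x) = \<Sum>\<^sub>i (l\<^sub>i \<bullet> f(x + \<lambda>\<^sub>i (T - t))) e\<^sub>i\<close>. For a datum \<open>\<phi> v\<close> with scalar profile \<open>\<phi>\<close>, the observed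
  quantity is therefore a combination of translates of \<open>\<phi>\<close> with the coefficients
  \<open>c\<^sub>i = (l\<^sub>i \<bullet> v) B\<^sup>T e\<^sub>i\<close>, and the moments \<open>\<Sum>\<^sub>i \<lambda>\<^sub>i\<^sup>j c\<^sub>i\<close> are the vectors \<open>B\<^sup>T (A\<^sup>T)\<^sup>j v\<close>. Orthogonality of
  \<open>v\<close> to a Kalman space says exactly that the first moments vanish, and both halves of the theorem
  read off consequences of vanishing moments.

  Without the Kalman condition, take \<open>v\<close> orthogonal to the last Kalman space. Then the moments of all
  orders below \<open>N\<close> vanish. There are at most \<open>N\<close> distinct eigenvalues, so Lagrange interpolation
  makes the coefficients cancel within each eigenvalue (\<open>modal_sums_vanish\<close>): nothing is ever
  observed, neither by the exponential nor by the flow (\<open>unobservable_flow\<close>). Every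
  observability inequality on such data would bound a positive number by zero. Dually, the pairing of
  the controlled state with an unobservable adjoint solution does not feel the control and is
  conserved, so a nonzero target cannot be reached from zero (\<open>not_exactly_controllable\<close>).

  For the optimality of the weights, take \<open>v \<noteq> 0\<close> in the layer of index \<open>k\<close> and the profile
  \<open>exp (- (\<epsilon> x)\<^sup>2 / 2)\<close>. The moments of order below \<open>k\<close> vanish, so in the Taylor expansion of the
  translates around \<open>\<epsilon> x\<close> all terms of order below \<open>k\<close> cancel; the observed quantity is of size \<open>\<epsilon>\<^sup>k\<close> on
  a region of length of order \<open>1/\<epsilon>\<close>, and the observation is at most \<open>D \<epsilon>\<^sup>2\<^sup>k / \<epsilon>\<close>
  (\<open>gaussian_observation_le\<close>). This estimate is carried out in the space variable, hence without a
  Plancherel identity. On the frequency side the datum is an explicit Gaussian of height of order \<open>1/\<epsilon>\<close>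
  and width \<open>\<epsilon>\<close>; where the weight exceeds \<open>M \<bar>\<xi>\<bar>\<^sup>2\<^sup>k\<close>, the weighted norm is at least
  \<open>M a \<epsilon>\<^sup>2\<^sup>k / \<epsilon>\<close> with a fixed \<open>a > 0\<close> (\<open>gaussian_layer_norm_ge\<close>). Both sides scale alike in \<open>\<epsilon>\<close>
  and \<open>M\<close> is arbitrary, which excludes any observability constant.
\<close>

section \<open>Continuity of translations in mean square\<close>

definition L1_translation_continuous :: "(real \<Rightarrow> real) \<Rightarrow> bool" where
  "L1_translation_continuous f \<longleftrightarrow>
     ((\<lambda>h. \<integral>\<^sup>+x. ennreal \<bar>f (x + h) - f x\<bar> \<partial>lborel) \<longlongrightarrow> 0) (nhds 0)"

lemma nn_integral_lborel_translate:
  fixes f :: "real \<Rightarrow> ennreal"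
  assumes "f \<in> borel_measurable borel"
  shows "(\<integral>\<^sup>+x. f (x + h) \<partial>lborel) = (\<integral>\<^sup>+x. f x \<partial>lborel)"
  using nn_integral_real_affine[OF assms, of 1 h] by (simp add: add.commute)

lemma L1_translation_continuousI:
  assumes "\<And>e. 0 < e \<Longrightarrow> \<exists>d>0. \<forall>h. \<bar>h\<bar> < d \<longrightarrow> (\<integral>\<^sup>+x. ennreal \<bar>f (x + h) - f x\<bar> \<partial>lborel) \<le> ennreal e"
  shows "L1_translation_continuous f"
  unfolding L1_translation_continuous_def
proof (rule order_tendstoI)
  fix a :: ennreal assume "0 < a"
  then obtain b where b: "0 < b" "b < a" using dense by blast
  obtain e where "b = ennreal e" "0 \<le> e" using b(2) by (cases b) auto
  with b have e: "0 < e" "ennreal e < a" by auto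
  from assms[OF e(1)] obtain d where "0 < d"
    "\<And>h. \<bar>h\<bar> < d \<Longrightarrow> (\<integral>\<^sup>+x. ennreal \<bar>f (x + h) - f x\<bar> \<partial>lborel) \<le> ennreal e" by blast
  then show "\<forall>\<^sub>F h in nhds 0. (\<integral>\<^sup>+x. ennreal \<bar>f (x + h) - f x\<bar> \<partial>lborel) < a"
    using e(2) by (auto simp: eventually_nhds_metric dist_real_def intro!: exI[of _ d] intro: le_less_trans)
qed simp

lemma L1_translation_continuousD:
  assumes "L1_translation_continuous f" "0 < e"
  obtains d where "0 < d"
    "\<And>h. \<bar>h\<bar> < d \<Longrightarrow> (\<integral>\<^sup>+x. ennreal \<bar>f (x + h) - f x\<bar> \<partial>lborel) \<le> ennreal e"
proof -
  have "\<forall>\<^sub>F h in nhds 0. (\<integral>\<^sup>+x. ennreal \<bar>f (x + h) - f x\<bar> \<partial>lborel) < ennreal e"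
    using assms by (auto simp: L1_translation_continuous_def intro: order_tendstoD)
  then show ?thesis
    using that by (auto simp: eventually_nhds_metric dist_real_def intro: less_imp_le)
qed

lemma L1_translation_continuous_add:
  assumes [measurable]: "f \<in> borel_measurable borel" "g \<in> borel_measurable borel"
    and f: "L1_translation_continuous f" and g: "L1_translation_continuous g"
  shows "L1_translation_continuous (\<lambda>x. f x + g x)"
proof (rule L1_translation_continuousI)
  fix e :: real assume "0 < e"
  then have e: "0 < e / 2" by simp
  obtain d1 where d1: "0 < d1" "\<And>h. \<bar>h\<bar> < d1 \<Longrightarrow> (\<integral>\<^sup>+x. ennreal \<bar>f (x + h) - f x\<bar> \<partial>lborel) \<le> ennreal (e/2)"
    using L1_translation_continuousD[OF f e] by blast
  obtain d2 where d2: "0 < d2" "\<And>h. \<bar>h\<bar> < d2 \<Longrightarrow> (\<integral>\<^sup>+x. ennreal \<bar>g (x + h) - g x\<bar> \<partial>lborel) \<le> ennreal (e/2)"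
    using L1_translation_continuousD[OF g e] by blast
  have "(\<integral>\<^sup>+x. ennreal \<bar>f (x + h) + g (x + h) - (f x + g x)\<bar> \<partial>lborel) \<le> ennreal e"
    if "\<bar>h\<bar> < min d1 d2" for h
  proof -
    have "(\<integral>\<^sup>+x. ennreal \<bar>f (x + h) + g (x + h) - (f x + g x)\<bar> \<partial>lborel)
        \<le> (\<integral>\<^sup>+x. ennreal \<bar>f (x + h) - f x\<bar> + ennreal \<bar>g (x + h) - g x\<bar> \<partial>lborel)"
      by (intro nn_integral_mono) (auto simp flip: ennreal_plus)
    also have "\<dots> = (\<integral>\<^sup>+x. ennreal \<bar>f (x + h) - f x\<bar> \<partial>lborel) + (\<integral>\<^sup>+x. ennreal \<bar>g (x + h) - g x\<bar> \<partial>lborel)"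
      by (intro nn_integral_add) measurable
    also have "\<dots> \<le> ennreal (e/2) + ennreal (e/2)"
      using that d1 d2 by (intro add_mono) auto
    also have "\<dots> = ennreal e" using \<open>0 < e\<close> by (simp flip: ennreal_plus)
    finally show ?thesis .
  qed
  then show "\<exists>d>0. \<forall>h. \<bar>h\<bar> < d \<longrightarrow> (\<integral>\<^sup>+x. ennreal \<bar>f (x + h) + g (x + h) - (f x + g x)\<bar> \<partial>lborel) \<le> ennreal e"
    using d1(1) d2(1) by (intro exI[of _ "min d1 d2"]) auto
qed

text \<open>
  The usual three-term estimate: translates of \<open>g\<close> are close to \<open>g\<close>, and by translation invariance
  of the Lebesgue measure the two other terms both equal the distance from \<open>f\<close> to \<open>g\<close>.
\<close>
lemma L1_translation_continuous_approx:
  assumes [measurable]: "f \<in> borel_measurable borel"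
    and ex: "\<And>e. 0 < e \<Longrightarrow> \<exists>g \<in> borel_measurable borel. L1_translation_continuous g \<and>
           (\<integral>\<^sup>+x. ennreal \<bar>f x - g x\<bar> \<partial>lborel) \<le> ennreal e"
  shows "L1_translation_continuous f"
proof (rule L1_translation_continuousI)
  fix e :: real assume "0 < e"
  then have e: "0 < e / 3" by simp
  obtain g where g[measurable]: "g \<in> borel_measurable borel" and tg: "L1_translation_continuous g"
    and fg: "(\<integral>\<^sup>+x. ennreal \<bar>f x - g x\<bar> \<partial>lborel) \<le> ennreal (e/3)" using ex[OF e] by blast
  obtain d where d: "0 < d" "\<And>h. \<bar>h\<bar> < d \<Longrightarrow> (\<integral>\<^sup>+x. ennreal \<bar>g (x + h) - g x\<bar> \<partial>lborel) \<le> ennreal (e/3)"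
    using L1_translation_continuousD[OF tg e] by blast
  have "(\<integral>\<^sup>+x. ennreal \<bar>f (x + h) - f x\<bar> \<partial>lborel) \<le> ennreal e" if "\<bar>h\<bar> < d" for h
  proof -
    have "(\<integral>\<^sup>+x. ennreal \<bar>f (x + h) - f x\<bar> \<partial>lborel)
        \<le> (\<integral>\<^sup>+x. ennreal \<bar>f (x + h) - g (x + h)\<bar> + (ennreal \<bar>g (x + h) - g x\<bar> + ennreal \<bar>f x - g x\<bar>) \<partial>lborel)"
      by (intro nn_integral_mono) (auto simp flip: ennreal_plus)
    also have "\<dots> = (\<integral>\<^sup>+x. ennreal \<bar>f (x + h) - g (x + h)\<bar> \<partial>lborel) +
        ((\<integral>\<^sup>+x. ennreal \<bar>g (x + h) - g x\<bar> \<partial>lborel) + (\<integral>\<^sup>+x. ennreal \<bar>f x - g x\<bar> \<partial>lborel))"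
      by (simp add: nn_integral_add)
    also have "(\<integral>\<^sup>+x. ennreal \<bar>f (x + h) - g (x + h)\<bar> \<partial>lborel) = (\<integral>\<^sup>+x. ennreal \<bar>f x - g x\<bar> \<partial>lborel)"
      by (rule nn_integral_lborel_translate[of "\<lambda>x. ennreal \<bar>f x - g x\<bar>"]) measurable
    also have "(\<integral>\<^sup>+x. ennreal \<bar>f x - g x\<bar> \<partial>lborel) + ((\<integral>\<^sup>+x. ennreal \<bar>g (x + h) - g x\<bar> \<partial>lborel) + (\<integral>\<^sup>+x. ennreal \<bar>f x - g x\<bar> \<partial>lborel))
       \<le> ennreal (e/3) + (ennreal (e/3) + ennreal (e/3))"
      using that d fg by (intro add_mono) auto
    also have "\<dots> = ennreal e" using \<open>0 < e\<close> by (simp flip: ennreal_plus)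
    finally show ?thesis .
  qed
  with d(1) show "\<exists>d>0. \<forall>h. \<bar>h\<bar> < d \<longrightarrow> (\<integral>\<^sup>+x. ennreal \<bar>f (x + h) - f x\<bar> \<partial>lborel) \<le> ennreal e" by blast
qed

text \<open>
  Outer regularity of \<open>A\<close> and of its complement gives \<open>U\<close> and a closed set inside \<open>A\<close>; since \<open>A\<close> has
  finite measure, cutting the closed set off by a large ball costs little and makes it compact.
\<close>
lemma lborel_compact_open_approx:
  fixes A :: "real set"
  assumes A[measurable]: "A \<in> sets borel" and fin: "emeasure lborel A < \<infinity>" and "0 < e"
  obtains K U where "compact K" "open U" "K \<subseteq> A" "A \<subseteq> U" "emeasure lborel (U - K) < ennreal e"
proof -
  have e: "0 < e / 3" using \<open>0 < e\<close> by simp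
  obtain U where U: "open U" "A \<subseteq> U" "emeasure lborel (U - A) < ennreal (e/3)"
    using outer_regular_lborel[OF A e] by blast
  obtain V where V: "open V" "- A \<subseteq> V" "emeasure lborel (V - (- A)) < ennreal (e/3)"
    using outer_regular_lborel[of "- A" "e/3"] e by auto
  have [measurable]: "V \<in> sets borel" "U \<in> sets borel" using U V by auto
  have "(\<lambda>n. emeasure lborel (A - cball 0 (real n))) \<longlonglongrightarrow> emeasure lborel (\<Inter>n. A - cball 0 (real n))"
  proof (rule Lim_emeasure_decseq)
    show "decseq (\<lambda>n. A - cball 0 (real n))" by (auto simp: decseq_def)
    show "emeasure lborel (A - cball 0 (real i)) \<noteq> \<infinity>" for i
      using emeasure_mono[of "A - cball 0 (real i)" A lborel] fin by (auto simp: top_unique)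
  qed auto
  moreover have "(\<Inter>n. A - cball 0 (real n)) = {}"
  proof -
    have "\<exists>n. x \<in> cball 0 (real n)" for x :: real
      using real_arch_simple[of "\<bar>x\<bar>"] by auto
    then show ?thesis by blast
  qed
  ultimately have "(\<lambda>n. emeasure lborel (A - cball 0 (real n))) \<longlonglongrightarrow> 0"
    by (simp only: emeasure_empty)
  then have "\<forall>\<^sub>F n in sequentially. emeasure lborel (A - cball 0 (real n)) < ennreal (e/3)"
    using e by (auto intro: order_tendstoD)
  then obtain n where n: "emeasure lborel (A - cball 0 (real n)) < ennreal (e/3)"
    by (auto simp: eventually_sequentially)
  define K where "K = - V \<inter> cball 0 (real n)"
  have "compact K" using V(1) by (auto simp: K_def intro!: closed_Int_compact)
  moreover have "K \<subseteq> A" using V(2) by (auto simp: K_def)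
  moreover have "emeasure lborel (U - K) < ennreal e"
  proof -
    have "U - K \<subseteq> (U - A) \<union> ((V - (- A)) \<union> (A - cball 0 (real n)))" by (auto simp: K_def)
    then have "emeasure lborel (U - K) \<le> emeasure lborel ((U - A) \<union> ((V - (- A)) \<union> (A - cball 0 (real n))))"
      by (intro emeasure_mono) auto
    also have "\<dots> \<le> emeasure lborel (U - A) + emeasure lborel ((V - (- A)) \<union> (A - cball 0 (real n)))"
      by (rule emeasure_subadditive) auto
    also have "\<dots> \<le> emeasure lborel (U - A) + (emeasure lborel (V - (- A)) + emeasure lborel (A - cball 0 (real n)))"
      by (intro add_left_mono emeasure_subadditive) auto
    also have "\<dots> < ennreal (e/3) + (ennreal (e/3) + ennreal (e/3))"
      using U V n by (intro add_strict_mono) auto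
    also have "\<dots> = ennreal e" using \<open>0 < e\<close> by (simp flip: ennreal_plus)
    finally show ?thesis .
  qed
  ultimately show ?thesis using U that by blast
qed

text \<open>
  If \<open>K \<subseteq> A \<subseteq> U\<close> with \<open>K\<close> compact and \<open>U\<close> open, a translation that is small compared with
  the distance from \<open>K\<close> to the complement of \<open>U\<close> moves \<open>K\<close> inside \<open>U\<close>. A point that such a
  translation moves into or out of \<open>A\<close> then lies in \<open>U - K\<close> before or after the move.
\<close>
lemma L1_translation_continuous_indicator:
  assumes A[measurable]: "A \<in> sets borel" and fin: "emeasure lborel A < \<infinity>"
  shows "L1_translation_continuous (\<lambda>x. indicator A x * c)"
proof (rule L1_translation_continuousI)
  fix e :: real assume "0 < e"
  define e' where "e' = e / (2 * (\<bar>c\<bar> + 1))"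
  have e': "0 < e'" using \<open>0 < e\<close> by (simp add: e'_def)
  obtain K U where KU: "compact K" "open U" "K \<subseteq> A" "A \<subseteq> U" "emeasure lborel (U - K) < ennreal e'"
    using lborel_compact_open_approx[OF A fin e'] by blast
  have [measurable]: "K \<in> sets borel" "U \<in> sets borel" using KU by (auto simp: borel_compact)
  obtain d where d: "0 < d" "(\<Union>x\<in>K. ball x d) \<subseteq> U"
    using compact_subset_open_imp_ball_epsilon_subset[of K U] KU by auto
  have "(\<integral>\<^sup>+x. ennreal \<bar>indicator A (x + h) * c - indicator A x * c\<bar> \<partial>lborel) \<le> ennreal e"
    if h: "\<bar>h\<bar> < d" for h
  proof -
    have near: "x + h \<in> U" "x - h \<in> U" if "x \<in> K" for x
      using d(2) that h by (auto simp: dist_real_def subset_eq)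
    have "\<bar>indicator A (x + h) * c - indicator A x * c\<bar>
       \<le> \<bar>c\<bar> * (indicator (U - K) (x + h) + indicator (U - K) x)" for x
      using KU(3,4) near(1)[of x] near(2)[of "x + h"] by (auto simp: indicator_def)
    then have "ennreal \<bar>indicator A (x + h) * c - indicator A x * c\<bar>
       \<le> ennreal (\<bar>c\<bar> * (indicator (U - K) (x + h) + indicator (U - K) x))" for x
      by (rule ennreal_leI)
    also have "ennreal (\<bar>c\<bar> * (indicator (U - K) (x + h) + indicator (U - K) x)) =
       ennreal \<bar>c\<bar> * (indicator (U - K) (x + h) + indicator (U - K) x)" for x
      by (simp add: ennreal_mult ennreal_plus ennreal_indicator)
    finally have "(\<integral>\<^sup>+x. ennreal \<bar>indicator A (x + h) * c - indicator A x * c\<bar> \<partial>lborel)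
       \<le> (\<integral>\<^sup>+x. ennreal \<bar>c\<bar> * (indicator (U - K) (x + h) + indicator (U - K) x) \<partial>lborel)"
      by (intro nn_integral_mono) simp
    also have "\<dots> = ennreal \<bar>c\<bar> * ((\<integral>\<^sup>+x. indicator (U - K) (x + h) \<partial>lborel) + (\<integral>\<^sup>+x. indicator (U - K) x \<partial>lborel))"
      by (simp add: nn_integral_cmult nn_integral_add)
    also have "(\<integral>\<^sup>+x. indicator (U - K) (x + h) \<partial>lborel) = (\<integral>\<^sup>+x. indicator (U - K) x \<partial>lborel)"
      by (rule nn_integral_lborel_translate[of "indicator (U - K)"]) measurable
    also have "(\<integral>\<^sup>+x. indicator (U - K) x \<partial>lborel) = emeasure lborel (U - K)"
      by simp
    also have "ennreal \<bar>c\<bar> * (emeasure lborel (U - K) + emeasure lborel (U - K)) \<le> ennreal \<bar>c\<bar> * (ennreal e' + ennreal e')"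
      using KU(5) by (intro mult_left_mono add_mono) auto
    also have "\<dots> = ennreal (\<bar>c\<bar> * (e' + e'))" using e' by (simp add: ennreal_mult ennreal_plus del: mult_2 mult_2_right flip: mult_2)
    also have "\<bar>c\<bar> * (e' + e') \<le> (\<bar>c\<bar> + 1) * (e' + e')" using e' by (intro mult_right_mono) auto
    also have "\<dots> = e" by (simp add: e'_def divide_simps)
    finally show ?thesis by (simp add: ennreal_leI)
  qed
  with d(1) show "\<exists>d>0. \<forall>h. \<bar>h\<bar> < d \<longrightarrow> (\<integral>\<^sup>+x. ennreal \<bar>indicator A (x + h) * c - indicator A x * c\<bar> \<partial>lborel) \<le> ennreal e"
    by blast
qed

text \<open>
  The property passes from indicators to their linear combinations and, by dominated convergence, to
  limits in mean.
\<close>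
lemma L1_translation_continuous_integrable:
  fixes f :: "real \<Rightarrow> real"
  assumes "integrable lborel f"
  shows "L1_translation_continuous f"
  using assms
proof (induction rule: integrable_induct)
  case (base A c)
  then show ?case using L1_translation_continuous_indicator[of A c] by simp
next
  case (add f g)
  then show ?case by (intro L1_translation_continuous_add) auto
next
  case (lim f s)
  have [measurable]: "f \<in> borel_measurable borel" "\<And>i. s i \<in> borel_measurable borel" using lim by auto
  have intf: "integrable lborel f" using lim by auto
  have "(\<lambda>i. \<integral>\<^sup>+x. ennreal (norm (f x - s i x)) \<partial>lborel) \<longlonglongrightarrow> 0"
  proof (rule Bochner_Integration.nn_integral_dominated_convergence_norm[where w = "\<lambda>x. 2 * norm (f x)"])
    show "(\<integral>\<^sup>+x. ennreal (2 * norm (f x)) \<partial>lborel) < \<infinity>"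
      using integrable_mult_right[OF integrable_norm[OF intf], of 2] unfolding integrable_iff_bounded by simp
  qed (use lim in auto)
  then have ev: "\<forall>\<^sub>F i in sequentially. (\<integral>\<^sup>+x. ennreal (norm (f x - s i x)) \<partial>lborel) < ennreal e" if "0 < e" for e
    using that by (auto intro: order_tendstoD)
  show ?case
  proof (rule L1_translation_continuous_approx)
    fix e :: real assume "0 < e"
    then obtain i where "(\<integral>\<^sup>+x. ennreal (norm (f x - s i x)) \<partial>lborel) < ennreal e"
      using ev[of e] by (auto simp: eventually_sequentially)
    then show "\<exists>g \<in> borel_measurable borel. L1_translation_continuous g \<and>
           (\<integral>\<^sup>+x. ennreal \<bar>f x - g x\<bar> \<partial>lborel) \<le> ennreal e"
      using lim by (intro bexI[of _ "s i"]) auto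
  qed simp
qed

text \<open>
  This inequality reduces square integrable functions to integrable ones: the squared increment of a
  nonnegative function is dominated by the increment of its square.
\<close>
lemma power2_diff_le_abs_diff_power2:
  fixes a b :: real
  assumes "0 \<le> a" "0 \<le> b"
  shows "(a - b)\<^sup>2 \<le> \<bar>a\<^sup>2 - b\<^sup>2\<bar>"
proof -
  have "(a - b)\<^sup>2 = \<bar>a - b\<bar> * \<bar>a - b\<bar>" by (simp add: power2_eq_square)
  also have "\<dots> \<le> \<bar>a - b\<bar> * \<bar>a + b\<bar>" using assms by (intro mult_left_mono) auto
  also have "\<dots> = \<bar>a\<^sup>2 - b\<^sup>2\<bar>" by (simp flip: abs_mult add: algebra_simps power2_eq_square)
  finally show ?thesis .
qed

text \<open>
  Split into positive and negative parts; the square of each part is integrable, so its translates are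
  continuous in mean.
\<close>
lemma L2_translation_continuous:
  fixes f :: "real \<Rightarrow> real"
  assumes f[measurable]: "f \<in> borel_measurable borel" and i: "integrable lborel (\<lambda>x. (f x)\<^sup>2)"
  shows "((\<lambda>h. \<integral>\<^sup>+x. ennreal ((f (x + h) - f x)\<^sup>2) \<partial>lborel) \<longlongrightarrow> 0) (nhds 0)"
proof -
  define p where "p = (\<lambda>x. max 0 (f x))"
  define n where "n = (\<lambda>x. max 0 (- f x))"
  have [measurable]: "p \<in> borel_measurable borel" "n \<in> borel_measurable borel" by (auto simp: p_def n_def)
  have "integrable lborel (\<lambda>x. (p x)\<^sup>2)" "integrable lborel (\<lambda>x. (n x)\<^sup>2)"
    by (rule Bochner_Integration.integrable_bound[OF i], simp, simp add: p_def n_def max_def)+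
  then have t: "L1_translation_continuous (\<lambda>x. (p x)\<^sup>2)" "L1_translation_continuous (\<lambda>x. (n x)\<^sup>2)"
    using L1_translation_continuous_integrable by auto
  have bound: "(\<integral>\<^sup>+x. ennreal ((f (x + h) - f x)\<^sup>2) \<partial>lborel) \<le>
     2 * (\<integral>\<^sup>+x. ennreal \<bar>(p (x + h))\<^sup>2 - (p x)\<^sup>2\<bar> \<partial>lborel) + 2 * (\<integral>\<^sup>+x. ennreal \<bar>(n (x + h))\<^sup>2 - (n x)\<^sup>2\<bar> \<partial>lborel)" for h
  proof -
    have "(f (x + h) - f x)\<^sup>2 \<le> 2 * \<bar>(p (x + h))\<^sup>2 - (p x)\<^sup>2\<bar> + 2 * \<bar>(n (x + h))\<^sup>2 - (n x)\<^sup>2\<bar>" for x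
    proof -
      have "f (x + h) - f x = (p (x + h) - p x) - (n (x + h) - n x)" by (auto simp: p_def n_def)
      then have "(f (x + h) - f x)\<^sup>2 \<le> 2 * (p (x + h) - p x)\<^sup>2 + 2 * (n (x + h) - n x)\<^sup>2"
        using zero_le_power2[of "(p (x + h) - p x) + (n (x + h) - n x)"]
        by (simp only:) (simp add: power2_eq_square algebra_simps)
      moreover have "(p (x + h) - p x)\<^sup>2 \<le> \<bar>(p (x + h))\<^sup>2 - (p x)\<^sup>2\<bar>" "(n (x + h) - n x)\<^sup>2 \<le> \<bar>(n (x + h))\<^sup>2 - (n x)\<^sup>2\<bar>"
        by (rule power2_diff_le_abs_diff_power2; simp add: p_def n_def)+
      ultimately have "(f (x + h) - f x)\<^sup>2 \<le> 2 * \<bar>(p (x + h))\<^sup>2 - (p x)\<^sup>2\<bar> + 2 * \<bar>(n (x + h))\<^sup>2 - (n x)\<^sup>2\<bar>"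
        by (meson add_mono mult_left_mono order_trans zero_le_numeral)
      then show ?thesis .
    qed
    then have "ennreal ((f (x + h) - f x)\<^sup>2) \<le> ennreal (2 * \<bar>(p (x + h))\<^sup>2 - (p x)\<^sup>2\<bar> + 2 * \<bar>(n (x + h))\<^sup>2 - (n x)\<^sup>2\<bar>)" for x
      by (rule ennreal_leI)
    also have "ennreal (2 * \<bar>(p (x + h))\<^sup>2 - (p x)\<^sup>2\<bar> + 2 * \<bar>(n (x + h))\<^sup>2 - (n x)\<^sup>2\<bar>)
        = 2 * ennreal \<bar>(p (x + h))\<^sup>2 - (p x)\<^sup>2\<bar> + 2 * ennreal \<bar>(n (x + h))\<^sup>2 - (n x)\<^sup>2\<bar>" for x
      by (simp add: ennreal_mult ennreal_plus)
    finally have "(\<integral>\<^sup>+x. ennreal ((f (x + h) - f x)\<^sup>2) \<partial>lborel)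
       \<le> (\<integral>\<^sup>+x. 2 * ennreal \<bar>(p (x + h))\<^sup>2 - (p x)\<^sup>2\<bar> + 2 * ennreal \<bar>(n (x + h))\<^sup>2 - (n x)\<^sup>2\<bar> \<partial>lborel)"
      by (intro nn_integral_mono) simp
    also have "\<dots> = 2 * (\<integral>\<^sup>+x. ennreal \<bar>(p (x + h))\<^sup>2 - (p x)\<^sup>2\<bar> \<partial>lborel) + 2 * (\<integral>\<^sup>+x. ennreal \<bar>(n (x + h))\<^sup>2 - (n x)\<^sup>2\<bar> \<partial>lborel)"
      by (simp add: nn_integral_add nn_integral_cmult)
    finally show ?thesis .
  qed
  have "((\<lambda>h. 2 * (\<integral>\<^sup>+x. ennreal \<bar>(p (x + h))\<^sup>2 - (p x)\<^sup>2\<bar> \<partial>lborel) + 2 * (\<integral>\<^sup>+x. ennreal \<bar>(n (x + h))\<^sup>2 - (n x)\<^sup>2\<bar> \<partial>lborel))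
     \<longlongrightarrow> 2 * 0 + 2 * 0) (nhds 0)"
    using t unfolding L1_translation_continuous_def by (intro tendsto_intros ennreal_tendsto_cmult) auto
  then have lim: "((\<lambda>h. 2 * (\<integral>\<^sup>+x. ennreal \<bar>(p (x + h))\<^sup>2 - (p x)\<^sup>2\<bar> \<partial>lborel) + 2 * (\<integral>\<^sup>+x. ennreal \<bar>(n (x + h))\<^sup>2 - (n x)\<^sup>2\<bar> \<partial>lborel))
     \<longlongrightarrow> 0) (nhds 0)" by simp
  show ?thesis
    by (rule tendsto_sandwich[OF _ _ tendsto_const lim]) (simp_all add: bound)
qed

section \<open>Modes of the adjoint system\<close>

text \<open>
  The functionals \<open>l i\<close> are the dual basis of the eigenvectors \<open>e i\<close>; only the resulting expansion of
  every vector is recorded.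
\<close>
definition adjoint_eigenbasis :: "real^'n^'n \<Rightarrow> ('n \<Rightarrow> real) \<Rightarrow> ('n \<Rightarrow> real^'n) \<Rightarrow> ('n \<Rightarrow> real^'n) \<Rightarrow> bool" where
  "adjoint_eigenbasis A lam e l \<longleftrightarrow>
     (\<forall>i. transpose A *v e i = lam i *\<^sub>R e i) \<and> (\<forall>v. (\<Sum>i\<in>UNIV. (l i \<bullet> v) *\<^sub>R e i) = v)"

lemma inner_matrix_vector_mult:
  fixes M :: "real^'n^'m"
  shows "x \<bullet> (M *v y) = (transpose M *v x) \<bullet> y"
  by (simp add: dot_lmul_matrix)

lemma inner_transpose_matrix_vector_mult:
  fixes M :: "real^'n^'m"
  shows "x \<bullet> (transpose M *v y) = (M *v x) \<bullet> y"
  by (metis inner_matrix_vector_mult transpose_transpose)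

text \<open>
  If \<open>A = P D Q\<close> with \<open>Q\<close> the inverse of \<open>P\<close>, then \<open>Q A = D Q\<close>: the rows of \<open>Q\<close> are eigenvectors of the
  transpose of \<open>A\<close>, and the columns of \<open>P\<close> are their dual basis.
\<close>
lemma adjoint_eigenbasis_exists:
  fixes A :: "real^'n^'n"
  assumes "diagonalizable_over_reals A"
  obtains lam e l where "adjoint_eigenbasis A lam e l"
proof -
  obtain P D :: "real^'n^'n" where PD: "invertible P" "\<forall>i j. i \<noteq> j \<longrightarrow> D $ i $ j = 0"
    "A = P ** D ** matrix_inv P"
    using assms unfolding diagonalizable_over_reals_def by blast
  define Q where "Q = matrix_inv P"
  have PQ: "P ** Q = mat 1" and QP: "Q ** P = mat 1"
    using someI_ex[OF PD(1)[unfolded invertible_def]] by (auto simp: Q_def matrix_inv_def)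
  have axis: "v = (\<Sum>i\<in>UNIV. (v $ i) *\<^sub>R axis i 1)" for v :: "real^'n"
    using basis_expansion[of v] by (simp add: scalar_mult_eq_scaleR)
  have "transpose A *v (transpose Q *v axis i 1) = D $ i $ i *\<^sub>R (transpose Q *v axis i 1)" for i
  proof -
    have DT: "transpose D *v axis i 1 = D $ i $ i *\<^sub>R axis i 1"
      using PD(2) by (auto simp: vec_eq_iff matrix_vector_mult_def transpose_def axis_def if_distrib cong: if_cong)
    have "transpose A ** transpose Q = transpose (Q ** A)" by (simp add: matrix_transpose_mul)
    also have "Q ** A = D ** Q"
      by (simp add: PD(3) flip: Q_def) (simp add: matrix_mul_assoc QP)
    also have "transpose (D ** Q) = transpose Q ** transpose D" by (simp add: matrix_transpose_mul)
    finally show ?thesis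
      by (metis DT matrix_vector_mul_assoc matrix_vector_mult_scaleR)
  qed
  moreover have "(\<Sum>i\<in>UNIV. ((P *v axis i 1) \<bullet> v) *\<^sub>R (transpose Q *v axis i 1)) = v" for v
  proof -
    have "(\<Sum>i\<in>UNIV. ((P *v axis i 1) \<bullet> v) *\<^sub>R (transpose Q *v axis i 1))
      = transpose Q *v (\<Sum>i\<in>UNIV. ((transpose P *v v) $ i) *\<^sub>R axis i 1)"
    proof -
      have "(P *v axis i 1) \<bullet> v = (transpose P *v v) $ i" for i
        by (metis inner_axis' inner_real_def inner_transpose_matrix_vector_mult mult_1)
      then show ?thesis
        by (simp add: linear_sum[OF matrix_vector_mul_linear] o_def matrix_vector_mult_scaleR del: transpose_matrix_vector)
    qed
    also have "\<dots> = transpose (P ** Q) *v v"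
      by (simp add: axis[symmetric] matrix_transpose_mul matrix_vector_mul_assoc del: transpose_matrix_vector)
    finally show ?thesis by (simp add: PQ transpose_mat)
  qed
  ultimately show ?thesis
    using that[of "\<lambda>i. D $ i $ i" "\<lambda>i. transpose Q *v axis i 1" "\<lambda>i. P *v axis i 1"]
    unfolding adjoint_eigenbasis_def by blast
qed

lemma matpow_Suc: "matpow M (Suc k) = M ** matpow M k"
  by (simp add: matpow_def)

lemma matpow_0 [simp]: "matpow M 0 = mat 1"
  by (simp add: matpow_def)

lemma matpow_Suc_right: "matpow M (Suc k) = matpow M k ** M"
  by (induction k) (simp_all add: matpow_Suc matrix_mul_assoc)

lemma transpose_matpow:
  fixes M :: "'a::comm_semiring_1^'n^'n"
  shows "transpose (matpow M k) = matpow (transpose M) k"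
  by (induction k) (simp_all add: matpow_Suc_right matrix_transpose_mul transpose_mat, simp flip: matpow_Suc matpow_Suc_right)

lemma matpow_eigenvector:
  fixes M :: "real^'n^'n"
  assumes "M *v e = c *\<^sub>R e"
  shows "matpow M k *v e = c ^ k *\<^sub>R e"
proof (induction k)
  case (Suc k)
  then show ?case
    by (simp add: matpow_Suc matrix_vector_mult_scaleR assms flip: matrix_vector_mul_assoc)
qed simp

lemma observed_power_eq_modal_sum:
  assumes "adjoint_eigenbasis A lam e l"
  shows "transpose B *v (matpow (transpose A) j *v v) =
     (\<Sum>i\<in>UNIV. lam i ^ j *\<^sub>R ((l i \<bullet> v) *\<^sub>R (transpose B *v e i)))"
proof -
  have "v = (\<Sum>i\<in>UNIV. (l i \<bullet> v) *\<^sub>R e i)" using assms by (simp add: adjoint_eigenbasis_def)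
  then have "transpose B *v (matpow (transpose A) j *v v) =
     transpose B *v (matpow (transpose A) j *v (\<Sum>i\<in>UNIV. (l i \<bullet> v) *\<^sub>R e i))" by simp
  also have "\<dots> = (\<Sum>i\<in>UNIV. (l i \<bullet> v) *\<^sub>R (transpose B *v (matpow (transpose A) j *v e i)))"
    by (simp only: linear_sum[OF matrix_vector_mul_linear] matrix_vector_mult_scaleR o_def)
  also have "\<dots> = (\<Sum>i\<in>UNIV. lam i ^ j *\<^sub>R ((l i \<bullet> v) *\<^sub>R (transpose B *v e i)))"
  proof (rule sum.cong)
    fix i
    have "matpow (transpose A) j *v e i = lam i ^ j *\<^sub>R e i"
      using assms by (intro matpow_eigenvector) (simp add: adjoint_eigenbasis_def del: transpose_matrix_vector)
    then show "(l i \<bullet> v) *\<^sub>R (transpose B *v (matpow (transpose A) j *v e i)) = lam i ^ j *\<^sub>R ((l i \<bullet> v) *\<^sub>R (transpose B *v e i))"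
      by (simp add: matrix_vector_mult_scaleR mult.commute del: transpose_matrix_vector)
  qed simp
  finally show ?thesis .
qed

lemma subspace_kalman_space: "subspace (kalman_space A B k)"
  unfolding subspace_def kalman_space_def
proof (intro conjI ballI allI)
  show "0 \<in> range (\<lambda>u. \<Sum>j\<le>k. (matpow A j ** B) *v u j)"
    by (rule image_eqI[of _ _ "\<lambda>_. 0"]) auto
next
  fix x y assume "x \<in> range (\<lambda>u. \<Sum>j\<le>k. (matpow A j ** B) *v u j)" "y \<in> range (\<lambda>u. \<Sum>j\<le>k. (matpow A j ** B) *v u j)"
  then obtain u w where "x = (\<Sum>j\<le>k. (matpow A j ** B) *v u j)" "y = (\<Sum>j\<le>k. (matpow A j ** B) *v w j)" by auto
  then show "x + y \<in> range (\<lambda>u. \<Sum>j\<le>k. (matpow A j ** B) *v u j)"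
    by (intro image_eqI[of _ _ "\<lambda>j. u j + w j"]) (auto simp: matrix_vector_right_distrib sum.distrib)
next
  fix c x assume "x \<in> range (\<lambda>u. \<Sum>j\<le>k. (matpow A j ** B) *v u j)"
  then obtain u where "x = (\<Sum>j\<le>k. (matpow A j ** B) *v u j)" by auto
  then show "c *\<^sub>R x \<in> range (\<lambda>u. \<Sum>j\<le>k. (matpow A j ** B) *v u j)"
    by (intro image_eqI[of _ _ "\<lambda>j. c *\<^sub>R u j"]) (auto simp: matrix_vector_mult_scaleR scaleR_sum_right)
qed

lemma inner_kalman_column:
  fixes A :: "real^'n^'n" and B :: "real^'m^'n"
  shows "((matpow A j ** B) *v w) \<bullet> v = w \<bullet> (transpose B *v (matpow (transpose A) j *v v))"
proof -
  have "((matpow A j ** B) *v w) \<bullet> v = w \<bullet> (transpose (matpow A j ** B) *v v)"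
    by (simp only: inner_transpose_matrix_vector_mult)
  also have "transpose (matpow A j ** B) = transpose B ** matpow (transpose A) j"
    by (simp only: matrix_transpose_mul transpose_matpow)
  finally show ?thesis by (simp only: matrix_vector_mul_assoc)
qed

text \<open>
  Transposing the block matrix turns orthogonality to its range into the kernel of the transpose,
  block by block.
\<close>
lemma orthogonal_kalman_space_iff:
  "v \<in> (kalman_space A B k)\<^sup>\<bottom> \<longleftrightarrow> (\<forall>j\<le>k. transpose B *v (matpow (transpose A) j *v v) = 0)"
proof
  assume v: "v \<in> (kalman_space A B k)\<^sup>\<bottom>"
  show "\<forall>j\<le>k. transpose B *v (matpow (transpose A) j *v v) = 0"
  proof (intro allI impI)
    fix j assume j: "j \<le> k"
    define w where "w = transpose B *v (matpow (transpose A) j *v v)"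
    have "(\<Sum>i\<le>k. (matpow A i ** B) *v (if i = j then w else 0)) = (matpow A j ** B) *v w"
      using j by (subst sum.mono_neutral_right[of _ "{j}"]) auto
    then have "(matpow A j ** B) *v w \<in> kalman_space A B k"
      unfolding kalman_space_def by (intro range_eqI[of _ _ "\<lambda>i. if i = j then w else 0"]) simp
    then have "((matpow A j ** B) *v w) \<bullet> v = 0"
      using v by (auto simp: orthogonal_comp_def orthogonal_def)
    then have "w \<bullet> w = 0"
      by (simp only: inner_kalman_column w_def)
    then show "transpose B *v (matpow (transpose A) j *v v) = 0" by (simp add: w_def)
  qed
next
  assume *: "\<forall>j\<le>k. transpose B *v (matpow (transpose A) j *v v) = 0"
  have "((matpow A j ** B) *v w) \<bullet> v = 0" if "j \<le> k" for j w
    using * that by (simp only: inner_kalman_column inner_zero_right)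
  then show "v \<in> (kalman_space A B k)\<^sup>\<bottom>"
    by (auto simp: orthogonal_comp_def orthogonal_def kalman_space_def inner_sum_left)
qed

text \<open>
  Vanishing moments extend by linearity to all polynomials of degree below \<open>CARD('n)\<close>. There are
  at most \<open>CARD('n)\<close> distinct nodes, so the Lagrange polynomial that isolates \<open>\<mu>\<close> has small enough
  degree.
\<close>
lemma modal_sums_vanish:
  fixes lam :: "'n::finite \<Rightarrow> real" and c :: "'n \<Rightarrow> 'b::real_vector"
  assumes "\<And>j. j < CARD('n) \<Longrightarrow> (\<Sum>i\<in>UNIV. lam i ^ j *\<^sub>R c i) = 0"
  shows "(\<Sum>i | lam i = \<mu>. c i) = 0"
proof (cases "\<mu> \<in> range lam")
  case True
  define p where "p = (\<Prod>\<nu>\<in>range lam - {\<mu>}. [:- \<nu>, 1:])"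
  have "degree p \<le> (\<Sum>\<nu>\<in>range lam - {\<mu>}. degree [:- \<nu>, 1:])"
    unfolding p_def by (simp add: degree_prod_eq_sum_degree)
  also have "\<dots> = card (range lam - {\<mu>})" by simp
  also have "\<dots> < card (range lam)" using True by (intro psubset_card_mono) auto
  also have "\<dots> \<le> CARD('n)" by (rule card_image_le) simp
  finally have deg: "degree p < CARD('n)" .
  have poly: "poly p x = (\<Prod>\<nu>\<in>range lam - {\<mu>}. x - \<nu>)" for x
    by (simp add: p_def poly_prod)
  have "(\<Sum>i\<in>UNIV. poly p (lam i) *\<^sub>R c i) = (\<Sum>j\<le>degree p. coeff p j *\<^sub>R (\<Sum>i\<in>UNIV. lam i ^ j *\<^sub>R c i))"
    by (simp add: poly_altdef scaleR_sum_left scaleR_sum_right) (rule sum.swap)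
  also have "\<dots> = 0" using deg assms by (intro sum.neutral) auto
  finally have "0 = (\<Sum>i\<in>UNIV. poly p (lam i) *\<^sub>R c i)" by simp
  also have "\<dots> = (\<Sum>i | lam i = \<mu>. poly p (lam i) *\<^sub>R c i)"
    by (rule sum.mono_neutral_right) (auto simp: poly)
  also have "\<dots> = poly p \<mu> *\<^sub>R (\<Sum>i | lam i = \<mu>. c i)" by (simp add: scaleR_sum_right)
  finally show ?thesis by (auto simp: poly)
next
  case False
  then have "{i. lam i = \<mu>} = {}" by auto
  then show ?thesis by simp
qed

lemma sum_group_by_eigenvalue:
  fixes lam :: "'n::finite \<Rightarrow> real"
  shows "(\<Sum>i\<in>UNIV. F i (lam i)) = (\<Sum>\<mu>\<in>range lam. \<Sum>i | lam i = \<mu>. F i \<mu>)"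
  using sum.image_gen[of UNIV "\<lambda>i. F i (lam i)" lam] by (auto intro!: sum.cong)

lemma unobservable_modal_sums_vanish:
  fixes A :: "real^'n^'n"
  assumes "adjoint_eigenbasis A lam e l" "v \<in> (kalman_space A B (CARD('n) - 1))\<^sup>\<bottom>"
  shows "(\<Sum>i | lam i = \<mu>. (l i \<bullet> v) *\<^sub>R (transpose B *v e i)) = 0"
  using assms(2) by (intro modal_sums_vanish)
     (auto simp: orthogonal_kalman_space_iff simp flip: observed_power_eq_modal_sum[OF assms(1)] simp del: transpose_matrix_vector scaleR_scaleR)

text \<open>
  The grouped modal sums vanish, so every moment does; this replaces the Cayley-Hamilton theorem in
  the passage from the powers below the dimension to all powers.
\<close>
lemma unobservable_powers:
  fixes A :: "real^'n^'n"
  assumes "diagonalizable_over_reals A" "v \<in> (kalman_space A B (CARD('n) - 1))\<^sup>\<bottom>"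
  shows "transpose B *v (matpow (transpose A) j *v v) = 0"
proof -
  obtain lam e l where E: "adjoint_eigenbasis A lam e l"
    using adjoint_eigenbasis_exists[OF assms(1)] .
  have "(\<Sum>i\<in>UNIV. lam i ^ j *\<^sub>R ((l i \<bullet> v) *\<^sub>R (transpose B *v e i)))
     = (\<Sum>\<mu>\<in>range lam. \<Sum>i | lam i = \<mu>. \<mu> ^ j *\<^sub>R ((l i \<bullet> v) *\<^sub>R (transpose B *v e i)))"
    by (rule sum_group_by_eigenvalue[where F = "\<lambda>i \<mu>. \<mu> ^ j *\<^sub>R ((l i \<bullet> v) *\<^sub>R (transpose B *v e i))"])
  also have "\<dots> = (\<Sum>\<mu>\<in>range lam. \<mu> ^ j *\<^sub>R (\<Sum>i | lam i = \<mu>. (l i \<bullet> v) *\<^sub>R (transpose B *v e i)))"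
    by (simp add: scaleR_sum_right)
  also have "\<dots> = 0" by (simp only: unobservable_modal_sums_vanish[OF E assms(2)] scaleR_zero_right sum.neutral_const)
  finally show ?thesis by (simp only: observed_power_eq_modal_sum[OF E])
qed

text \<open>
  A subspace with zero orthogonal complement is the whole space, hence has full dimension.
\<close>
lemma unobservable_space_nontrivial:
  fixes A :: "real^'n^'n"
  assumes "kalman_rank A B k < CARD('n)"
  shows "(kalman_space A B k)\<^sup>\<bottom> \<noteq> {0}"
proof
  assume *: "(kalman_space A B k)\<^sup>\<bottom> = {0}"
  have "kalman_space A B k = UNIV"
    using orthogonal_comp_self[OF subspace_kalman_space[of A B k]] * by simp
  then show False using assms by (simp add: kalman_rank_def)
qed

section \<open>Kalman layers and their projectors\<close>

lemma cvec_0 [simp]: "cvec 0 = 0"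
  by (simp add: cvec_def vec_eq_iff)

lemma subspace_kalman_layer: "subspace (kalman_layer A B k)"
  unfolding kalman_layer_def by (intro subspace_inter subspace_kalman_space subspace_orthogonal_comp)

lemma kalman_layer_unobserved:
  assumes "v \<in> kalman_layer A B k" "j < k"
  shows "transpose B *v (matpow (transpose A) j *v v) = 0"
proof -
  obtain i where "k = Suc i" using assms(2) by (cases k) auto
  then have "v \<in> (kalman_space A B i)\<^sup>\<bottom>" "j \<le> i" using assms by (auto simp: kalman_layer_def)
  then show ?thesis unfolding orthogonal_kalman_space_iff by blast
qed

lemma orth_proj_ident:
  assumes S: "subspace S" and x: "x \<in> S"
  shows "orth_proj S x = x"
  unfolding orth_proj_def
proof (rule the_equality)
  show "x \<in> S \<and> x - x \<in> S\<^sup>\<bottom>" using x subspace_0[OF subspace_orthogonal_comp] by simp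
next
  fix p assume p: "p \<in> S \<and> x - p \<in> S\<^sup>\<bottom>"
  then have "x - p \<in> S" using S x by (auto intro: subspace_diff)
  with p have "(x - p) \<bullet> (x - p) = 0" by (auto simp: orthogonal_comp_def orthogonal_def)
  then show "p = x" by simp
qed

lemma kalman_proj_cvec:
  assumes "v \<in> kalman_layer A B k"
  shows "kalman_proj A B k (cvec v) = cvec v"
proof -
  have "(\<chi> i. Re (cvec v $ i)) = v" "(\<chi> i. Im (cvec v $ i)) = 0" by (auto simp: cvec_def vec_eq_iff)
  then show ?thesis
    using assms
    by (simp add: kalman_proj_def orth_proj_ident[OF subspace_kalman_layer]
        orth_proj_ident[OF subspace_kalman_layer subspace_0[OF subspace_kalman_layer]])
qed

lemma norm_cvec: "norm (cvec v) = norm v"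
  by (simp add: cvec_def norm_vec_def)

section \<open>The matrix exponential on unobservable vectors\<close>

lemma linear_matrix_mult_right: "linear (\<lambda>X. M ** X)" for M :: "complex^'n^'m"
  by (rule linearI) (auto simp: vec_eq_iff matrix_matrix_mult_def sum.distrib ring_distribs scaleR_sum_right)

text \<open>
  Left multiplication by \<open>M\<close> is bounded, with constant \<open>C\<close> say, so the norms of the powers grow at most
  like \<open>C ^ k\<close> and the exponential series of \<open>C\<close> is a majorant. Without summability the infinite sum
  in the definition of the exponential would carry no information.
\<close>
lemma matexp_summable: "summable (\<lambda>k. (1 / fact k) *\<^sub>R matpow M k)" for M :: "complex^'n^'n"
proof -
  have bl: "bounded_linear (\<lambda>X :: complex^'n^'n. M ** X)"
    using linear_matrix_mult_right linear_conv_bounded_linear by blast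
  obtain C where C: "0 < C" "\<And>X :: complex^'n^'n. norm (M ** X) \<le> norm X * C"
    using bounded_linear.pos_bounded[OF bl] by auto
  have bound: "norm (matpow M k) \<le> C ^ k * norm (mat 1 :: complex^'n^'n)" for k
  proof (induction k)
    case (Suc k)
    have "norm (matpow M (Suc k)) \<le> norm (matpow M k) * C" using C(2) by (simp add: matpow_Suc)
    also have "\<dots> \<le> (C ^ k * norm (mat 1 :: complex^'n^'n)) * C" using Suc C by (intro mult_right_mono) auto
    finally show ?case by (simp add: ac_simps)
  qed simp
  have "summable (\<lambda>k. (inverse (fact k) * C ^ k) * norm (mat 1 :: complex^'n^'n))"
    by (intro summable_mult2 summable_exp)
  then show ?thesis
  proof (rule summable_comparison_test')
    fix k
    show "norm ((1 / fact k) *\<^sub>R matpow M k) \<le> inverse (fact k) * C ^ k * norm (mat 1 :: complex^'n^'n)"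
      using mult_left_mono[OF bound[of k], of "inverse (fact k)"] by (simp add: inverse_eq_divide mult.assoc)
  qed
qed

lemma cmat_mult_cvec: "cmat M *v cvec v = cvec (M *v v)"
  by (simp add: cmat_def cvec_def map_matrix_def vec_eq_iff matrix_vector_mult_def)

lemma matpow_scaled_cmat:
  "matpow (map_matrix (\<lambda>a. c * a) (cmat M)) k *v cvec v = c ^ k *s cvec (matpow M k *v v)"
proof (induction k)
  case (Suc k)
  have "map_matrix (\<lambda>a. c * a) (cmat M) *v z = c *s (cmat M *v z)" for z
    by (simp add: map_matrix_def vec_eq_iff matrix_vector_mult_def sum_distrib_left mult.assoc)
  then show ?case
    by (simp add: matpow_Suc Suc cmat_mult_cvec vector_scalar_commute vector_smult_assoc flip: matrix_vector_mul_assoc)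
qed simp

text \<open>
  The map from a matrix to its observed action on \<open>v\<close> is bounded and linear, so it acts on the exponential
  series term by term.
\<close>
lemma observed_matexp_eq_0:
  fixes M :: "real^'n^'n"
  assumes "\<And>j. L *v (matpow M j *v v) = 0"
  shows "cmat L *v (matexp (map_matrix (\<lambda>a. c * a) (cmat M)) *v cvec v) = 0"
proof -
  let ?X = "map_matrix (\<lambda>a. c * a) (cmat M)"
  have "linear (\<lambda>X :: complex^'n^'n. X *v cvec v)"
    by (rule linearI) (auto simp: vec_eq_iff matrix_vector_mult_def sum.distrib ring_distribs scaleR_sum_right)
  from linear_compose[OF this, of "(*v) (cmat L)"]
  have "linear (\<lambda>X :: complex^'n^'n. cmat L *v (X *v cvec v))"
    by (simp add: o_def bounded_linear.linear[OF matrix_vector_mul_bounded_linear])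
  then have bl: "bounded_linear (\<lambda>X :: complex^'n^'n. cmat L *v (X *v cvec v))"
    using linear_conv_bounded_linear by blast
  have "cmat L *v (matexp ?X *v cvec v) = (\<Sum>k. cmat L *v (((1 / fact k) *\<^sub>R matpow ?X k) *v cvec v))"
    unfolding matexp_def by (rule bounded_linear.suminf[OF bl matexp_summable])
  also have "\<dots> = (\<Sum>k. 0)"
  proof (rule suminf_cong)
    fix k
    have "cmat L *v (((1 / fact k) *\<^sub>R matpow ?X k) *v cvec v) = (1 / fact k) *\<^sub>R (cmat L *v (matpow ?X k *v cvec v))"
      using linear_scale[OF bounded_linear.linear[OF bl]] by simp
    then show "cmat L *v (((1 / fact k) *\<^sub>R matpow ?X k) *v cvec v) = 0"
      by (simp add: matpow_scaled_cmat vector_scalar_commute cmat_mult_cvec assms)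
  qed
  finally show ?thesis by simp
qed

section \<open>The adjoint flow as a superposition of translations\<close>

text \<open>
  The Cauchy--Schwarz inequality, used to estimate the flow mode by mode.
\<close>
lemma norm_sum_scaleR_power2_le:
  fixes e :: "'i \<Rightarrow> 'a::real_normed_vector"
  shows "(norm (\<Sum>i\<in>I. a i *\<^sub>R e i))\<^sup>2 \<le> (\<Sum>i\<in>I. (norm (e i))\<^sup>2) * (\<Sum>i\<in>I. (a i)\<^sup>2)"
proof -
  have "norm (\<Sum>i\<in>I. a i *\<^sub>R e i) \<le> (\<Sum>i\<in>I. \<bar>a i\<bar> * norm (e i))"
    using norm_sum[of "\<lambda>i. a i *\<^sub>R e i" I] by simp
  then have "(norm (\<Sum>i\<in>I. a i *\<^sub>R e i))\<^sup>2 \<le> (\<Sum>i\<in>I. \<bar>a i\<bar> * norm (e i))\<^sup>2"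
    by (intro power_mono) auto
  also have "\<dots> \<le> (\<Sum>i\<in>I. (\<bar>a i\<bar>)\<^sup>2) * (\<Sum>i\<in>I. (norm (e i))\<^sup>2)"
    by (rule Cauchy_Schwarz_ineq_sum)
  finally show ?thesis by (simp add: mult.commute)
qed

lemma L2_on_UNIV_iff:
  "f \<in> L2_on UNIV \<longleftrightarrow> f \<in> borel_measurable borel \<and> integrable lborel (\<lambda>x. (norm (f x))\<^sup>2)"
  by (simp add: L2_on_def set_borel_measurable_def set_integrable_def)

lemma L2_component:
  fixes f :: "real \<Rightarrow> real^'n"
  assumes "f \<in> L2_on UNIV"
  shows "(\<lambda>x. v \<bullet> f x) \<in> borel_measurable borel" "integrable lborel (\<lambda>x. (v \<bullet> f x)\<^sup>2)"
proof -
  have [measurable]: "f \<in> borel_measurable borel" and i: "integrable lborel (\<lambda>x. (norm (f x))\<^sup>2)"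
    using assms by (auto simp: L2_on_UNIV_iff)
  show "(\<lambda>x. v \<bullet> f x) \<in> borel_measurable borel" by measurable
  have "(v \<bullet> f x)\<^sup>2 \<le> (norm v)\<^sup>2 * (norm (f x))\<^sup>2" for x
    using Cauchy_Schwarz_ineq[of v "f x"] by (simp add: power2_norm_eq_inner)
  then show "integrable lborel (\<lambda>x. (v \<bullet> f x)\<^sup>2)"
    by (intro Bochner_Integration.integrable_bound[OF integrable_mult_right[OF i, of "(norm v)\<^sup>2"]]) auto
qed

lemma integrable_translate:
  fixes g :: "real \<Rightarrow> real"
  assumes "integrable lborel g"
  shows "integrable lborel (\<lambda>x. g (x + h))"
  using lborel_integrable_real_affine[OF assms, of 1 h] by (simp add: add.commute)

lemma integral_translate:
  fixes g :: "real \<Rightarrow> real"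
  shows "(LINT x|lborel. g (x + h)) = (LINT x|lborel. g x)"
  using lborel_integral_real_affine[of 1 g h] by (simp add: add.commute)

text \<open>
  Each mode is transported with its own eigenvalue as speed; time runs backwards from the datum at
  time \<open>T\<close>.
\<close>
definition adjoint_flow ::
  "real \<Rightarrow> ('n \<Rightarrow> real) \<Rightarrow> ('n \<Rightarrow> real^'n) \<Rightarrow> ('n \<Rightarrow> real^'n) \<Rightarrow> (real \<Rightarrow> real^'n) \<Rightarrow> real \<Rightarrow> real \<Rightarrow> real^'n" where
  "adjoint_flow T lam e l f t x = (\<Sum>i\<in>UNIV. (l i \<bullet> f (x + lam i * (T - t))) *\<^sub>R e i)"

lemma observed_flow:
  "transpose B *v adjoint_flow T lam e l f t x =
     (\<Sum>i\<in>UNIV. (l i \<bullet> f (x + lam i * (T - t))) *\<^sub>R (transpose B *v e i))"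
  by (simp add: adjoint_flow_def linear_sum[OF matrix_vector_mul_linear] o_def matrix_vector_mult_scaleR
      del: transpose_matrix_vector)

lemma adjoint_flow_L2:
  assumes f: "f \<in> L2_on UNIV"
  shows "adjoint_flow T lam e l f t \<in> L2_on UNIV"
proof -
  note [measurable] = L2_component(1)[OF f]
  have m[measurable]: "adjoint_flow T lam e l f t \<in> borel_measurable borel"
    unfolding adjoint_flow_def
    by (intro borel_measurable_sum borel_measurable_scaleR borel_measurable_const
        measurable_compose[OF _ L2_component(1)[OF f]]) simp
  have "integrable lborel (\<lambda>x. (\<Sum>i\<in>UNIV. (norm (e i))\<^sup>2) * (\<Sum>i\<in>UNIV. (l i \<bullet> f (x + lam i * (T - t)))\<^sup>2))"
    by (intro integrable_mult_right Bochner_Integration.integrable_sum integrable_translate[OF L2_component(2)[OF f]])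
  then have "integrable lborel (\<lambda>x. (norm (adjoint_flow T lam e l f t x))\<^sup>2)"
    by (rule Bochner_Integration.integrable_bound) (simp, auto simp: adjoint_flow_def norm_sum_scaleR_power2_le intro!: AE_I2 order_trans[OF norm_sum_scaleR_power2_le])
  with m show ?thesis by (simp add: L2_on_UNIV_iff)
qed

text \<open>
  In each mode the difference of the flow at two times is, up to a translation, the increment of one
  fixed square integrable function, so translations being continuous in mean square suffices.
\<close>
lemma adjoint_flow_continuous:
  fixes f :: "real \<Rightarrow> real^'n"
  assumes f: "f \<in> L2_on UNIV"
  shows "((\<lambda>s. L2_dist_sq (adjoint_flow T lam e l f s) (adjoint_flow T lam e l f t)) \<longlongrightarrow> 0) (at t within S)"
proof -
  note [measurable] = L2_component(1)[OF f]
  define \<omega> where "\<omega> = (\<lambda>i h. \<integral>\<^sup>+x. ennreal ((l i \<bullet> f (x + h) - l i \<bullet> f x)\<^sup>2) \<partial>lborel)"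
  define C where "C = (\<Sum>i\<in>UNIV. (norm (e i))\<^sup>2)"
  have C: "0 \<le> C" by (simp add: C_def sum_nonneg)
  have bound: "L2_dist_sq (adjoint_flow T lam e l f s) (adjoint_flow T lam e l f t)
     \<le> ennreal C * (\<Sum>i\<in>UNIV. \<omega> i (lam i * (t - s)))" for s
  proof -
    let ?d = "\<lambda>i x. l i \<bullet> f (x + lam i * (T - s)) - l i \<bullet> f (x + lam i * (T - t))"
    have md[measurable]: "?d i \<in> borel_measurable borel" for i
      by (intro borel_measurable_diff measurable_compose[OF _ L2_component(1)[OF f]]) simp_all
    have "ennreal ((norm (adjoint_flow T lam e l f s x - adjoint_flow T lam e l f t x))\<^sup>2)
        \<le> ennreal C * (\<Sum>i\<in>UNIV. ennreal ((?d i x)\<^sup>2))" for x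
    proof -
      have "adjoint_flow T lam e l f s x - adjoint_flow T lam e l f t x = (\<Sum>i\<in>UNIV. ?d i x *\<^sub>R e i)"
        by (simp add: adjoint_flow_def sum_subtractf scaleR_diff_left)
      then have "(norm (adjoint_flow T lam e l f s x - adjoint_flow T lam e l f t x))\<^sup>2 \<le> C * (\<Sum>i\<in>UNIV. (?d i x)\<^sup>2)"
        using norm_sum_scaleR_power2_le[of "\<lambda>i. ?d i x" e UNIV] by (simp add: C_def)
      then have "ennreal ((norm (adjoint_flow T lam e l f s x - adjoint_flow T lam e l f t x))\<^sup>2)
        \<le> ennreal (C * (\<Sum>i\<in>UNIV. (?d i x)\<^sup>2))" by (rule ennreal_leI)
      also have "\<dots> = ennreal C * (\<Sum>i\<in>UNIV. ennreal ((?d i x)\<^sup>2))"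
        using C by (simp add: ennreal_mult sum_nonneg)
      finally show ?thesis .
    qed
    then have "L2_dist_sq (adjoint_flow T lam e l f s) (adjoint_flow T lam e l f t)
       \<le> (\<integral>\<^sup>+x. ennreal C * (\<Sum>i\<in>UNIV. ennreal ((?d i x)\<^sup>2)) \<partial>lborel)"
      unfolding L2_dist_sq_def by (intro nn_integral_mono) simp
    also have "\<dots> = ennreal C * (\<Sum>i\<in>UNIV. (\<integral>\<^sup>+x. ennreal ((?d i x)\<^sup>2) \<partial>lborel))"
      using md by (simp add: nn_integral_cmult nn_integral_sum del: sum_ennreal)
    also have "\<dots> = ennreal C * (\<Sum>i\<in>UNIV. \<omega> i (lam i * (t - s)))"
    proof -
      have "(\<integral>\<^sup>+x. ennreal ((?d i x)\<^sup>2) \<partial>lborel) = \<omega> i (lam i * (t - s))" for i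
      proof -
        have [measurable]: "(\<lambda>x. l i \<bullet> f (x + lam i * (t - s)) - l i \<bullet> f x) \<in> borel_measurable borel"
          by (intro borel_measurable_diff measurable_compose[OF _ L2_component(1)[OF f]]) simp_all
        have "?d i x = l i \<bullet> f ((x + lam i * (T - t)) + lam i * (t - s)) - l i \<bullet> f (x + lam i * (T - t))" for x
          by (simp add: algebra_simps)
        then show ?thesis
          using nn_integral_lborel_translate[of "\<lambda>x. ennreal ((l i \<bullet> f (x + lam i * (t - s)) - l i \<bullet> f x)\<^sup>2)" "lam i * (T - t)"]
          by (simp add: \<omega>_def)
      qed
      then show ?thesis by simp
    qed
    finally show ?thesis .
  qed
  have "((\<lambda>s. \<omega> i (lam i * (t - s))) \<longlongrightarrow> 0) (at t within S)" for i
  proof -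
    have "((\<lambda>s. lam i * (t - s)) \<longlongrightarrow> lam i * (t - t)) (at t within S)" by (intro tendsto_intros)
    then have "((\<lambda>s. lam i * (t - s)) \<longlongrightarrow> 0) (at t within S)" by simp
    moreover have "(\<omega> i \<longlongrightarrow> 0) (nhds 0)"
      unfolding \<omega>_def by (rule L2_translation_continuous[OF L2_component[OF f]])
    ultimately show ?thesis by (rule filterlim_compose[rotated])
  qed
  then have "((\<lambda>s. ennreal C * (\<Sum>i\<in>UNIV. \<omega> i (lam i * (t - s)))) \<longlongrightarrow> ennreal C * (\<Sum>i\<in>(UNIV::'n set). 0)) (at t within S)"
    by (intro ennreal_tendsto_cmult tendsto_sum) auto
  then have lim: "((\<lambda>s. ennreal C * (\<Sum>i\<in>UNIV. \<omega> i (lam i * (t - s)))) \<longlongrightarrow> 0) (at t within S)" by simp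
  show ?thesis
    by (rule tendsto_sandwich[OF _ _ tendsto_const lim]) (simp_all add: bound)
qed

lemma integrable_L2_times_compact_support:
  fixes g h :: "real \<Rightarrow> real"
  assumes [measurable]: "g \<in> borel_measurable borel" "h \<in> borel_measurable borel"
    and g: "integrable lborel (\<lambda>x. (g x)\<^sup>2)"
    and h: "\<And>x. \<bar>h x\<bar> \<le> C" "\<And>x. R < \<bar>x\<bar> \<Longrightarrow> h x = 0"
  shows "integrable lborel (\<lambda>x. g x * h x)"
proof -
  have C: "0 \<le> C" using h(1)[of 0] by linarith
  have "integrable lborel (\<lambda>x. C * (g x)\<^sup>2 + C * indicator {-R..R} x)"
    using g by (intro Bochner_Integration.integrable_add integrable_mult_right integrable_real_indicator) (auto simp: emeasure_lborel_Icc_eq)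
  then show ?thesis
  proof (rule Bochner_Integration.integrable_bound)
    show "AE x in lborel. norm (g x * h x) \<le> norm (C * (g x)\<^sup>2 + C * indicator {-R..R} x)"
    proof (rule AE_I2)
      fix x
      show "norm (g x * h x) \<le> norm (C * (g x)\<^sup>2 + C * indicator {-R..R} x)"
      proof (cases "R < \<bar>x\<bar>")
        case False
        have "\<bar>g x\<bar> \<le> (g x)\<^sup>2 + 1"
          using zero_le_power2[of "\<bar>g x\<bar> - 1"] zero_le_power2[of "g x"] by (simp add: power2_eq_square algebra_simps)
        then have "\<bar>g x\<bar> * \<bar>h x\<bar> \<le> ((g x)\<^sup>2 + 1) * C" using h(1)[of x] by (intro mult_mono) auto
        moreover have "x \<in> {-R..R}" using False by auto
        ultimately show ?thesis using C by (simp add: abs_mult algebra_simps)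
      qed (use h C in auto)
    qed
  qed measurable
qed

text \<open>
  The derivative along a characteristic. Continuity of one partial derivative gives joint
  differentiability, which the chain rule needs.
\<close>
lemma continuous_partials_chain:
  fixes \<psi> \<psi>t \<psi>x :: "real \<times> real \<Rightarrow> real"
  assumes dt: "\<And>t x. ((\<lambda>s. \<psi> (s, x)) has_vector_derivative \<psi>t (t, x)) (at t)"
    and dx: "\<And>t x. ((\<lambda>z. \<psi> (t, z)) has_vector_derivative \<psi>x (t, x)) (at x)"
    and cx: "continuous_on UNIV \<psi>x"
  shows "((\<lambda>t. \<psi> (t, y - c * (T - t))) has_vector_derivative (\<psi>t (t, y - c * (T - t)) + c * \<psi>x (t, y - c * (T - t)))) (at t)"
proof -
  define z where "z = y - c * (T - t)"
  have "((\<lambda>(s, x). \<psi> (s, x)) has_derivative (\<lambda>(ds, dx). ds *\<^sub>R \<psi>t (t, z) + blinfun_scaleR_left (\<psi>x (t, z)) dx)) (at (t, z) within UNIV \<times> UNIV)"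
  proof (rule has_derivative_partialsI[where fy = "\<lambda>s x. blinfun_scaleR_left (\<psi>x (s, x))"])
    show "((\<lambda>s. \<psi> (s, z)) has_derivative (\<lambda>ds. ds *\<^sub>R \<psi>t (t, z))) (at t within UNIV)"
      using dt[of z t] by (simp add: has_vector_derivative_def)
    show "((\<lambda>x. \<psi> (s, x)) has_derivative blinfun_apply (blinfun_scaleR_left (\<psi>x (s, x)))) (at x within UNIV)" for s x
      using dx[of s x] by (simp add: has_vector_derivative_def)
    have "isCont \<psi>x (t, z)" using cx by (simp add: continuous_on_eq_continuous_at)
    then show "continuous (at (t, z) within UNIV \<times> UNIV) (\<lambda>(s, x). blinfun_scaleR_left (\<psi>x (s, x)))"
      by (simp add: case_prod_unfold bounded_linear.continuous[OF bounded_linear_blinfun_scaleR_left])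
  qed auto
  then have D: "(\<psi> has_derivative (\<lambda>(ds, dx). ds *\<^sub>R \<psi>t (t, z) + dx *\<^sub>R \<psi>x (t, z))) (at (t, z))"
    by simp
  have g: "((\<lambda>s. (s, y - c * (T - s))) has_derivative (\<lambda>ds. (ds, c * ds))) (at t)"
    by (auto intro!: derivative_eq_intros)
  have "((\<lambda>s. \<psi> (s, y - c * (T - s))) has_derivative (\<lambda>ds. ds *\<^sub>R \<psi>t (t, z) + (c * ds) *\<^sub>R \<psi>x (t, z))) (at t)"
    using has_derivative_compose[OF g D[unfolded z_def]] by (simp add: z_def)
  then show ?thesis
    by (simp add: has_vector_derivative_def z_def algebra_simps)
qed

text \<open>
  The weak formulation for one mode. After the change of variable \<open>y = x + c (T - t)\<close> the profile
  \<open>g y\<close> no longer depends on time, and the integrand is \<open>g y\<close> times the time derivative of the test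
  function along the characteristic through \<open>y\<close>. Exchanging the integrals leaves the increment of the
  test function between the two times.
\<close>
lemma transport_weak_identity:
  fixes g :: "real \<Rightarrow> real" and \<psi> \<psi>t \<psi>x :: "real \<times> real \<Rightarrow> real"
  assumes gm[measurable]: "g \<in> borel_measurable borel" and g2: "integrable lborel (\<lambda>x. (g x)\<^sup>2)"
    and T: "0 < T" and \<tau>: "\<tau> \<in> {0..T}"
    and dt: "\<And>t x. ((\<lambda>s. \<psi> (s, x)) has_vector_derivative \<psi>t (t, x)) (at t)"
    and dx: "\<And>t x. ((\<lambda>z. \<psi> (t, z)) has_vector_derivative \<psi>x (t, x)) (at x)"
    and ct: "continuous_on UNIV \<psi>t" and cx: "continuous_on UNIV \<psi>x"
    and supp: "\<And>t x. t \<in> {0..T} \<Longrightarrow> R < \<bar>x\<bar> \<Longrightarrow> \<psi> (t, x) = 0"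
  shows transport_weak_integrable1: "\<And>t. t \<in> {0..T} \<Longrightarrow> integrable lborel (\<lambda>x. g (x + c * (T - t)) * \<psi> (t, x))"
    and transport_weak_integrable2: "\<And>t. t \<in> {0..T} \<Longrightarrow> integrable lborel (\<lambda>x. g (x + c * (T - t)) * (\<psi>t (t, x) + c * \<psi>x (t, x)))"
    and transport_weak_integrable3: "set_integrable lborel {0..\<tau>} (\<lambda>t. LINT x|lborel. g (x + c * (T - t)) * (\<psi>t (t, x) + c * \<psi>x (t, x)))"
    and transport_weak_eq: "(LINT x|lborel. g (x + c * (T - \<tau>)) * \<psi> (\<tau>, x)) - (LINT x|lborel. g (x + c * (T - 0)) * \<psi> (0, x)) =
        (LINT t:{0..\<tau>}|lborel. LINT x|lborel. g (x + c * (T - t)) * (\<psi>t (t, x) + c * \<psi>x (t, x)))"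
proof -
  define H' where "H' = (\<lambda>p. \<psi>t p + c * \<psi>x p)"
  define H where "H = (\<lambda>t y. H' (t, y - c * (T - t)))"
  define G where "G = (\<lambda>t y. \<psi> (t, y - c * (T - t)))"
  \<comment> \<open>Along characteristics the support in \<open>x\<close> widens by at most the distance travelled.\<close>
  define R' where "R' = \<bar>R\<bar> + \<bar>c\<bar> * T"
  have cH': "continuous_on UNIV H'" unfolding H'_def using ct cx by (intro continuous_intros)
  have cH: "continuous_on UNIV (\<lambda>p. H (fst p) (snd p))"
    unfolding H_def by (intro continuous_on_compose2[OF cH'] continuous_intros) auto
  \<comment> \<open>At the end points of the time interval \<open>\<psi>\<close> is known to vanish on one side only, so derivatives
    are compared within the interval.\<close>
  have \<psi>t0: "\<psi>t (t, x) = 0" if "t \<in> {0..T}" "R < \<bar>x\<bar>" for t x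
  proof -
    have "((\<lambda>s. \<psi> (s, x)) has_vector_derivative \<psi>t (t, x)) (at t within cbox 0 T)"
      using dt has_vector_derivative_at_within by blast
    moreover have "((\<lambda>s. \<psi> (s, x)) has_vector_derivative 0) (at t within cbox 0 T)"
      by (rule has_vector_derivative_transform[OF _ _ has_vector_derivative_const[of 0]]) (use that supp in auto)
    ultimately show ?thesis
      using vector_derivative_unique_within_closed_interval[of 0 T t] T that by auto
  qed
  have \<psi>x0: "\<psi>x (t, x) = 0" if "t \<in> {0..T}" "R < \<bar>x\<bar>" for t x
  proof -
    have "open {x. R < \<bar>x\<bar>}" by (intro open_Collect_less continuous_intros)
    then have "((\<lambda>z. \<psi> (t, z)) has_vector_derivative 0) (at x)"
      by (intro has_vector_derivative_transform_within_open[OF has_vector_derivative_const[of 0], of "{x. R < \<bar>x\<bar>}"])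
        (use that supp in auto)
    with dx show ?thesis using vector_derivative_unique_at by blast
  qed
  have H0: "H' (t, x) = 0" if "t \<in> {0..T}" "R < \<bar>x\<bar>" for t x
    using \<psi>t0[OF that] \<psi>x0[OF that] by (simp add: H'_def)
  have c\<psi>: "continuous_on UNIV (\<lambda>x. \<psi> (t, x))" for t
    using dx by (intro continuous_at_imp_continuous_on) (auto intro: has_vector_derivative_continuous)
  have bound_of: "\<exists>C. \<forall>x. \<bar>h x\<bar> \<le> C" if "continuous_on UNIV h" "\<And>x. R < \<bar>x\<bar> \<Longrightarrow> h x = 0" for h :: "real \<Rightarrow> real"
  proof -
    have "bounded (h ` {-R..R})"
      using that(1) by (intro compact_imp_bounded compact_continuous_image) (auto intro: continuous_on_subset)
    then obtain C where C: "\<And>x. x \<in> {-R..R} \<Longrightarrow> \<bar>h x\<bar> \<le> C" by (force simp: bounded_iff)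
    have "\<bar>h x\<bar> \<le> max C 0" for x
      using C[of x] that(2)[of x] by (cases "R < \<bar>x\<bar>") (auto simp: abs_le_iff not_less)
    then show ?thesis by blast
  qed
  have gt[measurable]: "(\<lambda>x. g (x + a)) \<in> borel_measurable borel" for a
    by (rule measurable_compose[OF _ gm]) simp
  have slice: "integrable lborel (\<lambda>x. g (x + a) * h x)"
    if h: "continuous_on UNIV h" "\<And>x. R < \<bar>x\<bar> \<Longrightarrow> h x = 0" for h a
  proof -
    obtain C where "\<And>x. \<bar>h x\<bar> \<le> C" using bound_of[OF h] by blast
    then show ?thesis
      using h gt[of a] integrable_translate[OF g2, of a] borel_measurable_continuous_onI[OF h(1)]
      by (intro integrable_L2_times_compact_support[where C = C and R = R]) auto
  qed
  show i1: "integrable lborel (\<lambda>x. g (x + c * (T - t)) * \<psi> (t, x))" if "t \<in> {0..T}" for t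
    using slice[OF c\<psi>, of t "c * (T - t)"] supp[OF that] by simp
  have i2: "integrable lborel (\<lambda>x. g (x + c * (T - t)) * H' (t, x))" if "t \<in> {0..T}" for t
    by (rule slice) (use H0[OF that] in \<open>auto intro!: continuous_on_compose2[OF cH'] continuous_intros\<close>)
  then show "integrable lborel (\<lambda>x. g (x + c * (T - t)) * (\<psi>t (t, x) + c * \<psi>x (t, x)))" if "t \<in> {0..T}" for t
    using that by (simp add: H'_def)
  have shift1: "(LINT x|lborel. g (x + c * (T - t)) * k x) = (LINT y|lborel. g y * k (y - c * (T - t)))" for t k
    using integral_translate[of "\<lambda>y. g y * k (y - c * (T - t))" "c * (T - t)"] by simp
  have shift2: "integrable lborel (\<lambda>x. g (x + c * (T - t)) * k x) \<Longrightarrow> integrable lborel (\<lambda>y. g y * k (y - c * (T - t)))" for t k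
    using integrable_translate[of "\<lambda>x. g (x + c * (T - t)) * k x" "- (c * (T - t))"] by simp
  define F where "F = (\<lambda>t y. indicator {0..\<tau>} t * (g y * H t y))"
  obtain M where M: "\<And>t x. t \<in> {0..T} \<Longrightarrow> \<bar>H' (t, x)\<bar> \<le> M" "0 \<le> M"
  proof -
    have "bounded (H' ` ({0..T} \<times> {-R..R}))"
      using cH' by (intro compact_imp_bounded compact_continuous_image compact_Times) (auto intro: continuous_on_subset)
    then obtain C where C: "\<And>t x. t \<in> {0..T} \<Longrightarrow> x \<in> {-R..R} \<Longrightarrow> \<bar>H' (t, x)\<bar> \<le> C"
      by (force simp: bounded_iff)
    have "\<bar>H' (t, x)\<bar> \<le> max C 0" if "t \<in> {0..T}" for t x
      using C[OF that, of x] H0[OF that, of x] by (cases "R < \<bar>x\<bar>") (auto simp: abs_le_iff not_less)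
    then show ?thesis using that[of "max C 0"] by auto
  qed
  have Hbound: "\<bar>H t y\<bar> \<le> M * indicator {-R'..R'} y" if "t \<in> {0..T}" for t y
  proof (cases "y \<in> {-R'..R'}")
    case True
    then show ?thesis using M(1)[OF that] by (simp add: H_def)
  next
    case False
    have "\<bar>c * (T - t)\<bar> \<le> \<bar>c\<bar> * T" using that by (auto simp: abs_mult intro!: mult_left_mono)
    then have "R < \<bar>y - c * (T - t)\<bar>" using False by (auto simp: R'_def)
    then show ?thesis using H0[OF that] False by (simp add: H_def)
  qed
  have Hm: "(\<lambda>p. H (fst p) (snd p)) \<in> borel_measurable (lborel \<Otimes>\<^sub>M lborel)"
    using borel_measurable_continuous_onI[OF cH] by (simp add: lborel_prod)
  have Fm: "(\<lambda>p. F (fst p) (snd p)) \<in> borel_measurable (lborel \<Otimes>\<^sub>M lborel)"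
    unfolding F_def by (intro borel_measurable_times Hm) measurable
  have gi: "integrable lborel (\<lambda>y. \<bar>g y\<bar> * (M * indicator {-R'..R'} y))"
  proof (rule integrable_L2_times_compact_support[where C = M and R = R'])
    show "\<bar>M * indicator {-R'..R'} x\<bar> \<le> M" for x :: real using M(2) by (simp add: indicator_def)
    show "M * indicator {-R'..R'} x = 0" if "R' < \<bar>x\<bar>" for x :: real
      using that by (auto simp: indicator_def abs_if split: if_splits)
  qed (use g2 in simp_all)
  have Fi: "integrable (lborel \<Otimes>\<^sub>M lborel) (\<lambda>(t, y). F t y)"
  proof (rule Bochner_Integration.integrable_bound)
    show "integrable (lborel \<Otimes>\<^sub>M lborel) (\<lambda>p. indicator {0..\<tau>} (fst p) * (\<bar>g (snd p)\<bar> * (M * indicator {-R'..R'} (snd p))))"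
    proof (rule lborel_pair.Fubini_integrable)
      show "(\<lambda>p. indicator {0..\<tau>} (fst p) * (\<bar>g (snd p)\<bar> * (M * indicator {-R'..R'} (snd p)))) \<in> borel_measurable (lborel \<Otimes>\<^sub>M lborel)"
        by measurable
      have "(\<lambda>x. LINT y|lborel. norm (indicator {0..\<tau>} (fst (x, y)) * (\<bar>g (snd (x, y))\<bar> * (M * indicator {-R'..R'} (snd (x, y))))))
        = (\<lambda>x. indicator {0..\<tau>} x * (LINT y|lborel. \<bar>g y\<bar> * (M * indicator {-R'..R'} y)))"
        using M(2) by (auto simp: abs_mult fun_eq_iff indicator_def)
      then show "integrable lborel (\<lambda>x. LINT y|lborel. norm (indicator {0..\<tau>} (fst (x, y)) * (\<bar>g (snd (x, y))\<bar> * (M * indicator {-R'..R'} (snd (x, y))))))"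
        by (simp add: emeasure_lborel_Icc_eq)
      show "AE x in lborel. integrable lborel (\<lambda>y. indicator {0..\<tau>} (fst (x, y)) * (\<bar>g (snd (x, y))\<bar> * (M * indicator {-R'..R'} (snd (x, y)))))"
        using gi by (auto intro!: AE_I2)
    qed
    show "(\<lambda>(t, y). F t y) \<in> borel_measurable (lborel \<Otimes>\<^sub>M lborel)" using Fm by (simp add: case_prod_unfold)
    show "AE p in lborel \<Otimes>\<^sub>M lborel. norm (case p of (t, y) \<Rightarrow> F t y) \<le> norm (indicator {0..\<tau>} (fst p) * (\<bar>g (snd p)\<bar> * (M * indicator {-R'..R'} (snd p))))"
    proof (rule AE_I2)
      fix p :: "real \<times> real"
      obtain t y where p: "p = (t, y)" by force
      show "norm (case p of (t, y) \<Rightarrow> F t y) \<le> norm (indicator {0..\<tau>} (fst p) * (\<bar>g (snd p)\<bar> * (M * indicator {-R'..R'} (snd p))))"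
      proof (cases "t \<in> {0..\<tau>}")
        case True
        then have "t \<in> {0..T}" using \<tau> by auto
        from Hbound[OF this, of y] show ?thesis
          using True M(2) by (simp add: p F_def abs_mult mult_left_mono)
      qed (simp add: p F_def)
    qed
  qed
  have inner: "(LINT y|lborel. F t y) = indicator {0..\<tau>} t *\<^sub>R (LINT x|lborel. g (x + c * (T - t)) * H' (t, x))" for t
    by (simp add: F_def H_def shift1)
  show "set_integrable lborel {0..\<tau>} (\<lambda>t. LINT x|lborel. g (x + c * (T - t)) * (\<psi>t (t, x) + c * \<psi>x (t, x)))"
    using lborel_pair.integrable_fst[OF Fi] by (simp add: set_integrable_def inner H'_def)
  have FTC: "(LINT t|lborel. F t y) = g y * (G \<tau> y - G 0 y)" for y
  proof -
    have "(LINT t|lborel. indicator {0..\<tau>} t *\<^sub>R H t y) = G \<tau> y - G 0 y"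
    proof (rule integral_FTC_atLeastAtMost)
      show "((\<lambda>t. G t y) has_vector_derivative H t y) (at t within {0..\<tau>})" for t
        unfolding G_def H_def H'_def
        by (rule has_vector_derivative_at_within[OF continuous_partials_chain[OF dt dx cx]])
      show "continuous_on {0..\<tau>} (\<lambda>t. H t y)"
        unfolding H_def by (intro continuous_on_compose2[OF cH'] continuous_intros) auto
    qed (use \<tau> in auto)
    then show ?thesis
      by (simp add: F_def mult.left_commute[of _ "g y"])
  qed
  have "(LINT t:{0..\<tau>}|lborel. LINT x|lborel. g (x + c * (T - t)) * H' (t, x)) = (LINT t|lborel. LINT y|lborel. F t y)"
    by (simp add: set_lebesgue_integral_def inner)
  also have "\<dots> = (LINT y|lborel. LINT t|lborel. F t y)"
    using lborel_pair.Fubini_integral[OF Fi] by simp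
  also have "\<dots> = (LINT y|lborel. g y * G \<tau> y - g y * G 0 y)"
    by (simp add: FTC right_diff_distrib)
  also have "\<dots> = (LINT y|lborel. g y * G \<tau> y) - (LINT y|lborel. g y * G 0 y)"
    using shift2[OF i1[of \<tau>]] shift2[OF i1[of 0]] \<tau> T by (intro Bochner_Integration.integral_diff) (auto simp: G_def)
  finally show "(LINT x|lborel. g (x + c * (T - \<tau>)) * \<psi> (\<tau>, x)) - (LINT x|lborel. g (x + c * (T - 0)) * \<psi> (0, x)) =
        (LINT t:{0..\<tau>}|lborel. LINT x|lborel. g (x + c * (T - t)) * (\<psi>t (t, x) + c * \<psi>x (t, x)))"
    by (simp only: shift1 G_def H'_def)
qed

text \<open>
  Pairing the flow with a test function gives a sum over the modes; since \<open>e i\<close> is an eigenvector, each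
  summand is governed by a scalar transport operator with speed \<open>lam i\<close>.
\<close>
lemma adjoint_flow_solution:
  fixes f :: "real \<Rightarrow> real^'n"
  assumes E: "adjoint_eigenbasis A lam e l" and f: "f \<in> L2_on UNIV" and T: "0 < T"
  shows "adjoint_solution T A f (adjoint_flow T lam e l f)"
  unfolding adjoint_solution_def transport_solution_def
proof (intro conjI allI impI ballI)
  show "AE x in lborel. adjoint_flow T lam e l f T x = f x"
    using E by (simp add: adjoint_flow_def adjoint_eigenbasis_def)
next
  fix \<phi> \<phi>t \<phi>x :: "real \<times> real \<Rightarrow> real^'n" and \<tau> assume "test_fun T \<phi> \<phi>t \<phi>x" and \<tau>: "\<tau> \<in> {0..T}"
  then obtain R where
    dt: "\<And>t x. ((\<lambda>s. \<phi> (s, x)) has_vector_derivative \<phi>t (t, x)) (at t)"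
    and dx: "\<And>t x. ((\<lambda>z. \<phi> (t, z)) has_vector_derivative \<phi>x (t, x)) (at x)"
    and ct: "continuous_on UNIV \<phi>t" and cx: "continuous_on UNIV \<phi>x"
    and supp: "\<And>t x. t \<in> {0..T} \<Longrightarrow> R < \<bar>x\<bar> \<Longrightarrow> \<phi> (t, x) = 0"
    unfolding test_fun_def by blast
  let ?g = "\<lambda>i x. l i \<bullet> f x"
  have dt': "((\<lambda>s. e i \<bullet> \<phi> (s, x)) has_vector_derivative e i \<bullet> \<phi>t (t, x)) (at t)" for i t x
    by (rule bounded_linear.has_vector_derivative[OF bounded_linear_inner_right dt])
  have dx': "((\<lambda>z. e i \<bullet> \<phi> (t, z)) has_vector_derivative e i \<bullet> \<phi>x (t, x)) (at x)" for i t x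
    by (rule bounded_linear.has_vector_derivative[OF bounded_linear_inner_right dx])
  have ct': "continuous_on UNIV (\<lambda>p. e i \<bullet> \<phi>t p)" and cx': "continuous_on UNIV (\<lambda>p. e i \<bullet> \<phi>x p)" for i
    using ct cx by (intro continuous_intros; simp)+
  have supp': "t \<in> {0..T} \<Longrightarrow> R < \<bar>x\<bar> \<Longrightarrow> e i \<bullet> \<phi> (t, x) = 0" for i t x
    using supp by simp
  note W1 = transport_weak_integrable1[OF L2_component[OF f] T \<tau> dt' dx' ct' cx' supp']
   and W2 = transport_weak_integrable2[OF L2_component[OF f] T \<tau> dt' dx' ct' cx' supp']
   and W3 = transport_weak_integrable3[OF L2_component[OF f] T \<tau> dt' dx' ct' cx' supp']
   and W4 = transport_weak_eq[OF L2_component[OF f] T \<tau> dt' dx' ct' cx' supp']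
  have ip: "adjoint_flow T lam e l f t x \<bullet> \<phi> (t, x) = (\<Sum>i\<in>UNIV. ?g i (x + lam i * (T - t)) * (e i \<bullet> \<phi> (t, x)))" for t x
    by (simp add: adjoint_flow_def inner_sum_left)
  have eA: "e i \<bullet> (A *v w) = lam i * (e i \<bullet> w)" for i w
    using E by (simp add: inner_matrix_vector_mult adjoint_eigenbasis_def del: transpose_matrix_vector)
  have ip': "adjoint_flow T lam e l f t x \<bullet> (\<phi>t (t, x) + transpose (transpose A) *v \<phi>x (t, x))
      = (\<Sum>i\<in>UNIV. ?g i (x + lam i * (T - t)) * (e i \<bullet> \<phi>t (t, x) + lam i * (e i \<bullet> \<phi>x (t, x))))" for t x
    by (simp add: adjoint_flow_def inner_sum_left inner_add_right eA sum.distrib distrib_left del: transpose_matrix_vector)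
  have l: "(LINT x|lborel. adjoint_flow T lam e l f t x \<bullet> \<phi> (t, x)) =
      (\<Sum>i\<in>UNIV. LINT x|lborel. ?g i (x + lam i * (T - t)) * (e i \<bullet> \<phi> (t, x)))" if "t \<in> {0..T}" for t
    unfolding ip by (rule Bochner_Integration.integral_sum) (use W1 that in auto)
  have "(LINT t:{0..\<tau>}|lborel. LINT x|lborel. adjoint_flow T lam e l f t x \<bullet> (\<phi>t (t, x) + transpose (transpose A) *v \<phi>x (t, x)))
     = (LINT t:{0..\<tau>}|lborel. \<Sum>i\<in>UNIV. LINT x|lborel. ?g i (x + lam i * (T - t)) * (e i \<bullet> \<phi>t (t, x) + lam i * (e i \<bullet> \<phi>x (t, x))))"
  proof (rule set_lebesgue_integral_cong)
    show "\<forall>t. t \<in> {0..\<tau>} \<longrightarrow> (LINT x|lborel. adjoint_flow T lam e l f t x \<bullet> (\<phi>t (t, x) + transpose (transpose A) *v \<phi>x (t, x)))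
      = (\<Sum>i\<in>UNIV. LINT x|lborel. ?g i (x + lam i * (T - t)) * (e i \<bullet> \<phi>t (t, x) + lam i * (e i \<bullet> \<phi>x (t, x))))"
      unfolding ip' using W2 \<tau> by (auto intro!: Bochner_Integration.integral_sum)
  qed simp
  also have "\<dots> = (\<Sum>i\<in>UNIV. LINT t:{0..\<tau>}|lborel. LINT x|lborel. ?g i (x + lam i * (T - t)) * (e i \<bullet> \<phi>t (t, x) + lam i * (e i \<bullet> \<phi>x (t, x))))"
    unfolding set_lebesgue_integral_def scaleR_sum_right
    by (rule Bochner_Integration.integral_sum) (use W3 in \<open>auto simp: set_integrable_def\<close>)
  also have "\<dots> = (\<Sum>i\<in>UNIV. (LINT x|lborel. ?g i (x + lam i * (T - \<tau>)) * (e i \<bullet> \<phi> (\<tau>, x))) - (LINT x|lborel. ?g i (x + lam i * (T - 0)) * (e i \<bullet> \<phi> (0, x))))"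
    by (simp only: W4)
  also have "\<dots> = (LINT x|lborel. adjoint_flow T lam e l f \<tau> x \<bullet> \<phi> (\<tau>, x)) - (LINT x|lborel. adjoint_flow T lam e l f 0 x \<bullet> \<phi> (0, x))"
    using \<tau> T by (simp add: l sum_subtractf)
  finally show "(LINT x|lborel. adjoint_flow T lam e l f \<tau> x \<bullet> \<phi> (\<tau>, x)) - (LINT x|lborel. adjoint_flow T lam e l f 0 x \<bullet> \<phi> (0, x))
     = (LINT t:{0..\<tau>}|lborel. LINT x|lborel. adjoint_flow T lam e l f t x \<bullet> (\<phi>t (t, x) + transpose (transpose A) *v \<phi>x (t, x)))
      + (LINT p:{0<..<\<tau>} \<times> UNIV|lborel. 0 \<bullet> \<phi> p)"
    by simp
qed (use f in \<open>auto intro: adjoint_flow_L2 adjoint_flow_continuous\<close>)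

section \<open>Data that are never observed\<close>

text \<open>
  Modes with the same eigenvalue see the same translate of the datum, so the observation splits into
  the grouped modal sums at the points \<open>x + \<mu> (T - t)\<close>, each of which vanishes.
\<close>
lemma unobservable_flow:
  fixes A :: "real^'n^'n"
  assumes E: "adjoint_eigenbasis A lam e l"
    and f: "\<And>i. f (x + lam i * (T - t)) \<in> (kalman_space A B (CARD('n) - 1))\<^sup>\<bottom>"
  shows "transpose B *v adjoint_flow T lam e l f t x = 0"
proof -
  have "transpose B *v adjoint_flow T lam e l f t x =
     (\<Sum>\<mu>\<in>range lam. \<Sum>i | lam i = \<mu>. (l i \<bullet> f (x + \<mu> * (T - t))) *\<^sub>R (transpose B *v e i))"
    unfolding observed_flow
    by (rule sum_group_by_eigenvalue[where F = "\<lambda>i \<mu>. (l i \<bullet> f (x + \<mu> * (T - t))) *\<^sub>R (transpose B *v e i)"])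
  also have "\<dots> = 0"
  proof (rule sum.neutral, rule ballI)
    fix \<mu> assume "\<mu> \<in> range lam"
    then have "f (x + \<mu> * (T - t)) \<in> (kalman_space A B (CARD('n) - 1))\<^sup>\<bottom>" using f by auto
    then show "(\<Sum>i | lam i = \<mu>. (l i \<bullet> f (x + \<mu> * (T - t))) *\<^sub>R (transpose B *v e i)) = 0"
      by (rule unobservable_modal_sums_vanish[OF E])
  qed
  finally show ?thesis .
qed

text \<open>
  The null set on which \<open>f\<close> leaves the unobservable space is translated by finitely many amounts, so
  it stays a null set at each time.
\<close>
lemma unobservable_observation_zero:
  fixes A :: "real^'n^'n"
  assumes E: "adjoint_eigenbasis A lam e l" and f: "f \<in> borel_measurable borel"
    and U: "AE x in lborel. f x \<in> (kalman_space A B (CARD('n) - 1))\<^sup>\<bottom>"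
  shows "observation T \<O> B (adjoint_flow T lam e l f) = 0"
proof -
  let ?U = "(kalman_space A B (CARD('n) - 1))\<^sup>\<bottom>"
  have "closed ?U" by (intro closed_subspace subspace_orthogonal_comp)
  then have "?U \<in> sets borel" by simp
  then have pred: "Measurable.pred borel (\<lambda>x. f x \<in> ?U)"
    using f by measurable
  have "(\<integral>\<^sup>+x\<in>\<O>. ennreal ((norm (transpose B *v adjoint_flow T lam e l f t x))\<^sup>2) \<partial>lborel) = 0" for t
  proof -
    have "AE x in lborel. f (lam i * (T - t) + 1 * x) \<in> ?U" for i
      by (rule AE_borel_affine[OF _ pred U]) simp
    then have "AE x in lborel. \<forall>i. f (x + lam i * (T - t)) \<in> ?U"
      by (simp add: add.commute AE_all_countable)
    then have "AE x in lborel. ennreal ((norm (transpose B *v adjoint_flow T lam e l f t x))\<^sup>2) * indicator \<O> x = 0"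
      by eventually_elim (simp add: unobservable_flow[OF E] del: transpose_matrix_vector)
    then have "(\<integral>\<^sup>+x\<in>\<O>. ennreal ((norm (transpose B *v adjoint_flow T lam e l f t x))\<^sup>2) \<partial>lborel) = (\<integral>\<^sup>+(x::real). 0 \<partial>lborel)"
      by (rule nn_integral_cong_AE)
    then show ?thesis by simp
  qed
  then show ?thesis by (simp add: observation_def del: transpose_matrix_vector)
qed

theorem not_observable_on_unobservable_data:
  fixes A :: "real^'n^'n" and normX :: "(real \<Rightarrow> real^'n) \<Rightarrow> real"
  assumes diag: "diagonalizable_over_reals A" and T: "0 < T" and X: "X \<subseteq> L2_on UNIV"
    and f: "f \<in> X" "AE x in lborel. f x \<in> (kalman_space A B (CARD('n) - 1))\<^sup>\<bottom>" "normX f \<noteq> 0"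
  shows "\<not> observable_on X (\<lambda>qT. ennreal ((normX qT)\<^sup>2)) T \<O> A B"
proof
  assume "observable_on X (\<lambda>qT. ennreal ((normX qT)\<^sup>2)) T \<O> A B"
  then obtain C where C: "\<And>q. adjoint_solution T A f q \<Longrightarrow> ennreal ((normX f)\<^sup>2) \<le> ennreal C * observation T \<O> B q"
    using f(1) unfolding observable_on_def by blast
  obtain lam e l where E: "adjoint_eigenbasis A lam e l"
    using adjoint_eigenbasis_exists[OF diag] .
  have fL: "f \<in> L2_on UNIV" using X f(1) by blast
  then have "f \<in> borel_measurable borel" by (simp add: L2_on_UNIV_iff)
  then have "observation T \<O> B (adjoint_flow T lam e l f) = 0"
    by (rule unobservable_observation_zero[OF E _ f(2)])
  then have "ennreal ((normX f)\<^sup>2) \<le> 0"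
    using C[OF adjoint_flow_solution[OF E fL T]] by simp
  then show False using f(3) by (simp add: ennreal_eq_0_iff)
qed

section \<open>A conserved pairing that no control can change\<close>

text \<open>
  A compactly supported profile that is continuously differentiable, which is all the
  regularity that test functions must have.
\<close>
definition bump :: "real \<Rightarrow> real" where
  "bump x = (max 0 (1 - x\<^sup>2))\<^sup>2"

definition bump_deriv :: "real \<Rightarrow> real" where
  "bump_deriv x = - 4 * x * max 0 (1 - x\<^sup>2)"

lemma DERIV_power2_max_0: "((\<lambda>u. (max 0 u)\<^sup>2) has_real_derivative 2 * max 0 u) (at u)" for u :: real
proof (cases u "0 :: real" rule: linorder_cases)
  case less
  have "((\<lambda>u. 0) has_real_derivative 2 * max 0 u) (at u)" using less by (auto intro!: derivative_eq_intros)
  then show ?thesis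
    by (rule has_field_derivative_transform_within[where d = "- u"]) (use less in \<open>auto simp: dist_real_def\<close>)
next
  case equal
  have "((\<lambda>y. ((max 0 y)\<^sup>2 - (max 0 0)\<^sup>2) / (y - 0)) \<longlongrightarrow> 0) (at (0::real))"
  proof (rule Lim_null_comparison)
    show "\<forall>\<^sub>F y in at 0. norm (((max 0 y)\<^sup>2 - (max 0 0)\<^sup>2) / (y - 0)) \<le> \<bar>y :: real\<bar>"
      by (rule always_eventually) (auto simp: max_def power2_eq_square)
    show "((\<lambda>y::real. \<bar>y\<bar>) \<longlongrightarrow> 0) (at 0)" by (rule tendsto_rabs_zero) (rule tendsto_ident_at)
  qed
  then show ?thesis using equal by (simp add: has_field_derivative_iff)
next
  case greater
  have "((\<lambda>u. u\<^sup>2) has_real_derivative 2 * max 0 u) (at u)" using greater by (auto intro!: derivative_eq_intros)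
  then show ?thesis
    by (rule has_field_derivative_transform_within[where d = u]) (use greater in \<open>auto simp: dist_real_def\<close>)
qed

lemma DERIV_bump: "(bump has_real_derivative bump_deriv x) (at x)"
proof -
  have "((\<lambda>x. 1 - x\<^sup>2) has_real_derivative - 2 * x) (at x)"
    by (auto intro!: derivative_eq_intros)
  from DERIV_chain2[OF DERIV_power2_max_0 this] show ?thesis
    unfolding bump_def[abs_def] bump_deriv_def by (simp add: algebra_simps)
qed

lemma continuous_bump_deriv: "continuous_on UNIV bump_deriv"
  unfolding bump_deriv_def[abs_def] by (intro continuous_intros)

lemma bump_eq_0: "1 < \<bar>x\<bar> \<Longrightarrow> bump x = 0"
  using power_strict_mono[of 1 "\<bar>x\<bar>" 2] by (simp add: bump_def max_def)

lemma bump_nonneg: "0 \<le> bump x" and bump_le_1: "bump x \<le> 1"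
  by (auto simp: bump_def max_def power_le_one)

lemma bump_measurable [measurable]: "bump \<in> borel_measurable borel"
  unfolding bump_def[abs_def] by measurable

lemma integrable_bump_power2: "integrable lborel (\<lambda>x. (bump x)\<^sup>2)"
proof (rule Bochner_Integration.integrable_bound)
  show "integrable lborel (indicator {-1..1} :: real \<Rightarrow> real)"
    by (intro integrable_real_indicator) (auto simp: emeasure_lborel_Icc_eq)
  show "AE x in lborel. norm ((bump x)\<^sup>2) \<le> norm (indicator {-1..1} x :: real)"
    using bump_eq_0 bump_nonneg bump_le_1
    by (intro AE_I2) (auto simp: indicator_def power_le_one abs_le_iff not_le)
qed simp

lemma integral_bump_power2_pos: "0 < (LINT x|lborel. (bump x)\<^sup>2)"
proof -
  have "(LINT x|lborel. (1/16) * indicator {-1/2..1/2::real} x) \<le> (LINT x|lborel. (bump x)\<^sup>2)"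
  proof (rule integral_mono[OF _ integrable_bump_power2])
    show "integrable lborel (\<lambda>x::real. (1/16) * indicator {-1/2..1/2} x :: real)"
      by (intro integrable_mult_right integrable_real_indicator) (auto simp: emeasure_lborel_Icc_eq)
    show "(1/16) * indicator {-1/2..1/2} x \<le> (bump x)\<^sup>2" for x :: real
    proof (cases "x \<in> {-1/2..1/2}")
      case True
      then have "\<bar>x\<bar> \<le> 1/2" by auto
      then have "x\<^sup>2 \<le> (1/2)\<^sup>2" using power_mono[of "\<bar>x\<bar>" "1/2" 2] by simp
      then have "1/2 \<le> 1 - x\<^sup>2" by (simp add: power_divide)
      then have "1/2 \<le> max 0 (1 - x\<^sup>2)" by (rule order_trans) simp
      then have "(1/2)\<^sup>2 \<le> bump x" unfolding bump_def by (rule power_mono) simp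
      then have "((1/2)\<^sup>2)\<^sup>2 \<le> (bump x)\<^sup>2" by (rule power_mono) simp
      then show ?thesis using True by (simp add: power2_eq_square)
    qed simp
  qed
  moreover have "0 < (LINT x|lborel. (1/16) * indicator {-1/2..1/2::real} x :: real)" by simp
  ultimately show ?thesis by linarith
qed

text \<open>
  The flow with a bump profile is a classical adjoint solution with compact support, hence
  admissible as a test function for the controlled system.
\<close>
lemma test_fun_bump_flow:
  fixes v :: "real^'n"
  assumes T: "0 < T"
  shows "test_fun T (\<lambda>(t, x). adjoint_flow T lam e l (\<lambda>x. bump x *\<^sub>R v) t x)
     (\<lambda>(t, x). \<Sum>i\<in>UNIV. (- lam i * (l i \<bullet> bump_deriv (x + lam i * (T - t)) *\<^sub>R v)) *\<^sub>R e i)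
     (\<lambda>(t, x). adjoint_flow T lam e l (\<lambda>x. bump_deriv x *\<^sub>R v) t x)"
  unfolding test_fun_def
proof (intro conjI allI)
  fix t x
  have "((\<lambda>s. bump (x + lam i * (T - s))) has_real_derivative bump_deriv (x + lam i * (T - t)) * (- lam i)) (at t)" for i
    by (rule DERIV_chain2[OF DERIV_bump]) (auto intro!: derivative_eq_intros)
  then have "((\<lambda>s. bump (x + lam i * (T - s)) * (l i \<bullet> v)) has_vector_derivative
      bump_deriv (x + lam i * (T - t)) * (- lam i) * (l i \<bullet> v)) (at t)" for i
    unfolding has_real_derivative_iff_has_vector_derivative[symmetric] by (rule DERIV_cmult_right)
  then have "((\<lambda>s. (bump (x + lam i * (T - s)) * (l i \<bullet> v)) *\<^sub>R e i) has_vector_derivative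
      (bump_deriv (x + lam i * (T - t)) * (- lam i) * (l i \<bullet> v)) *\<^sub>R e i) (at t)" for i
    by (rule bounded_linear.has_vector_derivative[OF bounded_linear_scaleR_left])
  then have "((\<lambda>s. \<Sum>i\<in>UNIV. (bump (x + lam i * (T - s)) * (l i \<bullet> v)) *\<^sub>R e i) has_vector_derivative
      (\<Sum>i\<in>UNIV. (bump_deriv (x + lam i * (T - t)) * (- lam i) * (l i \<bullet> v)) *\<^sub>R e i)) (at t)"
    by (intro has_vector_derivative_sum) auto
  then show "((\<lambda>s. case (s, x) of (t, x) \<Rightarrow> adjoint_flow T lam e l (\<lambda>x. bump x *\<^sub>R v) t x) has_vector_derivative
      (case (t, x) of (t, x) \<Rightarrow> \<Sum>i\<in>UNIV. (- lam i * (l i \<bullet> bump_deriv (x + lam i * (T - t)) *\<^sub>R v)) *\<^sub>R e i)) (at t)"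
    by (simp add: adjoint_flow_def mult.assoc mult.left_commute[of "bump_deriv _"])
next
  fix t x
  have "((\<lambda>z. bump (z + lam i * (T - t))) has_real_derivative bump_deriv (x + lam i * (T - t)) * 1) (at x)" for i
    by (rule DERIV_chain2[OF DERIV_bump]) (auto intro!: derivative_eq_intros)
  then have "((\<lambda>z. bump (z + lam i * (T - t)) * (l i \<bullet> v)) has_vector_derivative
      bump_deriv (x + lam i * (T - t)) * 1 * (l i \<bullet> v)) (at x)" for i
    unfolding has_real_derivative_iff_has_vector_derivative[symmetric] by (rule DERIV_cmult_right)
  then have "((\<lambda>z. (bump (z + lam i * (T - t)) * (l i \<bullet> v)) *\<^sub>R e i) has_vector_derivative
      (bump_deriv (x + lam i * (T - t)) * 1 * (l i \<bullet> v)) *\<^sub>R e i) (at x)" for i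
    by (rule bounded_linear.has_vector_derivative[OF bounded_linear_scaleR_left])
  then have "((\<lambda>z. \<Sum>i\<in>UNIV. (bump (z + lam i * (T - t)) * (l i \<bullet> v)) *\<^sub>R e i) has_vector_derivative
      (\<Sum>i\<in>UNIV. (bump_deriv (x + lam i * (T - t)) * 1 * (l i \<bullet> v)) *\<^sub>R e i)) (at x)"
    by (intro has_vector_derivative_sum) auto
  then show "((\<lambda>z. case (t, z) of (t, x) \<Rightarrow> adjoint_flow T lam e l (\<lambda>x. bump x *\<^sub>R v) t x) has_vector_derivative
      (case (t, x) of (t, x) \<Rightarrow> adjoint_flow T lam e l (\<lambda>x. bump_deriv x *\<^sub>R v) t x)) (at x)"
    by (simp add: adjoint_flow_def)
next
  have c: "continuous_on UNIV (\<lambda>p. bump_deriv (snd p + lam i * (T - fst p)))" for i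
    by (rule continuous_on_compose2[OF continuous_bump_deriv]) (auto intro!: continuous_intros)
  show "continuous_on UNIV (\<lambda>(t, x). \<Sum>i\<in>UNIV. (- lam i * (l i \<bullet> bump_deriv (x + lam i * (T - t)) *\<^sub>R v)) *\<^sub>R e i)"
    unfolding case_prod_unfold by (intro continuous_intros c)
  show "continuous_on UNIV (\<lambda>(t, x). adjoint_flow T lam e l (\<lambda>x. bump_deriv x *\<^sub>R v) t x)"
    unfolding case_prod_unfold adjoint_flow_def by (intro continuous_intros c)
  have "adjoint_flow T lam e l (\<lambda>x. bump x *\<^sub>R v) t x = 0"
    if "t \<in> {0..T}" "1 + (\<Sum>i\<in>UNIV. \<bar>lam i\<bar>) * T < \<bar>x\<bar>" for t x
  proof -
    have "bump (x + lam i * (T - t)) = 0" for i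
    proof (rule bump_eq_0)
      have "\<bar>lam i * (T - t)\<bar> \<le> \<bar>lam i\<bar> * T"
        using that(1) by (auto simp: abs_mult intro!: mult_left_mono)
      also have "\<dots> \<le> (\<Sum>i\<in>UNIV. \<bar>lam i\<bar>) * T"
        using T by (intro mult_right_mono member_le_sum) auto
      finally show "1 < \<bar>x + lam i * (T - t)\<bar>" using that(2) by linarith
    qed
    then show ?thesis by (simp add: adjoint_flow_def)
  qed
  then show "\<exists>R. \<forall>t\<in>{0..T}. \<forall>x. R < \<bar>x\<bar> \<longrightarrow> (case (t, x) of (t, x) \<Rightarrow> adjoint_flow T lam e l (\<lambda>x. bump x *\<^sub>R v) t x) = 0"
    by (intro exI[of _ "1 + (\<Sum>i\<in>UNIV. \<bar>lam i\<bar>) * T"]) auto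
qed

text \<open>
  Test the controlled equation with the unobservable adjoint solution that ends in \<open>bump x *\<^sub>R v\<close>.
  The adjoint equation removes the volume term and unobservability removes the control, so the pairing
  is the same at both ends. Steering \<open>0\<close> to \<open>bump x *\<^sub>R v\<close> would make it both zero and positive.
\<close>
theorem not_exactly_controllable:
  fixes A :: "real^'n^'n" and B :: "real^'m^'n"
  assumes diag: "diagonalizable_over_reals A" and T: "0 < T"
    and v: "v \<in> (kalman_space A B (CARD('n) - 1))\<^sup>\<bottom>" "v \<noteq> 0"
  shows "\<not> exactly_controllable T \<O> A B"
proof
  assume ec: "exactly_controllable T \<O> A B"
  obtain lam e l where E: "adjoint_eigenbasis A lam e l"
    using adjoint_eigenbasis_exists[OF diag] .
  let ?U = "(kalman_space A B (CARD('n) - 1))\<^sup>\<bottom>"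
  let ?flow = "\<lambda>t x. adjoint_flow T lam e l (\<lambda>x. bump x *\<^sub>R v) t x"
  have y1: "(\<lambda>x. bump x *\<^sub>R v) \<in> L2_on UNIV"
    using integrable_bump_power2 by (simp add: L2_on_UNIV_iff power_mult_distrib)
  have y0: "(\<lambda>x. 0 :: real^'n) \<in> L2_on UNIV" by (simp add: L2_on_UNIV_iff)
  from ec[unfolded exactly_controllable_def, rule_format, OF y0 y1]
  obtain u y where sol: "transport_solution T A (\<lambda>(t, x). indicator \<O> x *\<^sub>R (B *v u (t, x))) y"
    and y: "AE x in lborel. y 0 x = 0" "AE x in lborel. y T x = bump x *\<^sub>R v" by blast
  have yL: "y t \<in> borel_measurable borel" if "t \<in> {0..T}" for t
    using sol that by (auto simp: transport_solution_def L2_on_UNIV_iff)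
  have fm: "?flow t \<in> borel_measurable borel" for t
    using adjoint_flow_L2[OF y1] by (simp add: L2_on_UNIV_iff)
  define \<phi>t where "\<phi>t = (\<lambda>(t, x). \<Sum>i\<in>UNIV. (- lam i * (l i \<bullet> bump_deriv (x + lam i * (T - t)) *\<^sub>R v)) *\<^sub>R e i)"
  define \<phi>x where "\<phi>x = (\<lambda>(t, x). adjoint_flow T lam e l (\<lambda>x. bump_deriv x *\<^sub>R v) t x)"
  have tf: "test_fun T (\<lambda>(t, x). ?flow t x) \<phi>t \<phi>x"
    unfolding \<phi>t_def \<phi>x_def by (rule test_fun_bump_flow[OF T])
  have adj: "\<phi>t (t, x) + transpose A *v \<phi>x (t, x) = 0" for t x
  proof -
    have "transpose A *v \<phi>x (t, x) = (\<Sum>i\<in>UNIV. (l i \<bullet> bump_deriv (x + lam i * (T - t)) *\<^sub>R v) *\<^sub>R (transpose A *v e i))"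
      by (simp add: \<phi>x_def observed_flow del: transpose_matrix_vector)
    also have "\<dots> = (\<Sum>i\<in>UNIV. (lam i * (l i \<bullet> bump_deriv (x + lam i * (T - t)) *\<^sub>R v)) *\<^sub>R e i)"
      using E by (simp add: adjoint_eigenbasis_def mult.commute del: transpose_matrix_vector)
    finally show ?thesis by (simp add: \<phi>t_def sum_negf)
  qed
  have obs: "transpose B *v ?flow t x = 0" for t x
    by (rule unobservable_flow[OF E]) (rule subspace_scale[OF subspace_orthogonal_comp v(1)])
  have "(case p of (t, x) \<Rightarrow> indicator \<O> x *\<^sub>R (B *v u (t, x))) \<bullet> (case p of (t, x) \<Rightarrow> ?flow t x) = 0" for p
  proof -
    obtain t x where p: "p = (t, x)" by force
    have "(B *v u (t, x)) \<bullet> ?flow t x = u (t, x) \<bullet> (transpose B *v ?flow t x)"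
      by (simp only: inner_transpose_matrix_vector_mult)
    then show ?thesis by (simp only: p prod.case obs inner_zero_right inner_scaleR_left mult_zero_right)
  qed
  moreover have "(LINT x|lborel. y T x \<bullet> (case (T, x) of (t, x) \<Rightarrow> ?flow t x)) - (LINT x|lborel. y 0 x \<bullet> (case (0, x) of (t, x) \<Rightarrow> ?flow t x)) =
        (LINT t:{0..T}|lborel. LINT x|lborel. y t x \<bullet> (\<phi>t (t, x) + transpose A *v \<phi>x (t, x))) +
        (LINT p:{0<..<T} \<times> UNIV|lborel. (case p of (t, x) \<Rightarrow> indicator \<O> x *\<^sub>R (B *v u (t, x))) \<bullet> (case p of (t, x) \<Rightarrow> ?flow t x))"
    using sol tf T unfolding transport_solution_def by (meson atLeastAtMost_iff less_imp_le order_refl)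
  ultimately have eq: "(LINT x|lborel. y T x \<bullet> ?flow T x) = (LINT x|lborel. y 0 x \<bullet> ?flow 0 x)"
    by (simp only: adj inner_zero_right) (simp add: set_lebesgue_integral_def)
  have "(LINT x|lborel. y 0 x \<bullet> ?flow 0 x) = (LINT (x::real)|lborel. 0)"
    using y(1) yL[of 0] fm[of 0] T by (intro integral_cong_AE) auto
  moreover have "(LINT x|lborel. y T x \<bullet> ?flow T x) = (LINT x|lborel. (norm v)\<^sup>2 * (bump x)\<^sup>2)"
  proof (rule integral_cong_AE)
    show "AE x in lborel. y T x \<bullet> ?flow T x = (norm v)\<^sup>2 * (bump x)\<^sup>2"
      using y(2)
    proof eventually_elim
      case (elim x)
      have "?flow T x = bump x *\<^sub>R v"
        using E by (simp add: adjoint_flow_def adjoint_eigenbasis_def del: inner_scaleR_right)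
      then show ?case using elim by (simp add: power2_norm_eq_inner) (simp add: power2_eq_square)
    qed
  qed (use yL[of T] fm[of T] T in auto)
  ultimately have "(norm v)\<^sup>2 * (LINT x|lborel. (bump x)\<^sup>2) = 0" using eq by simp
  then show False using integral_bump_power2_pos v(2) by simp
qed

section \<open>Dilated Gaussian data\<close>

text \<open>
  Raise \<open>y / n \<le> exp (y / n)\<close> to the power \<open>n\<close>.
\<close>
lemma power_le_power_self_exp:
  fixes y :: real
  assumes "0 \<le> y"
  shows "y ^ n \<le> real n ^ n * exp y"
proof (cases "n = 0")
  case False
  have "y / real n \<le> exp (y / real n)"
    using exp_ge_add_one_self[of "y / real n"] by linarith
  then have "y \<le> real n * exp (y / real n)" using False by (simp add: field_simps)
  then have "y ^ n \<le> (real n * exp (y / real n)) ^ n" using assms by (rule power_mono)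
  also have "\<dots> = real n ^ n * exp y"
    using False by (simp add: power_mult_distrib flip: exp_of_nat_mult)
  finally show ?thesis .
qed (use assms in simp)

lemma bounded_monomial_gaussian: "bounded (range (\<lambda>x::real. x ^ n * exp (- (x\<^sup>2) / 2)))"
proof -
  have "\<bar>x ^ n * exp (- (x\<^sup>2) / 2)\<bar> \<le> 1 + 2 ^ n * real n ^ n" for x :: real
  proof -
    \<comment> \<open>Passing to the even power \<open>2 * n\<close> makes everything a function of \<open>x\<^sup>2 / 2\<close>.\<close>
    have "0 \<le> (\<bar>x\<bar> ^ n - 1)\<^sup>2" by simp
    then have "2 * \<bar>x\<bar> ^ n \<le> 1 + (\<bar>x\<bar> ^ n)\<^sup>2" by (simp add: power2_eq_square algebra_simps)
    moreover have "0 \<le> \<bar>x\<bar> ^ n" by simp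
    ultimately have 1: "\<bar>x\<bar> ^ n \<le> 1 + (\<bar>x\<bar> ^ n)\<^sup>2" by linarith
    have "(\<bar>x\<bar> ^ n)\<^sup>2 = (\<bar>x\<bar>\<^sup>2) ^ n"
      by (simp only: power_mult[symmetric] mult.commute)
    also have "\<dots> = 2 ^ n * (x\<^sup>2 / 2) ^ n"
      by (simp add: power_divide)
    also have "\<dots> \<le> 2 ^ n * (real n ^ n * exp (x\<^sup>2 / 2))"
      by (intro mult_left_mono power_le_power_self_exp) auto
    finally have "\<bar>x\<bar> ^ n \<le> 1 + 2 ^ n * (real n ^ n * exp (x\<^sup>2 / 2))" using 1 by linarith
    then have "\<bar>x\<bar> ^ n * exp (- (x\<^sup>2) / 2) \<le> (1 + 2 ^ n * (real n ^ n * exp (x\<^sup>2 / 2))) * exp (- (x\<^sup>2) / 2)"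
      by (rule mult_right_mono) simp
    also have "\<dots> = exp (- (x\<^sup>2) / 2) + 2 ^ n * real n ^ n"
      by (simp add: algebra_simps flip: exp_add)
    also have "\<dots> \<le> 1 + 2 ^ n * real n ^ n" by simp
    finally show ?thesis by (simp add: abs_mult power_abs)
  qed
  then show ?thesis by (auto simp: bounded_iff intro!: exI[of _ "1 + 2 ^ n * real n ^ n"])
qed

text \<open>
  Up to sign these are the probabilists' Hermite polynomials: differentiating \<open>p(x) exp (- x\<^sup>2 / 2)\<close>
  replaces \<open>p\<close> by \<open>p' - x p\<close>.
\<close>
definition gaussian_poly :: "nat \<Rightarrow> real poly" where
  "gaussian_poly j = ((\<lambda>p. pderiv p - [:0, 1:] * p) ^^ j) 1"

definition gaussian_deriv :: "nat \<Rightarrow> real \<Rightarrow> real" where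
  "gaussian_deriv j x = poly (gaussian_poly j) x * exp (- (x\<^sup>2) / 2)"

lemma gaussian_deriv_0: "gaussian_deriv 0 x = exp (- (x\<^sup>2) / 2)"
  by (simp add: gaussian_deriv_def gaussian_poly_def)

lemma DERIV_gaussian_deriv: "(gaussian_deriv j has_real_derivative gaussian_deriv (Suc j) x) (at x)"
proof -
  have "((\<lambda>x. poly (gaussian_poly j) x * exp (- (x\<^sup>2) / 2)) has_real_derivative
      poly (pderiv (gaussian_poly j)) x * exp (- (x\<^sup>2) / 2) + (exp (- (x\<^sup>2) / 2) * - x) * poly (gaussian_poly j) x) (at x)"
    by (intro DERIV_mult poly_DERIV) (auto intro!: derivative_eq_intros)
  then show ?thesis
    unfolding gaussian_deriv_def[abs_def] by (simp add: gaussian_poly_def algebra_simps)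
qed

lemma gaussian_deriv_measurable [measurable]: "gaussian_deriv j \<in> borel_measurable borel"
  by (intro borel_measurable_continuous_onI continuous_at_imp_continuous_on ballI DERIV_isCont[OF DERIV_gaussian_deriv])

lemma bounded_power_gaussian_deriv: "bounded (range (\<lambda>x. x ^ n * gaussian_deriv j x))"
proof -
  have "bounded (range (\<lambda>x::real. x ^ n * (poly p x * exp (- (x\<^sup>2) / 2))))" for p n
  proof (induction p arbitrary: n)
    case (pCons a p)
    have "bounded (range (\<lambda>x::real. a *\<^sub>R (x ^ n * exp (- (x\<^sup>2) / 2))))"
      using bounded_scaling[OF bounded_monomial_gaussian[of n], of a] by (simp add: image_image)
    from bounded_plus_comp[OF this pCons.IH[of "Suc n"]]
    show ?case by (simp add: algebra_simps)
  qed simp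
  then show ?thesis by (simp add: gaussian_deriv_def)
qed

lemma gaussian_deriv_decay: "\<exists>C\<ge>0. \<forall>x. \<bar>gaussian_deriv j x\<bar> \<le> C / (1 + x\<^sup>2)"
proof -
  obtain C0 where C0: "\<And>x. \<bar>x ^ 0 * gaussian_deriv j x\<bar> \<le> C0"
    using bounded_power_gaussian_deriv[of 0 j] by (force simp: bounded_iff)
  obtain C2 where C2: "\<And>x. \<bar>x ^ 2 * gaussian_deriv j x\<bar> \<le> C2"
    using bounded_power_gaussian_deriv[of 2 j] by (force simp: bounded_iff)
  have "\<bar>gaussian_deriv j x\<bar> \<le> (C0 + C2) / (1 + x\<^sup>2)" for x
  proof -
    have "(1 + x\<^sup>2) * \<bar>gaussian_deriv j x\<bar> \<le> C0 + C2"
      using C0[of x] C2[of x] by (simp add: abs_mult distrib_right)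
    moreover have "0 < 1 + x\<^sup>2" by (simp add: add_pos_nonneg)
    ultimately show ?thesis by (simp add: pos_le_divide_eq mult.commute)
  qed
  moreover have "0 \<le> C0 + C2" using C0[of 0] C2[of 0] by linarith
  ultimately show ?thesis by blast
qed

lemma gaussian_schwartz:
  fixes v :: "'b::euclidean_space"
  assumes "0 < \<epsilon>"
  shows "(\<lambda>x. gaussian_deriv 0 (\<epsilon> * x) *\<^sub>R v) \<in> schwartz"
  unfolding schwartz_def
proof (intro CollectI exI conjI allI)
  let ?D = "\<lambda>j x. (\<epsilon> ^ j * gaussian_deriv j (\<epsilon> * x)) *\<^sub>R v"
  show "?D 0 = (\<lambda>x. gaussian_deriv 0 (\<epsilon> * x) *\<^sub>R v)" by simp
  fix j
  show "(?D j has_vector_derivative ?D (Suc j) x) (at x)" for x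
  proof -
    have "((\<lambda>x. \<epsilon> * x) has_real_derivative \<epsilon>) (at x)" by (auto intro!: derivative_eq_intros)
    from DERIV_cmult[OF DERIV_chain2[OF DERIV_gaussian_deriv this], of "\<epsilon> ^ j"]
    have "((\<lambda>x. \<epsilon> ^ j * gaussian_deriv j (\<epsilon> * x)) has_vector_derivative \<epsilon> ^ Suc j * gaussian_deriv (Suc j) (\<epsilon> * x)) (at x)"
      by (simp add: has_real_derivative_iff_has_vector_derivative ac_simps)
    then show ?thesis by (rule bounded_linear.has_vector_derivative[OF bounded_linear_scaleR_left])
  qed
  fix n
  obtain C where C: "\<And>x. \<bar>x ^ n * gaussian_deriv j x\<bar> \<le> C"
    using bounded_power_gaussian_deriv[of n j] by (force simp: bounded_iff)
  have "norm (x ^ n *\<^sub>R ?D j x) \<le> \<epsilon> ^ j / \<epsilon> ^ n * C * norm v" for x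
  proof -
    have "x ^ n *\<^sub>R ?D j x = (\<epsilon> ^ j / \<epsilon> ^ n * ((\<epsilon> * x) ^ n * gaussian_deriv j (\<epsilon> * x))) *\<^sub>R v"
      using assms by (simp add: power_mult_distrib)
    then have "norm (x ^ n *\<^sub>R ?D j x) = \<epsilon> ^ j / \<epsilon> ^ n * \<bar>(\<epsilon> * x) ^ n * gaussian_deriv j (\<epsilon> * x)\<bar> * norm v"
      using assms by (simp only: norm_scaleR abs_mult) simp
    also have "\<dots> \<le> \<epsilon> ^ j / \<epsilon> ^ n * C * norm v"
      using assms C by (intro mult_right_mono mult_left_mono) auto
    finally show ?thesis .
  qed
  then show "bounded (range (\<lambda>x. x ^ n *\<^sub>R ?D j x))" by (auto simp: bounded_iff)
qed

lemma integrable_inverse_1_plus_power2: "integrable lborel (\<lambda>x::real. 1 / (1 + x\<^sup>2))"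
  using integrable_inverse_1_plus_square by (simp add: set_integrable_def inverse_eq_divide)

lemma schwartz_L2:
  fixes f :: "real \<Rightarrow> 'b::euclidean_space"
  assumes "f \<in> schwartz"
  shows "f \<in> L2_on UNIV"
proof -
  obtain D where D: "D 0 = f" "\<And>j x. (D j has_vector_derivative D (Suc j) x) (at x)"
    "\<And>j l. bounded (range (\<lambda>x. x ^ l *\<^sub>R D j x))"
    using assms unfolding schwartz_def by blast
  have "continuous_on UNIV f"
    using D(2)[of 0] D(1) by (intro continuous_at_imp_continuous_on) (auto intro: has_vector_derivative_continuous)
  then have m[measurable]: "f \<in> borel_measurable borel" by (rule borel_measurable_continuous_onI)
  obtain C0 where C0: "\<And>x. norm (x ^ 0 *\<^sub>R f x) \<le> C0" using D(3)[of 0 0] D(1) by (force simp: bounded_iff)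
  obtain C1 where C1: "\<And>x. norm (x ^ 1 *\<^sub>R f x) \<le> C1" using D(3)[of 1 0] D(1) by (force simp: bounded_iff)
  have "integrable lborel (\<lambda>x. (norm (f x))\<^sup>2)"
  proof (rule Bochner_Integration.integrable_bound)
    show "integrable lborel (\<lambda>x::real. (C0\<^sup>2 + C1\<^sup>2) * (1 / (1 + x\<^sup>2)))"
      by (intro integrable_mult_right integrable_inverse_1_plus_power2)
    show "AE x in lborel. norm ((norm (f x))\<^sup>2) \<le> norm ((C0\<^sup>2 + C1\<^sup>2) * (1 / (1 + x\<^sup>2)))"
    proof (rule AE_I2)
      fix x :: real
      have "(norm (f x))\<^sup>2 \<le> C0\<^sup>2" using C0[of x] by (intro power_mono) auto
      moreover have "(\<bar>x\<bar> * norm (f x))\<^sup>2 \<le> C1\<^sup>2" using C1[of x] by (intro power_mono) auto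
      ultimately have "(1 + x\<^sup>2) * (norm (f x))\<^sup>2 \<le> C0\<^sup>2 + C1\<^sup>2" by (simp add: power_mult_distrib distrib_right)
      moreover have "0 < 1 + x\<^sup>2" by (simp add: add_pos_nonneg)
      ultimately have "(norm (f x))\<^sup>2 \<le> (C0\<^sup>2 + C1\<^sup>2) * (1 / (1 + x\<^sup>2))" by (simp add: pos_le_divide_eq mult.commute)
      then show "norm ((norm (f x))\<^sup>2) \<le> norm ((C0\<^sup>2 + C1\<^sup>2) * (1 / (1 + x\<^sup>2)))" by simp
    qed
  qed measurable
  then show ?thesis by (simp add: L2_on_UNIV_iff)
qed

lemma nn_integral_inverse_1_plus_power2:
  obtains I where "0 \<le> I" "\<And>\<epsilon>. 0 < \<epsilon> \<Longrightarrow> (\<integral>\<^sup>+x. ennreal (1 / (1 + (\<epsilon> * x)\<^sup>2)) \<partial>lborel) = ennreal (I / \<epsilon>)"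
proof
  let ?I = "LINT x|lborel. 1 / (1 + x\<^sup>2) :: real"
  show I: "0 \<le> ?I" by (intro integral_nonneg_AE) auto
  fix \<epsilon> :: real assume e: "0 < \<epsilon>"
  let ?X = "\<integral>\<^sup>+x. ennreal (1 / (1 + (\<epsilon> * x)\<^sup>2)) \<partial>lborel"
  have "ennreal ?I = (\<integral>\<^sup>+x. ennreal (1 / (1 + x\<^sup>2)) \<partial>lborel)"
    by (rule nn_integral_eq_integral[OF integrable_inverse_1_plus_power2, symmetric]) auto
  also have "\<dots> = ennreal \<epsilon> * ?X"
    using nn_integral_real_affine[of "\<lambda>x. ennreal (1 / (1 + x\<^sup>2))" \<epsilon> 0] e by simp
  finally have "ennreal (1 / \<epsilon>) * ennreal ?I = ennreal (1 / \<epsilon>) * (ennreal \<epsilon> * ?X)" by simp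
  then show "?X = ennreal (?I / \<epsilon>)"
    using e I by (simp add: mult.assoc[symmetric] flip: ennreal_mult)
qed

section \<open>Smallness of the observation on a Kalman layer\<close>

text \<open>
  Expand the \<open>i\<close>-th translate around \<open>\<epsilon> x\<close> to order \<open>k\<close>. The term of order \<open>m\<close> is a common factor times
  the \<open>m\<close>-th moment of the coefficients and cancels for \<open>m < k\<close>. The remainder carries the factor \<open>\<epsilon> ^ k\<close>
  and a derivative of the Gaussian at distance at most \<open>L\<close> from \<open>\<epsilon> x\<close>; quadratic decay is insensitive
  to a bounded shift of the argument.
\<close>
lemma modal_taylor_bound:
  fixes c :: "'i \<Rightarrow> 'b::real_normed_vector" and lam :: "'i \<Rightarrow> real"
  assumes fin: "finite I" and vanish: "\<And>j. j < k \<Longrightarrow> (\<Sum>i\<in>I. lam i ^ j *\<^sub>R c i) = 0"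
    and L: "\<And>i. i \<in> I \<Longrightarrow> \<bar>lam i\<bar> * T \<le> L" and T: "0 \<le> T"
  obtains K where "0 \<le> K"
    "\<And>\<epsilon> s x. 0 < \<epsilon> \<Longrightarrow> \<epsilon> \<le> 1 \<Longrightarrow> 0 \<le> s \<Longrightarrow> s \<le> T \<Longrightarrow>
       norm (\<Sum>i\<in>I. gaussian_deriv 0 (\<epsilon> * (x + lam i * s)) *\<^sub>R c i) \<le> K * \<epsilon> ^ k / (1 + (\<epsilon> * x)\<^sup>2)"
proof -
  obtain C where C: "0 \<le> C" "\<And>x. \<bar>gaussian_deriv k x\<bar> \<le> C / (1 + x\<^sup>2)"
    using gaussian_deriv_decay by blast
  define C' where "C' = C * (2 * (1 + L\<^sup>2))"
  have C': "0 \<le> C'" using C(1) by (simp add: C'_def)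
  have near: "\<bar>gaussian_deriv k (a + \<theta>)\<bar> \<le> C' / (1 + a\<^sup>2)" if "\<bar>\<theta>\<bar> \<le> L" for a \<theta>
  proof -
    have "\<theta>\<^sup>2 \<le> L\<^sup>2" using power_mono[OF that, of 2] by simp
    moreover have "a\<^sup>2 \<le> 2 * (a + \<theta>)\<^sup>2 + 2 * \<theta>\<^sup>2"
      using zero_le_power2[of "a + 2 * \<theta>"] by (simp add: power2_eq_square algebra_simps)
    ultimately have "1 + a\<^sup>2 \<le> 2 + 2 * L\<^sup>2 + 2 * (a + \<theta>)\<^sup>2 + 2 * (L\<^sup>2 * (a + \<theta>)\<^sup>2)"
      using mult_nonneg_nonneg[OF zero_le_power2[of L] zero_le_power2[of "a + \<theta>"]] by linarith
    also have "\<dots> = 2 * (1 + L\<^sup>2) * (1 + (a + \<theta>)\<^sup>2)" by (simp only: ring_distribs mult_1_right mult_1_left)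
    finally have "1 + a\<^sup>2 \<le> 2 * (1 + L\<^sup>2) * (1 + (a + \<theta>)\<^sup>2)" .
    then have "C * (1 + a\<^sup>2) \<le> C' * (1 + (a + \<theta>)\<^sup>2)"
      using mult_left_mono[of "1 + a\<^sup>2" _ C] C(1) by (simp add: C'_def mult.assoc)
    moreover have "0 < 1 + a\<^sup>2" "0 < 1 + (a + \<theta>)\<^sup>2" by (simp_all add: add_pos_nonneg)
    ultimately have "C / (1 + (a + \<theta>)\<^sup>2) \<le> C' / (1 + a\<^sup>2)" by (simp add: field_simps)
    with C(2)[of "a + \<theta>"] show ?thesis by linarith
  qed
  define K where "K = (\<Sum>i\<in>I. C' * L ^ k * norm (c i))"
  show ?thesis
  proof
    have L0: "0 \<le> L" if "i \<in> I" for i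
      using L[OF that] T by (meson abs_ge_zero mult_nonneg_nonneg order_trans)
    show "0 \<le> K" unfolding K_def using C' L0 by (intro sum_nonneg mult_nonneg_nonneg zero_le_power) auto
    fix \<epsilon> s x :: real assume e: "0 < \<epsilon>" "\<epsilon> \<le> 1" and s: "0 \<le> s" "s \<le> T"
    have "\<exists>\<theta>. \<bar>\<theta>\<bar> \<le> \<bar>\<epsilon> * lam i * s\<bar> \<and> gaussian_deriv 0 (\<epsilon> * x + \<epsilon> * lam i * s) =
       (\<Sum>m<k. (gaussian_deriv m (\<epsilon> * x + 0) / fact m) * (\<epsilon> * lam i * s) ^ m) +
       gaussian_deriv k (\<epsilon> * x + \<theta>) / fact k * (\<epsilon> * lam i * s) ^ k" for i
    proof (rule Maclaurin_all_le[where diff = "\<lambda>m y. gaussian_deriv m (\<epsilon> * x + y)"])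
      show "\<forall>m y. ((\<lambda>y. gaussian_deriv m (\<epsilon> * x + y)) has_real_derivative gaussian_deriv (Suc m) (\<epsilon> * x + y)) (at y)"
      proof (intro allI)
        fix m y
        have "((\<lambda>y. \<epsilon> * x + y) has_real_derivative 1) (at y)" by (auto intro!: derivative_eq_intros)
        from DERIV_chain2[OF DERIV_gaussian_deriv this]
        show "((\<lambda>y. gaussian_deriv m (\<epsilon> * x + y)) has_real_derivative gaussian_deriv (Suc m) (\<epsilon> * x + y)) (at y)" by simp
      qed
    qed simp
    then have "\<forall>i. \<exists>\<theta>. \<bar>\<theta>\<bar> \<le> \<bar>\<epsilon> * lam i * s\<bar> \<and> gaussian_deriv 0 (\<epsilon> * x + \<epsilon> * lam i * s) =
       (\<Sum>m<k. (gaussian_deriv m (\<epsilon> * x + 0) / fact m) * (\<epsilon> * lam i * s) ^ m) +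
       gaussian_deriv k (\<epsilon> * x + \<theta>) / fact k * (\<epsilon> * lam i * s) ^ k" by (rule allI)
    from choice[OF this] obtain \<theta> where \<theta>tay: "\<forall>i. \<bar>\<theta> i\<bar> \<le> \<bar>\<epsilon> * lam i * s\<bar> \<and> gaussian_deriv 0 (\<epsilon> * x + \<epsilon> * lam i * s) =
       (\<Sum>m<k. (gaussian_deriv m (\<epsilon> * x + 0) / fact m) * (\<epsilon> * lam i * s) ^ m) +
       gaussian_deriv k (\<epsilon> * x + \<theta> i) / fact k * (\<epsilon> * lam i * s) ^ k" by (rule exE)
    note \<theta> = \<theta>tay[THEN spec, THEN conjunct1] and tay = \<theta>tay[THEN spec, THEN conjunct2]
    let ?r = "\<lambda>i. gaussian_deriv k (\<epsilon> * x + \<theta> i) / fact k * (\<epsilon> * lam i * s) ^ k"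
    have "(\<Sum>i\<in>I. (\<Sum>m<k. (gaussian_deriv m (\<epsilon> * x + 0) / fact m) * (\<epsilon> * lam i * s) ^ m) *\<^sub>R c i)
       = (\<Sum>m<k. \<Sum>i\<in>I. ((gaussian_deriv m (\<epsilon> * x + 0) / fact m) * (\<epsilon> * lam i * s) ^ m) *\<^sub>R c i)"
      unfolding scaleR_sum_left by (rule sum.swap)
    also have "\<dots> = (\<Sum>m<k. (gaussian_deriv m (\<epsilon> * x) / fact m * (\<epsilon> * s) ^ m) *\<^sub>R (\<Sum>i\<in>I. lam i ^ m *\<^sub>R c i))"
      by (simp add: scaleR_sum_right power_mult_distrib mult_ac)
    also have "\<dots> = 0" using vanish by simp
    finally have poly0: "(\<Sum>i\<in>I. (\<Sum>m<k. (gaussian_deriv m (\<epsilon> * x + 0) / fact m) * (\<epsilon> * lam i * s) ^ m) *\<^sub>R c i) = 0" .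
    have "(\<Sum>i\<in>I. gaussian_deriv 0 (\<epsilon> * (x + lam i * s)) *\<^sub>R c i) = (\<Sum>i\<in>I. gaussian_deriv 0 (\<epsilon> * x + \<epsilon> * lam i * s) *\<^sub>R c i)"
      by (simp add: algebra_simps)
    also have "\<dots> = (\<Sum>i\<in>I. ?r i *\<^sub>R c i)"
      unfolding tay scaleR_add_left sum.distrib poly0 by simp
    also have "norm \<dots> \<le> (\<Sum>i\<in>I. C' * L ^ k * norm (c i) * (\<epsilon> ^ k / (1 + (\<epsilon> * x)\<^sup>2)))"
    proof (rule sum_norm_le)
      fix i assume i: "i \<in> I"
      have "\<bar>lam i * s\<bar> \<le> \<bar>lam i\<bar> * T" using s by (auto simp: abs_mult intro!: mult_left_mono)
      then have ls: "\<bar>lam i * s\<bar> \<le> L" using L[OF i] by linarith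
      have "\<bar>\<epsilon> * (lam i * s)\<bar> \<le> 1 * L"
        unfolding abs_mult using e ls L0[OF i] by (intro mult_mono) (auto simp: abs_mult)
      then have "\<bar>\<theta> i\<bar> \<le> L" using \<theta>[of i] by (simp add: mult.assoc)
      then have "\<bar>gaussian_deriv k (\<epsilon> * x + \<theta> i)\<bar> \<le> C' / (1 + (\<epsilon> * x)\<^sup>2)" by (rule near)
      moreover have "\<bar>gaussian_deriv k (\<epsilon> * x + \<theta> i)\<bar> / fact k \<le> \<bar>gaussian_deriv k (\<epsilon> * x + \<theta> i)\<bar> / 1"
        by (intro divide_left_mono) (auto simp: fact_ge_1)
      ultimately have g: "\<bar>gaussian_deriv k (\<epsilon> * x + \<theta> i)\<bar> / fact k \<le> C' / (1 + (\<epsilon> * x)\<^sup>2)" by simp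
      have "\<bar>\<epsilon> * lam i * s\<bar> ^ k \<le> (\<epsilon> * L) ^ k"
        using e ls by (intro power_mono) (auto simp: abs_mult mult.assoc intro!: mult_left_mono)
      then have "\<bar>gaussian_deriv k (\<epsilon> * x + \<theta> i)\<bar> / fact k * \<bar>\<epsilon> * lam i * s\<bar> ^ k \<le> C' / (1 + (\<epsilon> * x)\<^sup>2) * (\<epsilon> * L) ^ k"
        using g C' by (intro mult_mono) (auto intro!: divide_nonneg_nonneg)
      then have "\<bar>?r i\<bar> \<le> C' / (1 + (\<epsilon> * x)\<^sup>2) * (\<epsilon> * L) ^ k"
        by (simp add: abs_mult power_abs)
      then have "\<bar>?r i\<bar> * norm (c i) \<le> C' / (1 + (\<epsilon> * x)\<^sup>2) * (\<epsilon> * L) ^ k * norm (c i)"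
        by (rule mult_right_mono) simp
      then show "norm (?r i *\<^sub>R c i) \<le> C' * L ^ k * norm (c i) * (\<epsilon> ^ k / (1 + (\<epsilon> * x)\<^sup>2))"
        by (simp add: power_mult_distrib ac_simps)
    qed
    also have "\<dots> = K * \<epsilon> ^ k / (1 + (\<epsilon> * x)\<^sup>2)"
      unfolding sum_distrib_right[symmetric] K_def[symmetric] by simp
    finally show "norm (\<Sum>i\<in>I. gaussian_deriv 0 (\<epsilon> * (x + lam i * s)) *\<^sub>R c i) \<le> K * \<epsilon> ^ k / (1 + (\<epsilon> * x)\<^sup>2)" .
  qed
qed

text \<open>
  Square the pointwise bound and integrate: dilation by \<open>\<epsilon>\<close> turns the integral of the quadratically
  decaying factor into a constant over \<open>\<epsilon>\<close>.
\<close>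
lemma gaussian_observation_le:
  fixes A :: "real^'n^'n" and B :: "real^'m^'n"
  assumes E: "adjoint_eigenbasis A lam e l" and T: "0 < T"
    and v: "\<And>j. j < k \<Longrightarrow> transpose B *v (matpow (transpose A) j *v v) = 0"
  obtains D where "0 \<le> D" "\<And>\<epsilon>. 0 < \<epsilon> \<Longrightarrow> \<epsilon> \<le> 1 \<Longrightarrow>
     observation T \<O> B (adjoint_flow T lam e l (\<lambda>x. gaussian_deriv 0 (\<epsilon> * x) *\<^sub>R v)) \<le> ennreal (D * \<epsilon> ^ (2 * k) / \<epsilon>)"
proof -
  let ?c = "\<lambda>i. (l i \<bullet> v) *\<^sub>R (transpose B *v e i)"
  have van: "(\<Sum>i\<in>UNIV. lam i ^ j *\<^sub>R ?c i) = 0" if "j < k" for j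
    using v[OF that] by (simp only: observed_power_eq_modal_sum[OF E])
  have L: "\<bar>lam i\<bar> * T \<le> (\<Sum>i\<in>UNIV. \<bar>lam i\<bar>) * T" for i
    using T by (intro mult_right_mono member_le_sum) auto
  obtain K where K: "0 \<le> K" "\<And>\<epsilon> s x. 0 < \<epsilon> \<Longrightarrow> \<epsilon> \<le> 1 \<Longrightarrow> 0 \<le> s \<Longrightarrow> s \<le> T \<Longrightarrow>
       norm (\<Sum>i\<in>UNIV. gaussian_deriv 0 (\<epsilon> * (x + lam i * s)) *\<^sub>R ?c i) \<le> K * \<epsilon> ^ k / (1 + (\<epsilon> * x)\<^sup>2)"
    using modal_taylor_bound[OF finite van L less_imp_le[OF T]] by blast
  obtain I where I: "0 \<le> I" "\<And>\<epsilon>. 0 < \<epsilon> \<Longrightarrow> (\<integral>\<^sup>+x. ennreal (1 / (1 + (\<epsilon> * x)\<^sup>2)) \<partial>lborel) = ennreal (I / \<epsilon>)"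
    using nn_integral_inverse_1_plus_power2 by blast
  show ?thesis
  proof
    show "0 \<le> K\<^sup>2 * I * T" using I T by simp
    fix \<epsilon> :: real assume e: "0 < \<epsilon>" "\<epsilon> \<le> 1"
    let ?q = "adjoint_flow T lam e l (\<lambda>x. gaussian_deriv 0 (\<epsilon> * x) *\<^sub>R v)"
    have pt: "(norm (transpose B *v ?q t x))\<^sup>2 \<le> K\<^sup>2 * \<epsilon> ^ (2 * k) * (1 / (1 + (\<epsilon> * x)\<^sup>2))" if "t \<in> {0<..<T}" for t x
    proof -
      have "transpose B *v ?q t x = (\<Sum>i\<in>UNIV. gaussian_deriv 0 (\<epsilon> * (x + lam i * (T - t))) *\<^sub>R ?c i)"
        by (simp add: observed_flow del: transpose_matrix_vector)
      then have "norm (transpose B *v ?q t x) \<le> K * \<epsilon> ^ k / (1 + (\<epsilon> * x)\<^sup>2)"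
        using K(2)[OF e, of "T - t" x] that by simp
      then have "(norm (transpose B *v ?q t x))\<^sup>2 \<le> (K * \<epsilon> ^ k / (1 + (\<epsilon> * x)\<^sup>2))\<^sup>2"
        by (intro power_mono) simp_all
      also have "\<dots> = K\<^sup>2 * \<epsilon> ^ (2 * k) * (1 / (1 + (\<epsilon> * x)\<^sup>2))\<^sup>2"
        by (simp add: power_divide power_mult_distrib power_even_eq)
      also have "\<dots> \<le> K\<^sup>2 * \<epsilon> ^ (2 * k) * (1 / (1 + (\<epsilon> * x)\<^sup>2))"
      proof (rule mult_left_mono)
        have "0 \<le> 1 / (1 + (\<epsilon> * x)\<^sup>2)" "1 / (1 + (\<epsilon> * x)\<^sup>2) \<le> 1" by (auto simp: divide_simps add_pos_nonneg)
        then show "(1 / (1 + (\<epsilon> * x)\<^sup>2))\<^sup>2 \<le> 1 / (1 + (\<epsilon> * x)\<^sup>2)"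
          unfolding power2_eq_square[of "1 / (1 + (\<epsilon> * x)\<^sup>2)"] by (intro mult_left_le)
      qed (use e in simp)
      finally show ?thesis .
    qed
    have slice: "(\<integral>\<^sup>+x\<in>\<O>. ennreal ((norm (transpose B *v ?q t x))\<^sup>2) \<partial>lborel) \<le> ennreal (K\<^sup>2 * \<epsilon> ^ (2 * k) * (I / \<epsilon>))"
      if t: "t \<in> {0<..<T}" for t
    proof -
      have "(\<integral>\<^sup>+x\<in>\<O>. ennreal ((norm (transpose B *v ?q t x))\<^sup>2) \<partial>lborel)
        \<le> (\<integral>\<^sup>+x. ennreal (K\<^sup>2 * \<epsilon> ^ (2 * k)) * ennreal (1 / (1 + (\<epsilon> * x)\<^sup>2)) \<partial>lborel)"
      proof (rule nn_integral_mono)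
        fix x
        have "ennreal ((norm (transpose B *v ?q t x))\<^sup>2) * indicator \<O> x \<le> ennreal ((norm (transpose B *v ?q t x))\<^sup>2) * 1"
          by (intro mult_left_mono) (auto simp: indicator_def)
        also have "\<dots> \<le> ennreal (K\<^sup>2 * \<epsilon> ^ (2 * k) * (1 / (1 + (\<epsilon> * x)\<^sup>2)))"
          using pt[OF t, of x] by (simp only: mult_1_right ennreal_leI)
        also have "\<dots> = ennreal (K\<^sup>2 * \<epsilon> ^ (2 * k)) * ennreal (1 / (1 + (\<epsilon> * x)\<^sup>2))"
          using e by (intro ennreal_mult) auto
        finally show "ennreal ((norm (transpose B *v ?q t x))\<^sup>2) * indicator \<O> x
           \<le> ennreal (K\<^sup>2 * \<epsilon> ^ (2 * k)) * ennreal (1 / (1 + (\<epsilon> * x)\<^sup>2))" .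
      qed
      also have "\<dots> = ennreal (K\<^sup>2 * \<epsilon> ^ (2 * k)) * (\<integral>\<^sup>+x. ennreal (1 / (1 + (\<epsilon> * x)\<^sup>2)) \<partial>lborel)"
        by (rule nn_integral_cmult) measurable
      also have "\<dots> = ennreal (K\<^sup>2 * \<epsilon> ^ (2 * k) * (I / \<epsilon>))"
        unfolding I(2)[OF e(1)] using e I by (intro ennreal_mult[symmetric]) auto
      finally show ?thesis .
    qed
    have "observation T \<O> B ?q \<le> (\<integral>\<^sup>+t. ennreal (K\<^sup>2 * \<epsilon> ^ (2 * k) * (I / \<epsilon>)) * indicator {0<..<T} t \<partial>lborel)"
      unfolding observation_def
    proof (rule nn_integral_mono)
      fix t
      show "(\<integral>\<^sup>+x\<in>\<O>. ennreal ((norm (transpose B *v ?q t x))\<^sup>2) \<partial>lborel) * indicator {0<..<T} t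
         \<le> ennreal (K\<^sup>2 * \<epsilon> ^ (2 * k) * (I / \<epsilon>)) * indicator {0<..<T} t"
        using slice[of t] by (cases "t \<in> {0<..<T}") (simp_all del: transpose_matrix_vector)
    qed
    also have "\<dots> = ennreal (K\<^sup>2 * \<epsilon> ^ (2 * k) * (I / \<epsilon>)) * ennreal T"
      using T by (subst nn_integral_cmult_indicator) auto
    also have "\<dots> = ennreal (K\<^sup>2 * I * T * \<epsilon> ^ (2 * k) / \<epsilon>)"
      using e I T by (subst ennreal_mult[symmetric]) (auto simp: ac_simps)
    finally show "observation T \<O> B ?q \<le> ennreal (K\<^sup>2 * I * T * \<epsilon> ^ (2 * k) / \<epsilon>)" .
  qed
qed

section \<open>The Fourier transform of continuously differentiable integrable functions\<close>

lemma norm_vector_smult: "norm (c *s z) = cmod c * norm z" for z :: "complex^'n"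
  by (simp add: norm_vec_def norm_mult L2_set_right_distrib)

lemma bounded_linear_vector_smult: "bounded_linear (\<lambda>c. c *s z)" for z :: "complex^'n"
proof -
  have "linear (\<lambda>c. c *s z)"
    by (rule linearI) (auto simp: vec_eq_iff distrib_right)
  then show ?thesis using linear_conv_bounded_linear by blast
qed

lemma L2_dist_sq_eq_0_AE:
  assumes [measurable]: "g \<in> borel_measurable borel" "h \<in> borel_measurable borel"
    and "L2_dist_sq g h = 0"
  shows "AE x in lborel. g x = h x"
proof -
  have "AE x in lborel. ennreal ((norm (g x - h x))\<^sup>2) = 0"
    using assms(3) unfolding L2_dist_sq_def by (subst (asm) nn_integral_0_iff_AE) auto
  then show ?thesis by eventually_elim simp
qed

text \<open>
  The parallelogram inequality \<open>\<bar>a + b\<bar>\<^sup>2 \<le> 2 \<bar>a\<bar>\<^sup>2 + 2 \<bar>b\<bar>\<^sup>2\<close> serves as triangle inequality for the squared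
  distance.
\<close>
lemma L2_limit_unique:
  fixes g h :: "real \<Rightarrow> 'b::euclidean_space"
  assumes [measurable]: "g \<in> borel_measurable borel" "h \<in> borel_measurable borel" "\<And>R::real. s R \<in> borel_measurable borel"
    and g: "((\<lambda>R. L2_dist_sq (s R) g) \<longlongrightarrow> 0) at_top" and h: "((\<lambda>R. L2_dist_sq (s R) h) \<longlongrightarrow> 0) at_top"
  shows "AE x in lborel. g x = h x"
proof (rule L2_dist_sq_eq_0_AE)
  have bound: "L2_dist_sq g h \<le> 2 * L2_dist_sq (s R) g + 2 * L2_dist_sq (s R) h" for R
  proof -
    have "ennreal ((norm (g x - h x))\<^sup>2) \<le> 2 * ennreal ((norm (s R x - g x))\<^sup>2) + 2 * ennreal ((norm (s R x - h x))\<^sup>2)" for x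
    proof -
      have "norm (g x - h x) \<le> norm (s R x - g x) + norm (s R x - h x)"
        using norm_triangle_ineq4[of "s R x - h x" "s R x - g x"] by simp
      then have "(norm (g x - h x))\<^sup>2 \<le> (norm (s R x - g x) + norm (s R x - h x))\<^sup>2"
        by (rule power_mono) simp
      also have "\<dots> \<le> 2 * (norm (s R x - g x))\<^sup>2 + 2 * (norm (s R x - h x))\<^sup>2"
        using zero_le_power2[of "norm (s R x - g x) - norm (s R x - h x)"] by (simp add: power2_eq_square algebra_simps)
      finally have "ennreal ((norm (g x - h x))\<^sup>2) \<le> ennreal (2 * (norm (s R x - g x))\<^sup>2 + 2 * (norm (s R x - h x))\<^sup>2)"
        by (rule ennreal_leI)
      then show ?thesis by (simp add: ennreal_plus ennreal_mult)
    qed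
    then have "L2_dist_sq g h \<le> (\<integral>\<^sup>+x. 2 * ennreal ((norm (s R x - g x))\<^sup>2) + 2 * ennreal ((norm (s R x - h x))\<^sup>2) \<partial>lborel)"
      unfolding L2_dist_sq_def by (rule nn_integral_mono)
    also have "\<dots> = 2 * L2_dist_sq (s R) g + 2 * L2_dist_sq (s R) h"
      unfolding L2_dist_sq_def by (simp add: nn_integral_add nn_integral_cmult)
    finally show ?thesis .
  qed
  have "((\<lambda>R. 2 * L2_dist_sq (s R) g + 2 * L2_dist_sq (s R) h) \<longlongrightarrow> 2 * 0 + 2 * 0) at_top"
    using g h by (intro tendsto_add ennreal_tendsto_cmult) auto
  then have "L2_dist_sq g h \<le> 2 * 0 + 2 * 0"
    by (rule tendsto_lowerbound) (simp_all add: bound)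
  then show "L2_dist_sq g h = 0" by simp
qed measurable

text \<open>
  The transform is a chosen limit in mean square, and any limit agrees with it almost everywhere.
  This allows computing with an explicit representative.
\<close>
lemma fourier_eq_L2_limit:
  assumes g: "g \<in> L2_on UNIV" and lim: "((\<lambda>R. L2_dist_sq (truncated_fourier R f) g) \<longlongrightarrow> 0) at_top"
    and m: "\<And>R. truncated_fourier R f \<in> borel_measurable borel"
  shows "AE \<xi> in lborel. fourier f \<xi> = g \<xi>"
proof -
  have "fourier f \<in> L2_on UNIV \<and> ((\<lambda>R. L2_dist_sq (truncated_fourier R f) (fourier f)) \<longlongrightarrow> 0) at_top"
    unfolding fourier_def by (rule someI[of _ g]) (use g lim in blast)
  then show ?thesis
    using g lim m by (intro L2_limit_unique[of _ _ "\<lambda>R. truncated_fourier R f"]) (auto simp: L2_on_UNIV_iff)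
qed

lemma L2_of_decay:
  fixes F :: "real \<Rightarrow> 'b::euclidean_space"
  assumes [measurable]: "F \<in> borel_measurable borel" and F: "\<And>\<xi>. (1 + \<xi>\<^sup>2) * (norm (F \<xi>))\<^sup>2 \<le> C"
  shows "integrable lborel (\<lambda>\<xi>. (norm (F \<xi>))\<^sup>2)"
    and "(\<integral>\<^sup>+\<xi>. ennreal ((norm (F \<xi>))\<^sup>2) \<partial>lborel) \<le> ennreal (C * (LINT \<xi>|lborel. 1 / (1 + \<xi>\<^sup>2)))"
proof -
  have le: "(norm (F \<xi>))\<^sup>2 \<le> C * (1 / (1 + \<xi>\<^sup>2))" for \<xi>
  proof -
    have "0 < 1 + \<xi>\<^sup>2" by (simp add: add_pos_nonneg)
    then show ?thesis using F[of \<xi>] by (simp add: pos_le_divide_eq mult.commute)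
  qed
  have C: "0 \<le> C" using F[of 0] by (meson order_trans mult_nonneg_nonneg zero_le_power2 add_nonneg_nonneg zero_le_one)
  have i: "integrable lborel (\<lambda>\<xi>. C * (1 / (1 + \<xi>\<^sup>2)))"
    by (intro integrable_mult_right integrable_inverse_1_plus_power2)
  then show "integrable lborel (\<lambda>\<xi>. (norm (F \<xi>))\<^sup>2)"
    by (rule Bochner_Integration.integrable_bound) (use le C in \<open>auto intro!: AE_I2\<close>)
  have "(\<integral>\<^sup>+\<xi>. ennreal ((norm (F \<xi>))\<^sup>2) \<partial>lborel) \<le> (\<integral>\<^sup>+\<xi>. ennreal (C * (1 / (1 + \<xi>\<^sup>2))) \<partial>lborel)"
    by (intro nn_integral_mono ennreal_leI le)
  also have "\<dots> = ennreal (LINT \<xi>|lborel. C * (1 / (1 + \<xi>\<^sup>2)))"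
    by (rule nn_integral_eq_integral[OF i]) (use C in auto)
  finally show "(\<integral>\<^sup>+\<xi>. ennreal ((norm (F \<xi>))\<^sup>2) \<partial>lborel) \<le> ennreal (C * (LINT \<xi>|lborel. 1 / (1 + \<xi>\<^sup>2)))"
    by (simp only: integral_mult_right_zero)
qed

definition fourier_L1 :: "(real \<Rightarrow> real) \<Rightarrow> real \<Rightarrow> complex" where
  "fourier_L1 f \<xi> = (LINT x|lborel. exp (- \<i> * of_real (x * \<xi>)) * of_real (f x))"

lemma fourier_kernel_integrable:
  assumes f: "integrable lborel f"
  shows "integrable lborel (\<lambda>x. exp (- \<i> * of_real (x * \<xi>)) * of_real (f x :: real))"
proof (rule Bochner_Integration.integrable_bound[OF f])
  have [measurable]: "f \<in> borel_measurable borel" using f by auto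
  show "(\<lambda>x. exp (- \<i> * of_real (x * \<xi>)) * of_real (f x)) \<in> borel_measurable lborel" by measurable
qed (auto simp: norm_mult norm_exp_eq_Re)

lemma set_integral_indicator_tendsto:
  fixes g :: "real \<Rightarrow> 'b::{banach, second_countable_topology}"
  assumes "integrable lborel g"
  shows "((\<lambda>R. LINT x:{-R..R}|lborel. g x) \<longlongrightarrow> (LINT x|lborel. g x)) at_top"
  unfolding set_lebesgue_integral_def
proof (rule integral_dominated_convergence_at_top[where w = "\<lambda>x. norm (g x)"])
  have [measurable]: "g \<in> borel_measurable borel" using assms by auto
  show "(\<lambda>x. indicat_real {- t..t} x *\<^sub>R g x) \<in> borel_measurable lborel" for t by measurable
  show "g \<in> borel_measurable lborel" by measurable
  show "integrable lborel (\<lambda>x. norm (g x))" using assms by simp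
  show "\<forall>\<^sub>F R in at_top. AE x in lborel. norm (indicat_real {- R..R} x *\<^sub>R g x) \<le> norm (g x)"
    by (intro always_eventually allI AE_I2) (auto simp: indicator_def)
  show "AE x in lborel. ((\<lambda>R. indicat_real {- R..R} x *\<^sub>R g x) \<longlongrightarrow> g x) at_top"
  proof (rule AE_I2)
    fix x
    have "\<forall>\<^sub>F R in at_top. indicat_real {- R..R} x *\<^sub>R g x = g x"
      using eventually_ge_at_top[of "\<bar>x\<bar>"] by eventually_elim (auto simp: indicator_def)
    then show "((\<lambda>R. indicat_real {- R..R} x *\<^sub>R g x) \<longlongrightarrow> g x) at_top"
      by (rule tendsto_eventually)
  qed
qed

lemma integral_minus_set_integral:
  fixes g :: "real \<Rightarrow> 'b::{banach, second_countable_topology}"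
  assumes "integrable lborel g" "S \<in> sets borel"
  shows "(LINT x|lborel. g x) - (LINT x:S|lborel. g x) = (LINT x:-S|lborel. g x)"
proof -
  have "integrable lborel (\<lambda>x. indicator S x *\<^sub>R g x)"
    using integrable_mult_indicator[OF _ assms(1), of S] assms(2) by simp
  then have "(LINT x|lborel. g x) - (LINT x:S|lborel. g x) = (LINT x|lborel. g x - indicator S x *\<^sub>R g x)"
    unfolding set_lebesgue_integral_def by (intro Bochner_Integration.integral_diff[symmetric] assms)
  also have "\<dots> = (LINT x:-S|lborel. g x)"
    unfolding set_lebesgue_integral_def by (intro Bochner_Integration.integral_cong) (auto simp: indicator_def)
  finally show ?thesis .
qed

text \<open>
  The error of truncation is the integral over \<open>\<bar>x\<bar> > R\<close>. It is bounded by the tail of \<open>f\<close> directly and,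
  after one integration by parts, by boundary values and the tail of \<open>f'\<close> divided by \<open>\<bar>\<xi>\<bar>\<close>. Together
  this gives decay in \<open>\<xi>\<close> that is square integrable, uniformly in \<open>R\<close>.
\<close>
lemma fourier_tail_bound:
  fixes f f' :: "real \<Rightarrow> real"
  assumes d: "\<And>x. (f has_real_derivative f' x) (at x)" and c: "continuous_on UNIV f'"
    and f: "integrable lborel f" and f': "integrable lborel f'"
    and top: "(f \<longlongrightarrow> 0) at_top" and bot: "((\<lambda>x. f (- x)) \<longlongrightarrow> 0) at_top"
    and R: "0 \<le> R"
  defines "\<eta> \<equiv> \<bar>f R\<bar> + \<bar>f (- R)\<bar> + (LINT x:-{-R..R}|lborel. \<bar>f x\<bar> + \<bar>f' x\<bar>)"
  shows "(1 + \<xi>\<^sup>2) * (norm (fourier_L1 f \<xi> - (LINT x:{-R..R}|lborel. exp (- \<i> * of_real (x * \<xi>)) * of_real (f x))))\<^sup>2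
     \<le> 2 * \<eta>\<^sup>2"
proof -
  let ?e = "\<lambda>x. exp (- \<i> * of_real (x * \<xi>))"
  let ?h = "\<lambda>x. ?e x * of_real (f x)"
  let ?h' = "\<lambda>x. - \<i> * of_real \<xi> * (?e x * of_real (f x)) + ?e x * of_real (f' x)"
  let ?S = "{-R..R}"
  let ?t = "LINT x:-?S|lborel. ?e x * of_real (f x)"
  let ?t' = "LINT x:-?S|lborel. ?e x * of_real (f' x)"
  have fi: "integrable lborel ?h" and fi': "integrable lborel (\<lambda>x. ?e x * of_real (f' x))"
    by (rule fourier_kernel_integrable[OF f], rule fourier_kernel_integrable[OF f'])
  then have hi: "integrable lborel ?h'" by (intro Bochner_Integration.integrable_add integrable_mult_right)
  have dh: "(?h has_vector_derivative ?h' x) (at x)" for x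
  proof -
    have e: "(?e has_vector_derivative (- \<i> * of_real \<xi>) * ?e x) (at x)"
    proof -
      have kernel: "t *\<^sub>R (- \<i> * of_real \<xi>) = - \<i> * of_real (t * \<xi>)" for t
        by (simp add: scaleR_conv_of_real mult_ac)
      show ?thesis
        using exp_scaleR_has_vector_derivative_right[of "- \<i> * of_real \<xi>" x UNIV]
        unfolding kernel by (simp only: mult.commute)
    qed
    have "((\<lambda>x. complex_of_real (f x)) has_vector_derivative of_real (f' x)) (at x)"
      using d[of x] by (intro has_vector_derivative_of_real) (simp add: has_real_derivative_iff_has_vector_derivative)
    from has_vector_derivative_mult[OF e this] show ?thesis by (simp add: algebra_simps)
  qed
  have ch: "continuous_on S ?h'" for S
  proof -
    have "continuous_on UNIV f" using d by (intro continuous_at_imp_continuous_on) (auto intro: DERIV_isCont)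
    then have "continuous_on S f" "continuous_on S f'" using c continuous_on_subset by blast+
    then show ?thesis by (intro continuous_intros)
  qed
  have FTC: "(LINT x:{-r..r}|lborel. ?h' x) = ?h r - ?h (- r)" if "0 \<le> r" for r
    unfolding set_lebesgue_integral_def
    by (rule integral_FTC_atLeastAtMost) (use that dh ch in \<open>auto intro: has_vector_derivative_at_within\<close>)
  have "(LINT x|lborel. ?h' x) = 0"
  proof (rule tendsto_unique[OF _ set_integral_indicator_tendsto[OF hi]])
    have "((\<lambda>r. ?h r - ?h (- r)) \<longlongrightarrow> 0) at_top"
    proof (rule Lim_null_comparison)
      show "\<forall>\<^sub>F r in at_top. norm (?h r - ?h (- r)) \<le> \<bar>f r\<bar> + \<bar>f (- r)\<bar>"
        by (intro always_eventually allI order_trans[OF norm_triangle_ineq4]) (simp add: norm_mult norm_exp_eq_Re)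
      show "((\<lambda>r. \<bar>f r\<bar> + \<bar>f (- r)\<bar>) \<longlongrightarrow> 0) at_top"
        using tendsto_add[OF tendsto_rabs_zero[OF top] tendsto_rabs_zero[OF bot]] by simp
    qed
    moreover have "\<forall>\<^sub>F r in at_top. ?h r - ?h (- r) = (LINT x:{-r..r}|lborel. ?h' x)"
      using eventually_ge_at_top[of 0] by eventually_elim (simp only: FTC)
    ultimately show "((\<lambda>r. LINT x:{-r..r}|lborel. ?h' x) \<longlongrightarrow> 0) at_top"
      by (rule Lim_transform_eventually)
  qed simp
  then have "(LINT x:-?S|lborel. ?h' x) = - (?h R - ?h (- R))"
    using integral_minus_set_integral[OF hi, of ?S] FTC[OF R] by simp
  moreover have "(LINT x:-?S|lborel. ?h' x) = - \<i> * of_real \<xi> * ?t + ?t'"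
  proof -
    have s: "set_integrable lborel (-?S) ?h" "set_integrable lborel (-?S) (\<lambda>x. ?e x * of_real (f' x))"
      unfolding set_integrable_def by (rule integrable_mult_indicator[OF _ fi], simp, rule integrable_mult_indicator[OF _ fi'], simp)
    have "(LINT x:-?S|lborel. ?h' x) = (LINT x:-?S|lborel. - \<i> * of_real \<xi> * ?h x) + ?t'"
      by (intro set_integral_add(2) set_integrable_mult_right s)
    then show ?thesis by (simp only: set_integral_mult_right)
  qed
  moreover have "X = - d \<Longrightarrow> X = - \<i> * c * t + t' \<Longrightarrow> \<i> * c * t = t' + d" for X c t t' d :: complex
    by (simp add: algebra_simps)
  ultimately have "\<i> * of_real \<xi> * ?t = ?t' + (?h R - ?h (- R))" by blast
  then have "norm (\<i> * of_real \<xi> * ?t) \<le> norm ?t' + norm (?h R - ?h (- R))"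
    by (simp only: norm_triangle_ineq)
  also have "norm (?h R - ?h (- R)) \<le> \<bar>f R\<bar> + \<bar>f (- R)\<bar>"
    by (rule order_trans[OF norm_triangle_ineq4]) (simp add: norm_mult norm_exp_eq_Re)
  finally have x: "\<bar>\<xi>\<bar> * norm ?t \<le> norm ?t' + (\<bar>f R\<bar> + \<bar>f (- R)\<bar>)" by (simp add: norm_mult)
  have tail: "norm (LINT x:-?S|lborel. ?e x * of_real (g x)) \<le> (LINT x:-?S|lborel. \<bar>g x\<bar>)" for g
  proof -
    have "norm (LINT x:-?S|lborel. ?e x * of_real (g x)) \<le> (LINT x|lborel. norm (indicator (-?S) x *\<^sub>R (?e x * of_real (g x))))"
      unfolding set_lebesgue_integral_def by (rule integral_norm_bound)
    then show ?thesis by (simp add: set_lebesgue_integral_def norm_mult norm_exp_eq_Re)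
  qed
  have si: "set_integrable lborel (-?S) (\<lambda>x. \<bar>f x\<bar>)" "set_integrable lborel (-?S) (\<lambda>x. \<bar>f' x\<bar>)"
    using integrable_mult_indicator[OF _ integrable_abs[OF f], of "-?S"] integrable_mult_indicator[OF _ integrable_abs[OF f'], of "-?S"]
    by (auto simp: set_integrable_def)
  have nn: "0 \<le> (LINT x:-?S|lborel. \<bar>g x\<bar>)" for g :: "real \<Rightarrow> real"
    unfolding set_lebesgue_integral_def by (intro integral_nonneg_AE AE_I2) (auto simp: indicator_def)
  have \<eta>: "\<eta> = \<bar>f R\<bar> + \<bar>f (- R)\<bar> + ((LINT x:-?S|lborel. \<bar>f x\<bar>) + (LINT x:-?S|lborel. \<bar>f' x\<bar>))"
    unfolding \<eta>_def using si by (subst set_integral_add) auto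
  have 1: "norm ?t \<le> \<eta>" using tail[of f] nn[of f'] unfolding \<eta> by linarith
  have 2: "\<bar>\<xi>\<bar> * norm ?t \<le> \<eta>" using x tail[of f'] nn[of f] unfolding \<eta> by linarith
  have "(norm ?t)\<^sup>2 \<le> \<eta>\<^sup>2" using 1 by (rule power_mono) simp
  moreover have "(\<bar>\<xi>\<bar> * norm ?t)\<^sup>2 \<le> \<eta>\<^sup>2" using 2 by (rule power_mono) simp
  ultimately have "(1 + \<xi>\<^sup>2) * (norm ?t)\<^sup>2 \<le> 2 * \<eta>\<^sup>2" by (simp add: power_mult_distrib distrib_right)
  moreover have "fourier_L1 f \<xi> - (LINT x:?S|lborel. ?e x * of_real (f x)) = ?t"
    unfolding fourier_L1_def by (rule integral_minus_set_integral[OF fi]) simp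
  ultimately show ?thesis by simp
qed

text \<open>
  By the tail bound the truncated transforms converge in mean square to the absolutely convergent
  integral; the case \<open>R = 0\<close> of the same bound shows that the limit is square integrable.
\<close>
lemma fourier_eq_fourier_L1:
  fixes f f' :: "real \<Rightarrow> real" and z :: "complex^'n"
  assumes d: "\<And>x. (f has_real_derivative f' x) (at x)" and c: "continuous_on UNIV f'"
    and f: "integrable lborel f" and f': "integrable lborel f'"
    and top: "(f \<longlongrightarrow> 0) at_top" and bot: "((\<lambda>x. f (- x)) \<longlongrightarrow> 0) at_top"
  shows "AE \<xi> in lborel. fourier (\<lambda>x. of_real (f x) *s z) \<xi> = fourier_L1 f \<xi> *s z"
proof (rule fourier_eq_L2_limit)
  let ?e = "\<lambda>x \<xi>. exp (- \<i> * of_real (x * \<xi>)) :: complex"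
  let ?F = "\<lambda>R \<xi>. LINT x:{-R..R}|lborel. ?e x \<xi> * of_real (f x)"
  let ?\<eta> = "\<lambda>R. \<bar>f R\<bar> + \<bar>f (- R)\<bar> + (LINT x:-{-R..R}|lborel. \<bar>f x\<bar> + \<bar>f' x\<bar>)"
  note tail = fourier_tail_bound[OF d c f f' top bot]
  have [measurable]: "f \<in> borel_measurable borel" using f by auto
  have mF: "?F R \<in> borel_measurable borel" for R
    unfolding set_lebesgue_integral_def by measurable
  have mL: "fourier_L1 f \<in> borel_measurable borel"
    unfolding fourier_L1_def[abs_def] by measurable
  have smult: "(\<lambda>x. g x *s z) \<in> borel_measurable borel" if "g \<in> borel_measurable borel" for g :: "real \<Rightarrow> complex"
    by (rule measurable_compose[OF that])
      (intro borel_measurable_continuous_onI linear_continuous_on bounded_linear_vector_smult)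
  have tr: "truncated_fourier R (\<lambda>x. of_real (f x) *s z) \<xi> = ?F R \<xi> *s z" for R \<xi>
  proof -
    have "integrable lborel (\<lambda>x. indicator {-R..R} x *\<^sub>R (?e x \<xi> * of_real (f x)))"
      by (rule integrable_mult_indicator[OF _ fourier_kernel_integrable[OF f]]) simp
    from integral_bounded_linear[OF bounded_linear_vector_smult this, of z]
    have "(LINT x|lborel. (indicator {-R..R} x *\<^sub>R (?e x \<xi> * of_real (f x))) *s z) = ?F R \<xi> *s z"
      by (simp add: set_lebesgue_integral_def)
    moreover have "(indicator {-R..R} x *\<^sub>R (?e x \<xi> * of_real (f x))) *s z = indicator {-R..R} x *\<^sub>R (?e x \<xi> *s (of_real (f x) *s z))" for x
      by (simp add: vec_eq_iff mult.assoc)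
    ultimately show ?thesis by (simp add: truncated_fourier_def set_lebesgue_integral_def)
  qed
  show "truncated_fourier R (\<lambda>x. of_real (f x) *s z) \<in> borel_measurable borel" for R
    unfolding tr[abs_def] by (rule smult[OF mF])
  have mz: "(\<lambda>\<xi>. (fourier_L1 f \<xi> - ?F R \<xi>) *s z) \<in> borel_measurable borel" for R
    using mL mF by (intro smult borel_measurable_diff)
  have b: "(1 + \<xi>\<^sup>2) * (norm ((fourier_L1 f \<xi> - ?F R \<xi>) *s z))\<^sup>2 \<le> 2 * (?\<eta> R)\<^sup>2 * (norm z)\<^sup>2" if "0 \<le> R" for R \<xi>
    using mult_right_mono[OF tail[OF that, of \<xi>] zero_le_power2[of "norm z"]]
    by (simp only: norm_vector_smult power_mult_distrib mult.assoc)
  have F0: "?F 0 \<xi> = 0" for \<xi>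
  proof -
    have "AE x in lborel. x \<noteq> (0::real)" by (rule AE_lborel_singleton)
    then have "AE x in lborel. indicator {-0..0::real} x *\<^sub>R (?e x \<xi> * of_real (f x)) = 0"
      by eventually_elim (simp add: indicator_def)
    then show ?thesis unfolding set_lebesgue_integral_def by (rule integral_eq_zero_AE)
  qed
  show "(\<lambda>\<xi>. fourier_L1 f \<xi> *s z) \<in> L2_on UNIV"
    using L2_of_decay(1)[OF mz b[OF order_refl], unfolded F0 diff_0_right] smult[OF mL]
    by (simp only: L2_on_UNIV_iff)
  let ?I = "LINT \<xi>|lborel. 1 / (1 + \<xi>\<^sup>2) :: real"
  have dist: "L2_dist_sq (truncated_fourier R (\<lambda>x. of_real (f x) *s z)) (\<lambda>\<xi>. fourier_L1 f \<xi> *s z)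
     \<le> ennreal (2 * (?\<eta> R)\<^sup>2 * (norm z)\<^sup>2 * ?I)" if "0 \<le> R" for R
  proof -
    have "norm (?F R \<xi> *s z - fourier_L1 f \<xi> *s z) = norm ((fourier_L1 f \<xi> - ?F R \<xi>) *s z)" for \<xi>
      by (simp only: vector_sub_rdistrib norm_minus_commute)
    then show ?thesis
      using L2_of_decay(2)[OF mz b[OF that]] by (simp only: L2_dist_sq_def tr)
  qed
  have "(?\<eta> \<longlongrightarrow> 0) at_top"
  proof -
    have i: "integrable lborel (\<lambda>x. \<bar>f x\<bar> + \<bar>f' x\<bar>)" using f f' by simp
    have "((\<lambda>R. (LINT x|lborel. \<bar>f x\<bar> + \<bar>f' x\<bar>) - (LINT x:{-R..R}|lborel. \<bar>f x\<bar> + \<bar>f' x\<bar>)) \<longlongrightarrow>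
       (LINT x|lborel. \<bar>f x\<bar> + \<bar>f' x\<bar>) - (LINT x|lborel. \<bar>f x\<bar> + \<bar>f' x\<bar>)) at_top"
      by (intro tendsto_diff tendsto_const set_integral_indicator_tendsto i)
    then have "((\<lambda>R. LINT x:-{-R..R}|lborel. \<bar>f x\<bar> + \<bar>f' x\<bar>) \<longlongrightarrow> 0) at_top"
      by (simp add: integral_minus_set_integral[OF i])
    from tendsto_add[OF tendsto_add[OF tendsto_rabs_zero[OF top] tendsto_rabs_zero[OF bot]] this]
    show ?thesis by simp
  qed
  then have "((\<lambda>R. 2 * (?\<eta> R)\<^sup>2 * (norm z)\<^sup>2 * ?I) \<longlongrightarrow> 2 * 0\<^sup>2 * (norm z)\<^sup>2 * ?I) at_top"
    by (intro tendsto_mult tendsto_power tendsto_const)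
  then have "((\<lambda>R. 2 * (?\<eta> R)\<^sup>2 * (norm z)\<^sup>2 * ?I) \<longlongrightarrow> 0) at_top" by simp
  from tendsto_ennrealI[OF this]
  have lim: "((\<lambda>R. ennreal (2 * (?\<eta> R)\<^sup>2 * (norm z)\<^sup>2 * ?I)) \<longlongrightarrow> 0) at_top" by simp
  show "((\<lambda>R. L2_dist_sq (truncated_fourier R (\<lambda>x. of_real (f x) *s z)) (\<lambda>\<xi>. fourier_L1 f \<xi> *s z)) \<longlongrightarrow> 0) at_top"
  proof (rule tendsto_sandwich[OF _ _ tendsto_const lim])
    show "\<forall>\<^sub>F R in at_top. L2_dist_sq (truncated_fourier R (\<lambda>x. of_real (f x) *s z)) (\<lambda>\<xi>. fourier_L1 f \<xi> *s z)
       \<le> ennreal (2 * (?\<eta> R)\<^sup>2 * (norm z)\<^sup>2 * ?I)"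
      using eventually_ge_at_top[of 0] by eventually_elim (rule dist)
  qed simp
qed

lemma gaussian_deriv_integrable: "integrable lborel (gaussian_deriv j)"
proof -
  obtain C where C: "0 \<le> C" "\<And>x. \<bar>gaussian_deriv j x\<bar> \<le> C / (1 + x\<^sup>2)"
    using gaussian_deriv_decay by blast
  have "integrable lborel (\<lambda>x::real. C * (1 / (1 + x\<^sup>2)))"
    by (intro integrable_mult_right integrable_inverse_1_plus_power2)
  then show ?thesis
    by (rule Bochner_Integration.integrable_bound) (use C in \<open>auto intro!: AE_I2\<close>)
qed

text \<open>
  This is the characteristic function of the standard normal distribution, up to normalisation.
\<close>
lemma fourier_L1_gaussian: "fourier_L1 (gaussian_deriv 0) \<xi> = of_real (sqrt (2 * pi) * exp (- (\<xi>\<^sup>2) / 2))"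
proof -
  have "char std_normal_distribution (- \<xi>) = (LINT x|lborel. std_normal_density x *\<^sub>R iexp (- \<xi> * x))"
    unfolding char_def by (subst integral_density) (auto simp: normal_density_nonneg)
  also have "\<dots> = (LINT x|lborel. of_real (1 / sqrt (2 * pi)) * (exp (- \<i> * of_real (x * \<xi>)) * of_real (gaussian_deriv 0 x)))"
    by (intro Bochner_Integration.integral_cong)
      (auto simp: std_normal_density_def gaussian_deriv_0 scaleR_conv_of_real mult_ac)
  also have "\<dots> = of_real (1 / sqrt (2 * pi)) * fourier_L1 (gaussian_deriv 0) \<xi>"
    by (simp only: fourier_L1_def integral_mult_right_zero)
  finally have "of_real (sqrt (2 * pi)) * char std_normal_distribution (- \<xi>)
      = of_real (sqrt (2 * pi)) * (of_real (1 / sqrt (2 * pi)) * fourier_L1 (gaussian_deriv 0) \<xi>)"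
    by (simp only:)
  moreover have "of_real (sqrt (2 * pi)) * (of_real (1 / sqrt (2 * pi)) * w) = w" for w :: complex
    by (simp flip: mult.assoc of_real_mult)
  ultimately show ?thesis by (simp add: char_std_normal_distribution)
qed

lemma fourier_L1_dilate:
  assumes "0 < \<epsilon>"
  shows "fourier_L1 (\<lambda>x. f (\<epsilon> * x)) \<xi> = of_real (1 / \<epsilon>) * fourier_L1 f (\<xi> / \<epsilon>)"
proof -
  have "fourier_L1 f (\<xi> / \<epsilon>) = \<bar>\<epsilon>\<bar> *\<^sub>R (LINT x|lborel. exp (- \<i> * of_real ((0 + \<epsilon> * x) * (\<xi> / \<epsilon>))) * of_real (f (0 + \<epsilon> * x)))"
    unfolding fourier_L1_def by (rule lborel_integral_real_affine) (use assms in simp)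
  also have "\<dots> = of_real \<epsilon> * fourier_L1 (\<lambda>x. f (\<epsilon> * x)) \<xi>"
    using assms by (simp add: fourier_L1_def scaleR_conv_of_real)
  finally show ?thesis using assms by simp
qed

lemma fourier_real_gaussian:
  fixes v :: "real^'n"
  assumes e: "0 < \<epsilon>"
  shows "AE \<xi> in lborel. fourier_real (\<lambda>x. gaussian_deriv 0 (\<epsilon> * x) *\<^sub>R v) \<xi>
     = cvec ((sqrt (2 * pi) / \<epsilon> * exp (- ((\<xi> / \<epsilon>)\<^sup>2) / 2)) *\<^sub>R v)"
proof -
  let ?f = "\<lambda>x. gaussian_deriv 0 (\<epsilon> * x)"
  let ?f' = "\<lambda>x. gaussian_deriv 1 (\<epsilon> * x) * \<epsilon>"
  have i: "integrable lborel (\<lambda>x. gaussian_deriv j (\<epsilon> * x))" for j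
    using lborel_integrable_real_affine[OF gaussian_deriv_integrable, of \<epsilon> j 0] e by simp
  have lim: "((\<lambda>x. gaussian_deriv 0 (a * x)) \<longlongrightarrow> 0) at_top" if "a \<noteq> 0" for a
    unfolding gaussian_deriv_0 using that by real_asymp
  have "AE \<xi> in lborel. fourier (\<lambda>x. of_real (?f x) *s cvec v) \<xi> = fourier_L1 ?f \<xi> *s cvec v"
  proof (rule fourier_eq_fourier_L1[where f' = ?f'])
    show "(?f has_real_derivative ?f' x) (at x)" for x
      by (rule DERIV_chain2[OF DERIV_gaussian_deriv[of 0, folded One_nat_def]]) (auto intro!: derivative_eq_intros)
    have c: "continuous_on UNIV (gaussian_deriv 1)"
      by (intro continuous_at_imp_continuous_on ballI DERIV_isCont[OF DERIV_gaussian_deriv])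
    have "continuous_on UNIV (\<lambda>x. gaussian_deriv 1 (\<epsilon> * x))"
      by (rule continuous_on_compose2[OF c]) (auto intro!: continuous_intros)
    then show "continuous_on UNIV ?f'" by (rule continuous_on_mult_right)
    show "integrable lborel ?f" "integrable lborel ?f'" using i by auto
    show "(?f \<longlongrightarrow> 0) at_top" "((\<lambda>x. ?f (- x)) \<longlongrightarrow> 0) at_top"
      using lim[of \<epsilon>] lim[of "- \<epsilon>"] e by auto
  qed
  moreover have "(\<lambda>x. cvec (?f x *\<^sub>R v)) = (\<lambda>x. of_real (?f x) *s cvec v)"
    by (auto simp: cvec_def vec_eq_iff fun_eq_iff)
  moreover have "fourier_L1 ?f \<xi> *s cvec v = cvec ((sqrt (2 * pi) / \<epsilon> * exp (- ((\<xi> / \<epsilon>)\<^sup>2) / 2)) *\<^sub>R v)" for \<xi>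
    by (simp add: fourier_L1_dilate[OF e, of "gaussian_deriv 0"] fourier_L1_gaussian cvec_def vec_eq_iff)
  ultimately show ?thesis unfolding fourier_real_def by (simp only:)
qed

section \<open>Failure of observability for stronger weights\<close>

text \<open>
  On the frequencies between \<open>\<epsilon> / 2\<close> and \<open>\<epsilon>\<close> both factors of the integrand are bounded below by their
  order of magnitude: \<open>\<xi>\<close> is comparable to \<open>\<epsilon>\<close>, and the Gaussian has not yet decayed.
\<close>
lemma gaussian_layer_norm_ge:
  fixes A :: "real^'n^'n" and B :: "real^'m^'n"
  assumes v: "v \<in> kalman_layer A B k" and e: "0 < \<epsilon>" and M: "0 \<le> M"
    and w: "\<And>\<xi>. 0 < \<xi> \<Longrightarrow> \<xi> < \<epsilon> \<Longrightarrow> M * \<xi> ^ (2 * k) \<le> w \<xi>"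
  shows "ennreal (M * (pi * exp (-1) * (norm v)\<^sup>2 / 4 ^ k) * \<epsilon> ^ (2 * k) / \<epsilon>)
     \<le> layer_norm_sq A B k w (\<lambda>x. gaussian_deriv 0 (\<epsilon> * x) *\<^sub>R v)"
proof -
  define h where "h = (\<lambda>\<xi>. sqrt (2 * pi) / \<epsilon> * exp (- ((\<xi> / \<epsilon>)\<^sup>2) / 2))"
  let ?q = "\<lambda>x. gaussian_deriv 0 (\<epsilon> * x) *\<^sub>R v"
  define m where "m = M * (\<epsilon> / 2) ^ (2 * k) * (2 * pi / \<epsilon>\<^sup>2 * exp (-1) * (norm v)\<^sup>2)"
  have m0: "0 \<le> m" using M e by (simp add: m_def)
  have "AE \<xi> in lborel. fourier_real ?q \<xi> = cvec (h \<xi> *\<^sub>R v)"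
    using fourier_real_gaussian[OF e, of v] by (simp add: h_def)
  then have "AE \<xi> in lebesgue. fourier_real ?q \<xi> = cvec (h \<xi> *\<^sub>R v)"
    by (rule AE_completion)
  then have "AE \<xi> in lebesgue. ennreal m * indicator {\<epsilon>/2<..<\<epsilon>} \<xi> \<le> ennreal (w \<xi> * (norm (kalman_proj A B k (fourier_real ?q \<xi>)))\<^sup>2)"
  proof eventually_elim
    case (elim \<xi>)
    show ?case
    proof (cases "\<xi> \<in> {\<epsilon>/2<..<\<epsilon>}")
      case True
      then have xi: "0 < \<xi>" "\<xi> < \<epsilon>" "\<epsilon> / 2 \<le> \<xi>" using e by auto
      have "h \<xi> *\<^sub>R v \<in> kalman_layer A B k" using v by (rule subspace_scale[OF subspace_kalman_layer])
      then have n: "(norm (kalman_proj A B k (fourier_real ?q \<xi>)))\<^sup>2 = (h \<xi>)\<^sup>2 * (norm v)\<^sup>2"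
        by (simp add: elim kalman_proj_cvec norm_cvec power_mult_distrib)
      have "(\<xi> / \<epsilon>)\<^sup>2 \<le> 1" using xi e by (intro power_le_one) auto
      then have "exp (-1) \<le> exp (- ((\<xi> / \<epsilon>)\<^sup>2))" by simp
      also have "\<dots> = (exp (- ((\<xi> / \<epsilon>)\<^sup>2) / 2))\<^sup>2" by (simp add: power2_eq_square flip: exp_add)
      finally have "2 * pi / \<epsilon>\<^sup>2 * exp (-1) \<le> 2 * pi / \<epsilon>\<^sup>2 * (exp (- ((\<xi> / \<epsilon>)\<^sup>2) / 2))\<^sup>2"
        by (rule mult_left_mono) simp
      also have "\<dots> = (h \<xi>)\<^sup>2" by (simp add: h_def power_mult_distrib power_divide)
      finally have h: "2 * pi / \<epsilon>\<^sup>2 * exp (-1) * (norm v)\<^sup>2 \<le> (h \<xi>)\<^sup>2 * (norm v)\<^sup>2"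
        by (rule mult_right_mono) simp
      have "M * (\<epsilon> / 2) ^ (2 * k) \<le> M * \<xi> ^ (2 * k)"
        using M e xi by (intro mult_left_mono power_mono) auto
      also have "\<dots> \<le> w \<xi>" using w xi by blast
      finally have w': "M * (\<epsilon> / 2) ^ (2 * k) \<le> w \<xi>" .
      moreover have "0 \<le> M * (\<epsilon> / 2) ^ (2 * k)" using M e by simp
      ultimately have "m \<le> w \<xi> * ((h \<xi>)\<^sup>2 * (norm v)\<^sup>2)"
        unfolding m_def by (intro mult_mono h) (auto intro: order_trans)
      then show ?thesis using True by (simp add: n ennreal_leI)
    qed simp
  qed
  then have "(\<integral>\<^sup>+\<xi>. ennreal m * indicator {\<epsilon>/2<..<\<epsilon>} \<xi> \<partial>lebesgue) \<le> layer_norm_sq A B k w ?q"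
    unfolding layer_norm_sq_def by (rule nn_integral_mono_AE)
  also have "(\<integral>\<^sup>+\<xi>. ennreal m * indicator {\<epsilon>/2<..<\<epsilon>} \<xi> \<partial>lebesgue) = ennreal m * ennreal (\<epsilon> / 2)"
    using e by (subst nn_integral_cmult_indicator) (auto simp: emeasure_lborel_Ioo)
  also have "\<dots> = ennreal (m * (\<epsilon> / 2))" using m0 e by (intro ennreal_mult[symmetric]) auto
  also have "m * (\<epsilon> / 2) = M * (pi * exp (-1) * (norm v)\<^sup>2 / 4 ^ k) * \<epsilon> ^ (2 * k) / \<epsilon>"
  proof -
    have "(2::real) ^ (2 * k) = 4 ^ k" by (simp add: power_mult)
    then show ?thesis using e by (simp add: m_def power_divide power2_eq_square field_simps)
  qed
  finally show ?thesis .
qed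

text \<open>
  The two estimates for Gaussian data have the same dependence on \<open>\<epsilon>\<close>, so an observability constant
  \<open>C\<close> would force \<open>M * a \<le> C * D\<close>; the weight admits the choice \<open>M = (C * D + 1) / a\<close> near frequency zero.
  Schwartz data suffice, so the statement covers every class of data that contains them and every
  norm that dominates the single layer.
\<close>
theorem weight_not_observable:
  fixes A :: "real^'n^'n" and B :: "real^'m^'n" and N2 :: "(real \<Rightarrow> real^'n) \<Rightarrow> ennreal"
  assumes diag: "diagonalizable_over_reals A" and T: "0 < T"
    and layer: "kalman_layer A B k \<noteq> {0}" and w: "stronger_at_zero k w"
    and X: "schwartz \<subseteq> X" and N2: "\<And>q. layer_norm_sq A B k w q \<le> N2 q"
  shows "\<not> observable_on X N2 T \<O> A B"
proof
  assume "observable_on X N2 T \<O> A B"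
  then obtain C where C: "0 < C" "\<And>f q. f \<in> X \<Longrightarrow> adjoint_solution T A f q \<Longrightarrow> N2 f \<le> ennreal C * observation T \<O> B q"
    unfolding observable_on_def by blast
  obtain lam e l where E: "adjoint_eigenbasis A lam e l"
    using adjoint_eigenbasis_exists[OF diag] .
  obtain v where v: "v \<in> kalman_layer A B k" "v \<noteq> 0"
    using layer subspace_0[OF subspace_kalman_layer] by blast
  obtain D where D: "0 \<le> D" "\<And>\<epsilon>. 0 < \<epsilon> \<Longrightarrow> \<epsilon> \<le> 1 \<Longrightarrow>
     observation T \<O> B (adjoint_flow T lam e l (\<lambda>x. gaussian_deriv 0 (\<epsilon> * x) *\<^sub>R v)) \<le> ennreal (D * \<epsilon> ^ (2 * k) / \<epsilon>)"
    using gaussian_observation_le[OF E T kalman_layer_unobserved[OF v(1)]] by blast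
  define a where "a = pi * exp (-1) * (norm v)\<^sup>2 / 4 ^ k"
  have a: "0 < a" using v(2) by (simp add: a_def)
  define M where "M = (C * D + 1) / a"
  have M: "0 \<le> M" using C D a by (simp add: M_def)
  have "\<forall>\<^sub>F \<xi> in at 0. M \<le> w \<xi> / \<bar>\<xi>\<bar> ^ (2 * k)"
    using w unfolding stronger_at_zero_def filterlim_at_top by blast
  then obtain \<delta> where \<delta>: "0 < \<delta>" "\<And>\<xi>. \<xi> \<noteq> 0 \<Longrightarrow> \<bar>\<xi>\<bar> < \<delta> \<Longrightarrow> M \<le> w \<xi> / \<bar>\<xi>\<bar> ^ (2 * k)"
    unfolding eventually_at by (auto simp: dist_real_def)
  \<comment> \<open>The cap at \<open>1\<close> is where the bound on the observation starts to hold.\<close>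
  define \<epsilon> where "\<epsilon> = min \<delta> 1"
  have e: "0 < \<epsilon>" "\<epsilon> \<le> 1" "\<epsilon> \<le> \<delta>" using \<delta>(1) by (auto simp: \<epsilon>_def)
  let ?f = "\<lambda>x. gaussian_deriv 0 (\<epsilon> * x) *\<^sub>R v"
  have s: "?f \<in> schwartz" by (rule gaussian_schwartz[OF e(1)])
  have wM: "M * \<xi> ^ (2 * k) \<le> w \<xi>" if "0 < \<xi>" "\<xi> < \<epsilon>" for \<xi>
    using \<delta>(2)[of \<xi>] that e by (simp add: pos_le_divide_eq)
  have "ennreal (M * a * \<epsilon> ^ (2 * k) / \<epsilon>) \<le> layer_norm_sq A B k w ?f"
    unfolding a_def by (rule gaussian_layer_norm_ge[OF v(1) e(1) M wM])
  also have "\<dots> \<le> N2 ?f" by (rule N2)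
  also have "\<dots> \<le> ennreal C * observation T \<O> B (adjoint_flow T lam e l ?f)"
    using s X by (intro C(2) adjoint_flow_solution[OF E schwartz_L2[OF s] T]) auto
  also have "\<dots> \<le> ennreal C * ennreal (D * \<epsilon> ^ (2 * k) / \<epsilon>)"
    by (intro mult_left_mono D(2) e) simp
  also have "\<dots> = ennreal (C * (D * \<epsilon> ^ (2 * k) / \<epsilon>))"
    using C D e by (intro ennreal_mult[symmetric]) auto
  finally have "M * a * \<epsilon> ^ (2 * k) / \<epsilon> \<le> C * (D * \<epsilon> ^ (2 * k) / \<epsilon>)"
    using C D e by (subst (asm) ennreal_le_iff) auto
  then have "M * a * (\<epsilon> ^ (2 * k) / \<epsilon>) \<le> C * D * (\<epsilon> ^ (2 * k) / \<epsilon>)" by simp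
  moreover have "0 < \<epsilon> ^ (2 * k) / \<epsilon>" using e by simp
  ultimately have "M * a \<le> C * D" by (rule mult_right_le_imp_le)
  then show False using a by (simp add: M_def)
qed

theorem theorem5p1:
  fixes A :: "real^'n^'n" and B :: "real^'m^'n" and T :: real and \<O> :: "real set"
  assumes "CARD('m) \<le> CARD('n)"
    and "diagonalizable_over_reals A"
    and "0 < T"
    and "\<O> = UNIV \<or> bounded_gap \<O>"
  shows
    "(kalman_rank A B (CARD('n) - 1) < CARD('n) \<longrightarrow>
       (\<exists>U :: (real^'n) set. subspace U \<and> U \<noteq> {0} \<and>
          (\<forall>v\<in>U. \<forall>t\<in>{0..T}. \<forall>\<xi>::real.
             cmat (transpose B) *v
               (matexp (map_matrix (\<lambda>a. \<i> * of_real (\<xi> * (T - t)) * a) (cmat (transpose A))) *v cvec v)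
             = 0) \<and>
          U = (kalman_space A B (CARD('n) - 1))\<^sup>\<bottom> \<and>
          (\<forall>(X :: (real \<Rightarrow> real^'n) set) normX.
             X \<subseteq> L2_on UNIV \<longrightarrow> seminorm_on X normX \<longrightarrow>
             (\<exists>qT\<in>X. (AE x in lborel. qT x \<in> U) \<and> normX qT \<noteq> 0) \<longrightarrow>
             \<not> observable_on X (\<lambda>qT. ennreal ((normX qT)\<^sup>2)) T \<O> A B)) \<and>
       \<not> exactly_controllable T \<O> A B)
     \<and>
     (\<forall>K. kalman_index A B K \<longrightarrow>
       (\<forall>k w. k \<le> K \<and> kalman_layer A B k \<noteq> {0} \<and> weight w \<and> stronger_at_zero k w \<longrightarrow>
          \<not> observable_on (L2_on UNIV) (layer_norm_sq A B k w) T \<O> A B) \<and>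
       (\<forall>k w. k \<le> K \<and> kalman_layer A B k \<noteq> {0} \<and> (\<forall>j\<le>K. weight (w j)) \<and> stronger_at_zero k (w k) \<longrightarrow>
          \<not> observable_on schwartz (block_norm_sq A B K w) T \<O> A B) \<and>
       (\<forall>k w. k \<le> K \<and> kalman_layer A B k \<noteq> {0} \<and> weight w \<and> stronger_at_zero k w \<longrightarrow>
          \<not> observable_on schwartz (block_norm_sq A B K (rho(k := w))) T \<O> A B))"
proof (intro conjI impI allI)
  let ?U = "(kalman_space A B (CARD('n) - 1))\<^sup>\<bottom>"
  assume rank: "kalman_rank A B (CARD('n) - 1) < CARD('n)"
  have nontrivial: "?U \<noteq> {0}" by (rule unobservable_space_nontrivial[OF rank])
  show "\<exists>U :: (real^'n) set. subspace U \<and> U \<noteq> {0} \<and>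
          (\<forall>v\<in>U. \<forall>t\<in>{0..T}. \<forall>\<xi>::real.
             cmat (transpose B) *v
               (matexp (map_matrix (\<lambda>a. \<i> * of_real (\<xi> * (T - t)) * a) (cmat (transpose A))) *v cvec v)
             = 0) \<and>
          U = (kalman_space A B (CARD('n) - 1))\<^sup>\<bottom> \<and>
          (\<forall>(X :: (real \<Rightarrow> real^'n) set) normX.
             X \<subseteq> L2_on UNIV \<longrightarrow> seminorm_on X normX \<longrightarrow>
             (\<exists>qT\<in>X. (AE x in lborel. qT x \<in> U) \<and> normX qT \<noteq> 0) \<longrightarrow>
             \<not> observable_on X (\<lambda>qT. ennreal ((normX qT)\<^sup>2)) T \<O> A B)"
  proof (intro exI[of _ ?U] conjI ballI allI impI)
    show "cmat (transpose B) *v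
        (matexp (map_matrix (\<lambda>a. \<i> * of_real (\<xi> * (T - t)) * a) (cmat (transpose A))) *v cvec v) = 0"
      if "v \<in> ?U" for v t \<xi>
      by (rule observed_matexp_eq_0[OF unobservable_powers[OF assms(2) that]])
    show "\<not> observable_on X (\<lambda>qT. ennreal ((normX qT)\<^sup>2)) T \<O> A B"
      if "X \<subseteq> L2_on UNIV" "\<exists>qT\<in>X. (AE x in lborel. qT x \<in> ?U) \<and> normX qT \<noteq> 0"
      for X :: "(real \<Rightarrow> real^'n) set" and normX
      using that not_observable_on_unobservable_data[OF assms(2,3) that(1)] by blast
  qed (rule subspace_orthogonal_comp nontrivial refl)+
  obtain v where "v \<in> ?U" "v \<noteq> 0"
    using nontrivial subspace_0[OF subspace_orthogonal_comp, of "kalman_space A B (CARD('n) - 1)"] by blast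
  then show "\<not> exactly_controllable T \<O> A B"
    by (rule not_exactly_controllable[OF assms(2,3)])
next
  \<comment> \<open>The squared norm over all layers dominates its \<open>k\<close>-th summand, so both block norms reduce to one layer.\<close>
  have block: "layer_norm_sq A B k (w k) q \<le> block_norm_sq A B K w q" if "k \<le> K" for k K w q
    unfolding block_norm_sq_def using that by (intro member_le_sum) auto
  fix K k
  show "\<not> observable_on (L2_on UNIV) (layer_norm_sq A B k w) T \<O> A B"
    if "k \<le> K \<and> kalman_layer A B k \<noteq> {0} \<and> weight w \<and> stronger_at_zero k w" for w
    using that by (intro weight_not_observable[OF assms(2,3), of B k w]) (auto intro: schwartz_L2)
  show "\<not> observable_on schwartz (block_norm_sq A B K w) T \<O> A B"
    if "k \<le> K \<and> kalman_layer A B k \<noteq> {0} \<and> (\<forall>j\<le>K. weight (w j)) \<and> stronger_at_zero k (w k)" for w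
    using that by (intro weight_not_observable[OF assms(2,3), of B k "w k"] block) auto
  show "\<not> observable_on schwartz (block_norm_sq A B K (rho(k := w))) T \<O> A B"
    if "k \<le> K \<and> kalman_layer A B k \<noteq> {0} \<and> weight w \<and> stronger_at_zero k w" for w
    using that block[of k K "rho(k := w)"]
    by (intro weight_not_observable[OF assms(2,3), of B k w]) auto
qed

end
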